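(* Let $G$ be an undirected graph with $n$ vertices whose edges are distributed among $s$ sites in the message passing model. Then any (randomized, constant-error) algorithm that correctly outputs a constant fraction of a cluster of $G$ requires $\Omega(ns)$ bits of communication. This holds even when restricted to graphs in which each cluster has constant expansion (and the graph satisfies $\lambda_{k+1}(\mathcal{L}_G)/\rho(k)=\Omega(k^3)$, where $k$ is the number of clusters).
   Context: For a weighted graph $G$: $d_v$ is the weighted degree, $\mu(S)=\sum_{v\in S}d_v$, $\phi_G(S)=w(S,V\setminus S)/\mu(S)$; the $k$-way expansion constant is $\rho(k)=\min_{\text{partitions }A_1,\dots,A_k}\max_i\phi_G(A_i)$, and $\mathcal{L}_G=D_G^{-1/2}(D_G-A_G)D_G^{-1/2}$ is the normalized Laplacian with eigenvalues $\lambda_1\le\dots\le\lambda_n$. The clusters of $G$ are the parts of a $k$-way partition achieving $\rho(k)$. Message passing (coordinator) model: $s$ sites and a coordinator, each site connected to the coordinator by a private two-way channel; the input edges are arbitrarily partitioned among the sites; the coordinator outputs the answer; communication cost is the total number of bits sent.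
   Formalization: The number of sites is assumed to satisfy s ≤ Kn for an arbitrary constant K: since each edge is held by one site, all sites can send their edges with O(n² log n + s) bits in total, so the Ω(ns) bound fails once s grows faster than n log n. *)

theory Defs
  imports
    "HOL-Probability.Probability_Mass_Function"
    "HOL-Library.Disjoint_Sets"
    "HOL-Computational_Algebra.Polynomial"
    "Jordan_Normal_Form.Char_Poly"
begin

section \<open>Weighted graphs, expansion and clusters\<close>

text \<open>
  A weighted graph on a vertex set \<open>V\<close> is a symmetric weight function \<open>w\<close>. Weights are only ever
  read on \<open>V\<close>, so replacing \<open>V\<close> by a subset \<open>A\<close> gives the induced subgraph \<open>G[A]\<close>.
\<close>

type_synonym weight = "nat \<Rightarrow> nat \<Rightarrow> real"

definition degree :: "weight \<Rightarrow> nat set \<Rightarrow> nat \<Rightarrow> real" where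
  "degree w V v = (\<Sum>u\<in>V. w v u)"

definition volume :: "weight \<Rightarrow> nat set \<Rightarrow> nat set \<Rightarrow> real" where
  "volume w V S = (\<Sum>v\<in>S. degree w V v)"

definition cut :: "weight \<Rightarrow> nat set \<Rightarrow> nat set \<Rightarrow> real" where
  "cut w S T = (\<Sum>u\<in>S. \<Sum>v\<in>T. w u v)"

definition conductance :: "weight \<Rightarrow> nat set \<Rightarrow> nat set \<Rightarrow> real" where
  "conductance w V S = cut w S (V - S) / volume w V S"

definition kway_partitions :: "nat set \<Rightarrow> nat \<Rightarrow> nat set set set" where
  "kway_partitions V k = {\<A>. partition_on V \<A> \<and> card \<A> = k}"

definition max_conductance :: "weight \<Rightarrow> nat set \<Rightarrow> nat set set \<Rightarrow> real" where
  "max_conductance w V \<A> = Max (conductance w V ` \<A>)"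

definition expansion_const :: "weight \<Rightarrow> nat set \<Rightarrow> nat \<Rightarrow> real" where
  "expansion_const w V k = Min (max_conductance w V ` kway_partitions V k)"

text \<open>
  An optimal partition need not be unique; a cluster is a part of any one of them.
\<close>

definition is_cluster :: "weight \<Rightarrow> nat set \<Rightarrow> nat \<Rightarrow> nat set \<Rightarrow> bool" where
  "is_cluster w V k A \<longleftrightarrow>
     (\<exists>\<A>\<in>kway_partitions V k. max_conductance w V \<A> = expansion_const w V k \<and> A \<in> \<A>)"

text \<open>
  The expansion of a cluster \<open>A\<close> is the conductance of the induced subgraph \<open>G[A]\<close>, hence degrees
  and volumes are taken inside \<open>A\<close>. (The conductance of \<open>A\<close> in \<open>G\<close> is small for a good cluster.)
\<close>

definition expansion_at_least :: "real \<Rightarrow> weight \<Rightarrow> nat set \<Rightarrow> bool" where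
  "expansion_at_least \<alpha> w A \<longleftrightarrow>
     (\<forall>S. S \<noteq> {} \<and> S \<subset> A \<and> volume w A S \<le> volume w A A / 2 \<longrightarrow> \<alpha> \<le> conductance w A S)"

definition norm_laplacian :: "weight \<Rightarrow> nat \<Rightarrow> real mat" where
  "norm_laplacian w n =
     (let d = degree w {..<n}; R = mat_diag n (\<lambda>i. 1 / sqrt (d i))
      in R * (mat_diag n d - mat n n (\<lambda>(i, j). w i j)) * R)"

text \<open>
  The \<open>i\<close>-th smallest eigenvalue with multiplicity, counted from \<open>i = 1\<close>. The matrices below are
  symmetric, so the characteristic polynomial has \<open>n\<close> real roots.
\<close>

definition eigenvalue_nth :: "real mat \<Rightarrow> nat \<Rightarrow> real" where
  "eigenvalue_nth M i = sorted_list_of_multiset (proots (char_poly M)) ! (i - 1)"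

section \<open>Simple graphs with edges distributed among sites\<close>

definition simple_edges :: "nat \<Rightarrow> nat set set \<Rightarrow> bool" where
  "simple_edges n E \<longleftrightarrow> E \<subseteq> {{u, v} | u v. u < n \<and> v < n \<and> u \<noteq> v}"

definition unit_weight :: "nat set set \<Rightarrow> weight" where
  "unit_weight E u v = (if {u, v} \<in> E then 1 else 0)"

text \<open>
  The restricted graph class: \<open>n\<close> vertices, none isolated (so that the normalized Laplacian and all
  conductances are defined), every cluster has expansion at least \<open>\<alpha>\<close>, and
  $\lambda_{k+1} / \rho(k) \ge C k^3$. For \<open>C > 0\<close> the last condition forces \<open>\<rho>(k) > 0\<close>, since division
  by zero yields zero.
\<close>

definition well_clustered :: "nat \<Rightarrow> nat \<Rightarrow> real \<Rightarrow> real \<Rightarrow> nat set set \<Rightarrow> bool" where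
  "well_clustered n k \<alpha> C E \<longleftrightarrow>
     simple_edges n E \<and>
     (\<forall>v<n. degree (unit_weight E) {..<n} v > 0) \<and>
     (\<forall>A. is_cluster (unit_weight E) {..<n} k A \<longrightarrow> expansion_at_least \<alpha> (unit_weight E) A) \<and>
     eigenvalue_nth (norm_laplacian (unit_weight E) n) (k + 1)
       / expansion_const (unit_weight E) {..<n} k \<ge> C * real k ^ 3"

definition distributed_among :: "nat \<Rightarrow> nat set set \<Rightarrow> (nat \<Rightarrow> nat set set) \<Rightarrow> bool" where
  "distributed_among s E X \<longleftrightarrow> disjoint_family_on X {..<s} \<and> (\<Union>i<s. X i) = E"

definition cluster_fraction :: "real \<Rightarrow> nat \<Rightarrow> nat \<Rightarrow> nat set set \<Rightarrow> nat set \<Rightarrow> bool" where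
  "cluster_fraction c n k E S \<longleftrightarrow>
     (\<exists>A. is_cluster (unit_weight E) {..<n} k A \<and> S \<subseteq> A \<and> real (card S) \<ge> c * real (card A))"

section \<open>The coordinator model\<close>

text \<open>
  The coordinator holds no input, so its deterministic strategy is a decision tree: it sends a bit to
  a site, or receives a bit from a site and branches on it (first subtree: \<open>True\<close>), or outputs. The
  bit produced by site \<open>i\<close> depends only on its own input and on the history of its private channel.
\<close>

datatype 'o coordinator =
    Output 'o
  | Send nat bool "'o coordinator"
  | Receive nat "'o coordinator" "'o coordinator"

datatype message = To_Site bool | From_Site bool

type_synonym 'x site_strategy = "nat \<Rightarrow> 'x \<Rightarrow> message list \<Rightarrow> bool"

type_synonym ('x, 'o) protocol = "'x site_strategy \<times> 'o coordinator"

primrec sites_used :: "'o coordinator \<Rightarrow> nat set" where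
  "sites_used (Output out) = {}"
| "sites_used (Send i b t) = insert i (sites_used t)"
| "sites_used (Receive i t1 t0) = insert i (sites_used t1 \<union> sites_used t0)"

text \<open>The result of an execution is the output together with the number of bits sent.\<close>

primrec execute ::
  "'o coordinator \<Rightarrow> 'x site_strategy \<Rightarrow> (nat \<Rightarrow> 'x) \<Rightarrow> (nat \<Rightarrow> message list) \<Rightarrow> 'o \<times> nat" where
  "execute (Output out) \<sigma> X h = (out, 0)"
| "execute (Send i b t) \<sigma> X h =
     apsnd Suc (execute t \<sigma> X (h(i := h i @ [To_Site b])))"
| "execute (Receive i t1 t0) \<sigma> X h =
     (let b = \<sigma> i (X i) (h i); h' = h(i := h i @ [From_Site b])
      in apsnd Suc (if b then execute t1 \<sigma> X h' else execute t0 \<sigma> X h'))"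

definition output_of :: "('x, 'o) protocol \<Rightarrow> (nat \<Rightarrow> 'x) \<Rightarrow> 'o" where
  "output_of \<pi> X = fst (execute (snd \<pi>) (fst \<pi>) X (\<lambda>_. []))"

definition bits_sent :: "('x, 'o) protocol \<Rightarrow> (nat \<Rightarrow> 'x) \<Rightarrow> nat" where
  "bits_sent \<pi> X = snd (execute (snd \<pi>) (fst \<pi>) X (\<lambda>_. []))"

text \<open>
  A randomized protocol is a distribution over deterministic ones. Thus the coins are shared by all
  parties, which subsumes private coins and only makes a lower bound stronger.
\<close>

definition protocol_for_sites :: "nat \<Rightarrow> ('x, 'o) protocol pmf \<Rightarrow> bool" where
  "protocol_for_sites s P \<longleftrightarrow> (\<forall>\<pi>\<in>set_pmf P. sites_used (snd \<pi>) \<subseteq> {..<s})"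

definition outputs_cluster_fraction ::
  "nat \<Rightarrow> nat \<Rightarrow> nat \<Rightarrow> real \<Rightarrow> real \<Rightarrow> real \<Rightarrow> real
     \<Rightarrow> (nat set set, nat set) protocol pmf \<Rightarrow> bool" where
  "outputs_cluster_fraction n s k \<alpha> C c \<delta> P \<longleftrightarrow>
     (\<forall>E X. well_clustered n k \<alpha> C E \<and> distributed_among s E X \<longrightarrow>
        measure_pmf.prob P {\<pi>. cluster_fraction c n k E (output_of \<pi> X)} \<ge> 1 - \<delta>)"

end

theory Submission
  imports Defs "Jordan_Normal_Form.Schur_Decomposition" "HOL-Probability.Probability"
    "HOL-Number_Theory.Cong"
begin

unbundle no inner_syntax and no vec_syntax

text \<open>
  The hard graphs consist of \<open>k\<close> cliques and many outer vertices arranged in columns. In each column,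
  every one of an odd number \<open>m\<close> of sites holds a private bit, which decides whether it joins the outer
  vertex \<open>t\<close> of the column to clique \<open>t\<close> or to clique \<open>t + 1\<close>. The cliques dominate the volume, so in the
  unique optimal partition every outer vertex belongs to the clique that got most of its edges. The
  cliques are also small compared with the clusters, so a constant fraction of a cluster reveals, up to
  a common complement, the majority bits of linearly many of the \<open>N\<close> columns.

  Let the bits be uniform and let \<open>W v\<close> be the sum of the \<open>m\<close> signs of column \<open>v\<close>. A leaf of a protocol is a
  rectangle, on which the sites are independent and its output fixes the guessed signs. The bias of the
  bits of a site is controlled by its entropy deficit on the rectangle, and the total deficit is on average at
  most the number \<open>B\<close> of bits sent. Hence the signed sum of \<open>W v\<close> over the guessed columns has mean square
  at most \<open>\<epsilon> N\<^sup>2 m\<close> if \<open>B\<close> is a small multiple of \<open>N m\<close>, with \<open>\<epsilon>\<close> small. If the guesses are correct, this sum is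
  the sum of \<open>\<bar>W v\<bar>\<close>, which is of order \<open>N \<surd>m\<close> because \<open>\<bar>W v\<bar>\<close> is rarely much smaller than \<open>\<surd>m\<close>.
\<close>

text \<open>The expansion constant is a maximum, so a partition might misplace a vertex of a part
  that is not extremal without being penalised. The columns remove this obstacle: in every column
  each site gives each core exactly one edge, whatever the bits are. Hence all intended clusters
  have the same cut, and volumes that differ by at most 2, so their maximal conductance is nearly
  their average, and a misplaced vertex, which raises the total cut, is detected by summing over the
  parts. A single leaf may bias many sites in the same direction, so no useful bound on the mean of
  a column holds leaf by leaf. This is why second moments are used: inside a leaf the variances of
  the sites add up, and the squared means are controlled after averaging over the leaves. The number
  \<open>m\<close> of voting sites is capped at a small multiple of \<open>n\<close>, for otherwise
  the cliques would no longer dominate the outer edges. As \<open>s\<close> is at most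
  \<open>K * n\<close>, the cap keeps a constant fraction of \<open>s\<close>.\<close>

section \<open>Eigenvalues of symmetric matrices\<close>

text \<open>The characteristic polynomial has a complex root. It is real because the Hermitian form
  of its eigenvector is real by symmetry and equals the root times a positive number.\<close>

lemma symmetric_real_eigenvalue_exists:
  fixes M :: "real mat"
  assumes M: "M \<in> carrier_mat n n" and sym: "M\<^sup>T = M" and n: "n > 0"
  shows "\<exists>e. eigenvalue M e"
proof -
  let ?A = "map_mat complex_of_real M"
  have A: "?A \<in> carrier_mat n n" using M by simp
  obtain as where as: "char_poly ?A = (\<Prod>a\<leftarrow>as. [:- a, 1:])" "length as = n"
    using char_poly_factorized[OF A] by blast
  then obtain a as' where as': "as = a # as'" using n by (cases as) auto
  have "poly (char_poly ?A) a = 0" unfolding as as' by simp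
  then have "eigenvalue ?A a" using eigenvalue_root_char_poly[OF A] by blast
  then obtain v where v: "v \<in> carrier_vec n" "v \<noteq> 0\<^sub>v n" "?A *\<^sub>v v = a \<cdot>\<^sub>v v"
    using A unfolding eigenvalue_def eigenvector_def by auto
  have Mji: "M $$ (i, j) = M $$ (j, i)" if "i < n" "j < n" for i j
    using that M sym by (metis carrier_matD index_transpose_mat(1))
  define z where "z = (\<Sum>i<n. \<Sum>j<n. of_real (M $$ (i, j)) * v $ j * cnj (v $ i))"
  define w where "w = (\<Sum>i<n. (cmod (v $ i))\<^sup>2)"
  have "cnj z = (\<Sum>i<n. \<Sum>j<n. of_real (M $$ (i, j)) * cnj (v $ j) * v $ i)"
    unfolding z_def by simp
  also have "\<dots> = (\<Sum>j<n. \<Sum>i<n. of_real (M $$ (i, j)) * cnj (v $ j) * v $ i)"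
    by (rule sum.swap)
  also have "\<dots> = z"
    unfolding z_def by (intro sum.cong refl) (simp add: Mji mult_ac)
  finally have "cnj z = z" .
  then have zre: "z = of_real (Re z)" by (simp add: complex_eq_iff)
  have row: "(\<Sum>j<n. of_real (M $$ (i, j)) * v $ j) = a * v $ i" if "i < n" for i
  proof -
    have "(?A *\<^sub>v v) $ i = (\<Sum>j<n. of_real (M $$ (i, j)) * v $ j)"
      using that M v(1) by (simp add: scalar_prod_def atLeast0LessThan)
    then show ?thesis using v that by simp
  qed
  have "z = (\<Sum>i<n. a * v $ i * cnj (v $ i))"
    unfolding z_def by (intro sum.cong refl) (simp add: row flip: sum_distrib_right)
  also have "\<dots> = a * of_real w"
    unfolding w_def of_real_sum sum_distrib_left
    by (intro sum.cong refl) (simp add: mult.assoc complex_norm_square[symmetric])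
  finally have zw: "z = a * of_real w" .
  obtain i where i: "i < n" "v $ i \<noteq> 0"
    using v(1,2) by (metis carrier_vecD eq_vecI index_zero_vec(1) zero_carrier_vec)
  have "w > 0" unfolding w_def
    by (rule sum_pos2[of _ i]) (use i in auto)
  then have a: "a = of_real (Re z / w)" using zw zre by (simp add: field_simps)
  interpret h: comm_ring_hom complex_of_real by standard auto
  have "char_poly ?A = map_poly of_real (char_poly M)" by (rule of_real_hom.char_poly_hom[OF M])
  then have "of_real (poly (char_poly M) (Re z / w)) = (0::complex)"
    using \<open>poly (char_poly ?A) a = 0\<close> a by (metis of_real_hom.poly_map_poly)
  then show ?thesis using eigenvalue_root_char_poly[OF M] by auto
qed

text \<open>Gram-Schmidt keeps the head of its list, so after normalisation the first column is
  still a multiple of \<open>v\<close>. That suffices to split off an eigenvector.\<close>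

lemma orthonormal_completion:
  fixes v :: "real vec"
  assumes v: "v \<in> carrier_vec n" and v0: "v \<noteq> 0\<^sub>v n"
  shows "\<exists>W\<in>carrier_mat n n. W\<^sup>T * W = 1\<^sub>m n \<and> (\<exists>r. col W 0 = r \<cdot>\<^sub>v v)"
proof -
  interpret cof_vec_space n "TYPE(real)" .
  define b where "b = basis_completion v"
  define ws where "ws = gram_schmidt n b"
  have b: "set b \<subseteq> carrier_vec n" "distinct b" "\<not> lin_dep (set b)" "length b = n" "hd b = v"
    using basis_completion[OF v v0] unfolding b_def by auto
  have n: "n \<noteq> 0" using v v0 by (auto intro: eq_vecI)
  have ws: "set ws \<subseteq> carrier_vec n" "corthogonal ws" "length ws = n"
    using gram_schmidt_result[OF b(1-3) ws_def] b(4) by auto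
  obtain vs where bv: "b = v # vs" using b n by (cases b) auto
  have hd: "ws ! 0 = v" using gram_schmidt_hd[OF v, of vs] ws(3) n
    unfolding ws_def bv by (metis hd_conv_nth length_0_conv)
  have wsi: "ws ! i \<in> carrier_vec n" if "i < n" for i using ws that by auto
  have ort: "ws ! i \<bullet> ws ! j = 0 \<longleftrightarrow> i \<noteq> j" if "i < n" "j < n" for i j
    using corthogonalD[OF ws(2), of i j] ws(3) that by (simp)
  define r where "r i = 1 / sqrt (ws ! i \<bullet> ws ! i)" for i
  define W where "W = mat_of_cols n (map (\<lambda>i. r i \<cdot>\<^sub>v ws ! i) [0..<n])"
  have W: "W \<in> carrier_mat n n" unfolding W_def by (auto intro: carrier_matI)
  have cols: "col W i = r i \<cdot>\<^sub>v ws ! i" if "i < n" for i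
    unfolding W_def using that wsi[OF that] by (subst col_mat_of_cols) auto
  have "W\<^sup>T * W = 1\<^sub>m n"
  proof (rule eq_matI)
    fix i j assume "i < dim_row (1\<^sub>m n)" "j < dim_col (1\<^sub>m n)"
    then have ij: "i < n" "j < n" by auto
    have "(W\<^sup>T * W) $$ (i, j) = col W i \<bullet> col W j" using ij W by simp
    also have "\<dots> = r i * r j * (ws ! i \<bullet> ws ! j)"
      unfolding cols[OF ij(1)] cols[OF ij(2)]
      using wsi[OF ij(1)] wsi[OF ij(2)] by (simp add: mult_ac)
    also have "\<dots> = (if i = j then 1 else 0)"
    proof (cases "i = j")
      case True
      have "ws ! j \<bullet> ws ! j \<ge> 0" by (simp add: scalar_prod_def sum_nonneg)
      then have "ws ! j \<bullet> ws ! j > 0" using ort[OF ij(2) ij(2)] by simp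
      then show ?thesis using True by (simp add: r_def)
    qed (use ort ij in auto)
    finally show "(W\<^sup>T * W) $$ (i, j) = 1\<^sub>m n $$ (i, j)" using ij by simp
  qed (use W in auto)
  then show ?thesis using W cols[of 0] hd n by auto
qed

text \<open>Deflation: in an orthonormal basis that starts with an eigenvector, the first column
  vanishes below the diagonal, by symmetry so does the rest of the first row, and the induction
  hypothesis diagonalizes the remaining block.\<close>

lemma symmetric_mat_orthogonally_diagonalizable:
  fixes M :: "real mat"
  assumes "M \<in> carrier_mat n n" and "M\<^sup>T = M"
  shows "\<exists>P\<in>carrier_mat n n. P\<^sup>T * P = 1\<^sub>m n \<and> diagonal_mat (P\<^sup>T * M * P)"
  using assms
proof (induction n arbitrary: M)
  case 0
  then show ?case by (auto intro!: bexI[of _ "1\<^sub>m 0"] simp: diagonal_mat_def)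
next
  case (Suc n)
  note M = Suc.prems(1) and sym = Suc.prems(2)
  obtain e v where v: "v \<in> carrier_vec (Suc n)" "v \<noteq> 0\<^sub>v (Suc n)" "M *\<^sub>v v = e \<cdot>\<^sub>v v"
    using symmetric_real_eigenvalue_exists[OF M sym] M unfolding eigenvalue_def eigenvector_def by auto
  obtain W r where W: "W \<in> carrier_mat (Suc n) (Suc n)" "W\<^sup>T * W = 1\<^sub>m (Suc n)" "col W 0 = r \<cdot>\<^sub>v v"
    using orthonormal_completion[OF v(1,2)] by auto
  define B where "B = W\<^sup>T * M * W"
  have B: "B \<in> carrier_mat (Suc n) (Suc n)" unfolding B_def using W M by auto
  have B2: "B = W\<^sup>T * (M * W)" unfolding B_def using assoc_mult_mat[OF _ M W(1), of "W\<^sup>T" "Suc n"] W(1) by simp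
  have symB: "B\<^sup>T = B"
  proof -
    have "B\<^sup>T = (M * W)\<^sup>T * (W\<^sup>T)\<^sup>T" unfolding B2
      by (rule transpose_mult) (use W M in auto)
    also have "(M * W)\<^sup>T = W\<^sup>T * M" using transpose_mult[OF M W(1)] sym by simp
    finally show ?thesis by (simp add: B_def)
  qed
  have col0: "B $$ (i, 0) = (if i = 0 then e else 0)" if "i < Suc n" for i
  proof -
    have "col (M * W) 0 = M *\<^sub>v col W 0" using M W by (auto intro: col_mult2)
    also have "\<dots> = e \<cdot>\<^sub>v col W 0" unfolding W(3) using v M
      by (simp add: mult_mat_vec smult_smult_assoc mult.commute)
    finally have "B $$ (i, 0) = col W i \<bullet> (e \<cdot>\<^sub>v col W 0)" unfolding B2 using W M that by simp
    also have "\<dots> = e * (col W i \<bullet> col W 0)"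
      using W(1) that by simp
    also have "col W i \<bullet> col W 0 = (W\<^sup>T * W) $$ (i, 0)" using W(1) that by simp
    finally show ?thesis unfolding W(2) using that by simp
  qed
  have row0: "B $$ (0, i) = (if i = 0 then e else 0)" if "i < Suc n" for i
    using col0[OF that] symB B that by (metis carrier_matD index_transpose_mat(1) zero_less_Suc)
  define A where "A = mat n n (\<lambda>(i, j). B $$ (Suc i, Suc j))"
  have A: "A \<in> carrier_mat n n" unfolding A_def by simp
  have E: "mat 1 1 (\<lambda>_. e) \<in> carrier_mat 1 1" by simp
  have Bblock: "B = four_block_mat (mat 1 1 (\<lambda>_. e)) (0\<^sub>m 1 n) (0\<^sub>m n 1) A"
    using B by (intro eq_matI) (auto simp: A_def row0 col0 four_block_mat_def Let_def)
  have "B $$ (Suc i, Suc j) = B $$ (Suc j, Suc i)" if "i < n" "j < n" for i j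
    using symB B that by (metis Suc_less_eq carrier_matD index_transpose_mat(1))
  then have symA: "A\<^sup>T = A" unfolding A_def by (intro eq_matI) auto
  obtain Q where Q: "Q \<in> carrier_mat n n" "Q\<^sup>T * Q = 1\<^sub>m n" "diagonal_mat (Q\<^sup>T * A * Q)"
    using Suc.IH[OF A symA] by blast
  define F where "F = four_block_mat (1\<^sub>m 1) (0\<^sub>m 1 n) (0\<^sub>m n 1) Q"
  have F: "F \<in> carrier_mat (Suc n) (Suc n)" unfolding F_def using Q by auto
  have FT: "F\<^sup>T = four_block_mat (1\<^sub>m 1) (0\<^sub>m 1 n) (0\<^sub>m n 1) Q\<^sup>T"
    unfolding F_def by (subst transpose_four_block_mat) (use Q in auto)
  have QT: "Q\<^sup>T \<in> carrier_mat n n" using Q by simp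
  have one: "(1\<^sub>m 1 :: real mat) \<in> carrier_mat 1 1" by simp
  have FF: "F\<^sup>T * F = 1\<^sub>m (Suc n)"
  proof -
    have "F\<^sup>T * F = four_block_mat (1\<^sub>m 1) (0\<^sub>m 1 n) (0\<^sub>m n 1) (1\<^sub>m n)"
      unfolding FT by (subst F_def, subst mult_four_block_mat[OF one _ _ QT one _ _ Q(1)]) (use Q in auto)
    then show ?thesis using four_block_one_mat[of 1 n] by simp
  qed
  have FBF: "F\<^sup>T * B * F = four_block_mat (mat 1 1 (\<lambda>_. e)) (0\<^sub>m 1 n) (0\<^sub>m n 1) (Q\<^sup>T * A * Q)"
  proof -
    have "F\<^sup>T * B = four_block_mat (mat 1 1 (\<lambda>_. e)) (0\<^sub>m 1 n) (0\<^sub>m n 1) (Q\<^sup>T * A)"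
      unfolding FT Bblock
      by (subst mult_four_block_mat[OF one _ _ QT E _ _ A]) (use Q A in auto)
    then show ?thesis unfolding F_def
      by (simp only:, subst mult_four_block_mat[OF E _ _ mult_carrier_mat[OF QT A] one _ _ Q(1)]) (use Q A in auto)
  qed
  have FTc: "F\<^sup>T \<in> carrier_mat (Suc n) (Suc n)" and WTc: "W\<^sup>T \<in> carrier_mat (Suc n) (Suc n)"
    using F W by auto
  have PT: "(W * F)\<^sup>T = F\<^sup>T * W\<^sup>T" using transpose_mult[OF W(1) F] .
  have "(W * F)\<^sup>T * (W * F) = F\<^sup>T * ((W\<^sup>T * W) * F)"
    unfolding PT using FTc WTc W(1) F by (simp add: assoc_mult_mat[where ?n\<^sub>1.0="Suc n" and ?n\<^sub>2.0="Suc n" and ?n\<^sub>3.0="Suc n" and ?n\<^sub>4.0="Suc n"])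
  then have orth: "(W * F)\<^sup>T * (W * F) = 1\<^sub>m (Suc n)" using W(2) FF F by simp
  have "(W * F)\<^sup>T * M * (W * F) = F\<^sup>T * B * F"
    unfolding PT B_def using FTc WTc W(1) F M
    by (simp add: assoc_mult_mat[where ?n\<^sub>1.0="Suc n" and ?n\<^sub>2.0="Suc n" and ?n\<^sub>3.0="Suc n" and ?n\<^sub>4.0="Suc n"])
  moreover have "diagonal_mat (F\<^sup>T * B * F)"
    unfolding FBF using Q A by (auto simp: diagonal_mat_def four_block_mat_def Let_def)
  ultimately show ?case using orth W(1) F by (metis mult_carrier_mat)
qed

lemma homogeneous_system_nontrivial_solution:
  fixes L :: "real vec list"
  assumes L: "set L \<subseteq> carrier_vec n" and len: "length L < n"
  shows "\<exists>v\<in>carrier_vec n. v \<noteq> 0\<^sub>v n \<and> (\<forall>w\<in>set L. w \<bullet> v = 0)"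
proof -
  \<comment> \<open>Zero rows make the system square. A zero row forces the determinant to vanish,
    and a singular matrix has a kernel vector.\<close>
  define A where "A = mat_of_rows n (L @ replicate (n - length L) (0\<^sub>v n))"
  have A: "A \<in> carrier_mat n n" unfolding A_def using len by (auto intro!: carrier_matI)
  have rows: "row A i = (L @ replicate (n - length L) (0\<^sub>v n)) ! i" if "i < n" for i
    unfolding A_def using that len L by (subst mat_of_rows_row) (auto simp: nth_append)
  define m where "m = n - 1"
  have m: "m < n" "length L \<le> m" using len unfolding m_def by auto
  have row_m: "row A m = 0\<^sub>v n" using rows[of m] m by (simp add: nth_append)
  then have "A $$ (m, j) = 0" if "j < n" for j
  proof -
    have "A $$ (m, j) = row A m $ j" using A that m by simp
    then show ?thesis using row_m that by simp
  qed
  then have "det A = 0"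
    using m by (subst laplace_expansion_row[OF A, of m]) auto
  then obtain v where v: "v \<in> carrier_vec n" "v \<noteq> 0\<^sub>v n" "A *\<^sub>v v = 0\<^sub>v n"
    using det_0_iff_vec_prod_zero_field[OF A] by blast
  have "w \<bullet> v = 0" if w: "w \<in> set L" for w
  proof -
    obtain i where i: "i < length L" "w = L ! i" using w by (metis in_set_conv_nth)
    have "(A *\<^sub>v v) $ i = row A i \<bullet> v" using A i len by simp
    also have "row A i = w" using rows[of i] i len by (simp add: nth_append)
    finally show ?thesis using v(3) i len by simp
  qed
  then show ?thesis using v by blast
qed

text \<open>One half of the Courant-Fischer principle. If the conclusion failed, more than
  \<open>k\<close> eigenvectors would have eigenvalue below \<open>l\<close>, and their span would
  contain a nonzero \<open>g\<close> orthogonal to all \<open>c j\<close>, contradicting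
  \<open>R\<close>.\<close>

lemma courant_fischer_lower_bound:
  fixes M :: "real mat" and c :: "nat \<Rightarrow> real vec"
  assumes M: "M \<in> carrier_mat n n" and sym: "M\<^sup>T = M" and k: "k < n"
    and c: "\<And>j. j < k \<Longrightarrow> c j \<in> carrier_vec n"
    and R: "\<And>g. g \<in> carrier_vec n \<Longrightarrow> (\<And>j. j < k \<Longrightarrow> c j \<bullet> g = 0) \<Longrightarrow> l * (g \<bullet> g) \<le> g \<bullet> (M *\<^sub>v g)"
  shows "l \<le> eigenvalue_nth M (k + 1)"
proof (rule ccontr)
  assume neg: "\<not> l \<le> eigenvalue_nth M (k + 1)"
  obtain P where P: "P \<in> carrier_mat n n" "P\<^sup>T * P = 1\<^sub>m n" "diagonal_mat (P\<^sup>T * M * P)"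
    using symmetric_mat_orthogonally_diagonalizable[OF M sym] by blast
  define D where "D = P\<^sup>T * M * P"
  have D: "D \<in> carrier_mat n n" unfolding D_def using P M by auto
  have PT: "P\<^sup>T \<in> carrier_mat n n" using P by simp
  have PP: "P * P\<^sup>T = 1\<^sub>m n" using mat_mult_left_right_inverse[OF PT P(1) P(2)] .
  have MP: "M = P * D * P\<^sup>T"
  proof -
    have "P * D * P\<^sup>T = (P * P\<^sup>T) * M * (P * P\<^sup>T)"
      unfolding D_def using P(1) PT M
      by (simp add: assoc_mult_mat[where ?n\<^sub>1.0=n and ?n\<^sub>2.0=n and ?n\<^sub>3.0=n and ?n\<^sub>4.0=n])
    then show ?thesis using PP M by simp
  qed
  have "similar_mat M D" unfolding similar_mat_def
    using similar_mat_witI[OF PP P(2) MP M D P(1) PT] by blast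
  then have "char_poly M = char_poly D" by (rule char_poly_similar)
  also have "\<dots> = (\<Prod>a\<leftarrow>diag_mat D. [:- a, 1:])"
    by (rule char_poly_upper_triangular[OF D])
      (use P(3) D in \<open>auto simp: diagonal_mat_def upper_triangular_def D_def\<close>)
  finally have cp: "char_poly M = (\<Prod>a\<leftarrow>diag_mat D. [:- a, 1:])" .
  have pr: "proots (\<Prod>a\<leftarrow>xs. [:- a, 1:]) = mset xs" for xs :: "real list"
  proof (induction xs)
    case (Cons x xs)
    have "(\<Prod>a\<leftarrow>xs. [:- a, 1:]) \<noteq> 0" by (auto simp: prod_list_zero_iff)
    then show ?case using Cons by (simp add: proots_mult del: mult_pCons_left)
  qed simp
  define es where "es = sorted_list_of_multiset (mset (diag_mat D))"
  have es: "sorted es" "mset es = mset (diag_mat D)" unfolding es_def by auto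
  have len: "length es = n" using arg_cong[OF es(2), of size] D by (simp add: diag_mat_def)
  have "es ! k < l" using neg unfolding eigenvalue_nth_def cp pr es_def by simp
  define I where "I = {i. i < n \<and> D $$ (i, i) < l}"
  have "k < card I"
  proof -
    have "es ! i < l" if "i \<le> k" for i
      using sorted_nth_mono[OF es(1) that] k len \<open>es ! k < l\<close> by simp
    then have "{..k} \<subseteq> {i. i < length es \<and> es ! i < l}" using len k by auto
    then have "card {..k} \<le> card {i. i < length es \<and> es ! i < l}" by (intro card_mono) auto
    also have "\<dots> = length (filter (\<lambda>x. x < l) es)" by (simp add: length_filter_conv_card)
    also have "\<dots> = length (filter (\<lambda>x. x < l) (diag_mat D))"
      using arg_cong[OF es(2), of "\<lambda>X. size (filter_mset (\<lambda>x. x < l) X)"] by (simp flip: mset_filter)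
    also have "\<dots> = card I"
      unfolding length_filter_conv_card I_def using D
      by (intro arg_cong[where f=card]) (auto simp: diag_mat_def)
    finally show ?thesis by simp
  qed
  have finI: "finite I" "I \<subseteq> {..<n}" unfolding I_def by auto
  \<comment> \<open>In the eigenbasis the unit vectors kill the coordinates outside
    \<open>I\<close>. Together with the \<open>k\<close> constraints these are
    \<open>k + n - card I < n\<close> equations.\<close>
  define L where "L = map (\<lambda>j. P\<^sup>T *\<^sub>v c j) [0..<k] @ map (unit_vec n) (filter (\<lambda>i. i \<notin> I) [0..<n])"
  have "length (filter (\<lambda>i. i \<notin> I) [0..<n]) = card ({..<n} - I)"
    by (subst distinct_card[symmetric]) (auto intro!: arg_cong[where f=card])
  also have "\<dots> = n - card I" using finI by (simp add: card_Diff_subset)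
  finally have "length L < n" unfolding L_def using \<open>k < card I\<close> k
      card_mono[OF _ finI(2)] by simp
  moreover have "set L \<subseteq> carrier_vec n" unfolding L_def using PT c by auto
  ultimately obtain a where a: "a \<in> carrier_vec n" "a \<noteq> 0\<^sub>v n" "\<And>w. w \<in> set L \<Longrightarrow> w \<bullet> a = 0"
    using homogeneous_system_nontrivial_solution by blast
  have off: "a $ i = 0" if "i < n" "i \<notin> I" for i
    using a(3)[of "unit_vec n i"] that a(1) unfolding L_def by simp
  define g where "g = P *\<^sub>v a"
  have g: "g \<in> carrier_vec n" unfolding g_def using P a by simp
  have tr: "u \<bullet> (P *\<^sub>v w) = (P\<^sup>T *\<^sub>v u) \<bullet> w" if "u \<in> carrier_vec n" "w \<in> carrier_vec n" for u w
    using transpose_vec_mult_scalar[OF P(1) that(2,1)] by simp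
  have "c j \<bullet> g = 0" if "j < k" for j
    unfolding g_def tr[OF c[OF that] a(1)] by (rule a(3)) (use that in \<open>simp add: L_def\<close>)
  then have ineq: "l * (g \<bullet> g) \<le> g \<bullet> (M *\<^sub>v g)" using R[OF g] by blast
  have PTg: "P\<^sup>T *\<^sub>v g = a" unfolding g_def
    using P(2) a(1) assoc_mult_mat_vec[OF PT P(1) a(1)] by simp
  have gg: "g \<bullet> g = a \<bullet> a"
    using tr[OF g a(1)] PTg unfolding g_def[symmetric] by simp
  have "M *\<^sub>v g = P *\<^sub>v (D *\<^sub>v a)"
    unfolding MP assoc_mult_mat_vec[OF mult_carrier_mat[OF P(1) D] PT g] PTg
    by (rule assoc_mult_mat_vec[OF P(1) D a(1)])
  then have "g \<bullet> (M *\<^sub>v g) = a \<bullet> (D *\<^sub>v a)"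
    using tr[OF g, of "D *\<^sub>v a"] D a PTg by simp
  also have "\<dots> = (\<Sum>i<n. D $$ (i, i) * (a $ i)\<^sup>2)"
  proof -
    have "(D *\<^sub>v a) $ i = D $$ (i, i) * a $ i" if i: "i < n" for i
    proof -
      have "(D *\<^sub>v a) $ i = (\<Sum>j<n. D $$ (i, j) * a $ j)"
        using i D a(1) by (simp add: scalar_prod_def atLeast0LessThan)
      also have "\<dots> = (\<Sum>j<n. if j = i then D $$ (i, i) * a $ i else 0)"
        using P(3) D i by (intro sum.cong) (auto simp: diagonal_mat_def D_def)
      finally show ?thesis using i by simp
    qed
    then show ?thesis using D a(1)
      by (auto simp: scalar_prod_def atLeast0LessThan power2_eq_square intro!: sum.cong)
  qed
  also have "\<dots> < (\<Sum>i<n. l * (a $ i)\<^sup>2)"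
  proof (rule sum_strict_mono_ex1)
    show "\<forall>i\<in>{..<n}. D $$ (i, i) * (a $ i)\<^sup>2 \<le> l * (a $ i)\<^sup>2"
    proof
      fix i assume "i \<in> {..<n}"
      then show "D $$ (i, i) * (a $ i)\<^sup>2 \<le> l * (a $ i)\<^sup>2"
        using off[of i] unfolding I_def by (cases "i \<in> I") (auto simp: I_def intro!: mult_right_mono)
    qed
    obtain i where i: "i < n" "a $ i \<noteq> 0" using a(1,2)
      by (metis carrier_vecD eq_vecI index_zero_vec(1) zero_carrier_vec)
    then have "i \<in> I" using off by blast
    then show "\<exists>i\<in>{..<n}. D $$ (i, i) * (a $ i)\<^sup>2 < l * (a $ i)\<^sup>2"
      using i unfolding I_def by (intro bexI[of _ i]) auto
  qed simp
  also have "\<dots> = l * (g \<bullet> g)"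
    unfolding gg using a(1) by (simp add: scalar_prod_def atLeast0LessThan sum_distrib_left power2_eq_square)
  finally show False using ineq by simp
qed

section \<open>Rectangles of a protocol\<close>

text \<open>
  The sum of \<open>g\<close> over all leaves, where \<open>R\<close> is the rectangle of inputs that reach the leaf; empty
  rectangles are included.
\<close>

primrec leaf_sum ::
  "('o \<Rightarrow> (nat \<Rightarrow> 'x set) \<Rightarrow> real) \<Rightarrow> 'o coordinator \<Rightarrow> 'x site_strategy \<Rightarrow>
    (nat \<Rightarrow> message list) \<Rightarrow> (nat \<Rightarrow> 'x set) \<Rightarrow> real" where
  "leaf_sum g (Output out) \<sigma> h R = g out R"
| "leaf_sum g (Send i b t) \<sigma> h R = leaf_sum g t \<sigma> (h(i := h i @ [To_Site b])) R"
| "leaf_sum g (Receive i t1 t0) \<sigma> h R =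
     leaf_sum g t1 \<sigma> (h(i := h i @ [From_Site True])) (R(i := {x \<in> R i. \<sigma> i x (h i)})) +
     leaf_sum g t0 \<sigma> (h(i := h i @ [From_Site False])) (R(i := {x \<in> R i. \<not> \<sigma> i x (h i)}))"

lemma leaf_sum_add:
  "leaf_sum (\<lambda>out R. g out R + g' out R) t \<sigma> h R = leaf_sum g t \<sigma> h R + leaf_sum g' t \<sigma> h R"
  by (induction t arbitrary: h R) auto

lemma leaf_sum_cmult:
  "leaf_sum (\<lambda>out R. a * g out R) t \<sigma> h R = a * leaf_sum g t \<sigma> h R"
  by (induction t arbitrary: h R) (auto simp: algebra_simps)

lemma leaf_sum_sum:
  "leaf_sum (\<lambda>out R. \<Sum>v<(N::nat). g v out R) t \<sigma> h R = (\<Sum>v<N. leaf_sum (g v) t \<sigma> h R)"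
  by (induction t arbitrary: h R) (auto simp: sum.distrib)

text \<open>The leaves carry rectangles inside \<open>R\<close>, so estimates that hold only for
  subsets of the original input sets can be summed over the leaves.\<close>

lemma leaf_sum_mono:
  assumes "\<And>out R'. (\<And>i. R' i \<subseteq> R i) \<Longrightarrow> g out R' \<le> g' out R'"
  shows "leaf_sum g t \<sigma> h R \<le> leaf_sum g' t \<sigma> h R"
  using assms
proof (induction t arbitrary: h R)
  case (Receive i t1 t0)
  show ?case unfolding leaf_sum.simps
  proof (intro add_mono Receive.IH Receive.prems)
    fix R' j assume *: "\<And>j. R' j \<subseteq> (R(i := {x \<in> R i. \<sigma> i x (h i)})) j"
    show "R' j \<subseteq> R j" using *[of j] by (auto split: if_splits)
  next
    fix R' j assume *: "\<And>j. R' j \<subseteq> (R(i := {x \<in> R i. \<not> \<sigma> i x (h i)})) j"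
    show "R' j \<subseteq> R j" using *[of j] by (auto split: if_splits)
  qed
qed auto

lemma leaf_sum_cong:
  assumes "\<And>out R'. (\<And>i. R' i \<subseteq> R i) \<Longrightarrow> g out R' = g' out R'"
  shows "leaf_sum g t \<sigma> h R = leaf_sum g' t \<sigma> h R"
  by (intro antisym leaf_sum_mono) (simp_all add: assms)

lemma sum_PiE_split:
  fixes f :: "('i \<Rightarrow> 'x) \<Rightarrow> 'b::comm_monoid_add"
  assumes "finite I" "i \<in> I" "\<And>i. i \<in> I \<Longrightarrow> finite (R i)"
  shows "(\<Sum>x\<in>PiE I R. f x) =
    (\<Sum>x\<in>PiE I (R(i := {y \<in> R i. P y})). f x) + (\<Sum>x\<in>PiE I (R(i := {y \<in> R i. \<not> P y})). f x)"
proof -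
  have "PiE I (R(i := {y \<in> R i. P y})) = {x \<in> PiE I R. P (x i)}"
    using assms(2) by (auto simp: PiE_iff extensional_def split: if_splits)
  moreover have "PiE I (R(i := {y \<in> R i. \<not> P y})) = {x \<in> PiE I R. \<not> P (x i)}"
    using assms(2) by (auto simp: PiE_iff extensional_def split: if_splits)
  moreover have "PiE I R = {x \<in> PiE I R. P (x i)} \<union> {x \<in> PiE I R. \<not> P (x i)}" by auto
  moreover have "finite (PiE I R)" using assms by (intro finite_PiE) auto
  ultimately show ?thesis
    by (metis (no_types, lifting) sum.union_disjoint disjoint_iff finite_Un mem_Collect_eq)
qed

text \<open>The rectangles of the leaves partition \<open>PiE I R\<close>, and all inputs in one of
  them lead to the output of that leaf. This translates between sums over inputs and sums over
  leaves, and is used in both directions.\<close>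

lemma leaf_sum_PiE:
  assumes "finite I" "sites_used t \<subseteq> I" "\<And>i. i \<in> I \<Longrightarrow> finite (R i)"
  shows "leaf_sum (\<lambda>out R. \<Sum>x\<in>PiE I R. G out x) t \<sigma> h R =
    (\<Sum>x\<in>PiE I R. G (fst (execute t \<sigma> x h)) x)"
  using assms(2,3)
proof (induction t arbitrary: h R)
  case (Receive i t1 t0)
  let ?R1 = "R(i := {x \<in> R i. \<sigma> i x (h i)})" and ?R0 = "R(i := {x \<in> R i. \<not> \<sigma> i x (h i)})"
  have i: "i \<in> I" using Receive.prems by simp
  have fin: "finite (?R1 j)" "finite (?R0 j)" if "j \<in> I" for j
    using Receive.prems(2)[OF that] by (auto split: if_splits)
  have x1: "\<sigma> i (x i) (h i)" if "x \<in> PiE I ?R1" for x using PiE_mem[OF that i] by simp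
  have x0: "\<not> \<sigma> i (x i) (h i)" if "x \<in> PiE I ?R0" for x using PiE_mem[OF that i] by simp
  have IH1: "leaf_sum (\<lambda>out R. \<Sum>x\<in>PiE I R. G out x) t1 \<sigma> h1 ?R1 =
      (\<Sum>x\<in>PiE I ?R1. G (fst (execute t1 \<sigma> x h1)) x)" for h1
    by (rule Receive.IH(1)) (use Receive.prems fin in auto)
  have IH0: "leaf_sum (\<lambda>out R. \<Sum>x\<in>PiE I R. G out x) t0 \<sigma> h0 ?R0 =
      (\<Sum>x\<in>PiE I ?R0. G (fst (execute t0 \<sigma> x h0)) x)" for h0
    by (rule Receive.IH(2)) (use Receive.prems fin in auto)
  show ?case
    unfolding leaf_sum.simps IH1 IH0
    by (subst sum_PiE_split[OF assms(1) i Receive.prems(2), where P="\<lambda>x. \<sigma> i x (h i)"], simp,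
        intro arg_cong2[where f=plus] sum.cong refl) (simp_all add: x1 x0)
qed auto

section \<open>Entropy lost along a protocol tree\<close>

lemma entropy_split:
  fixes a b :: real
  assumes "a \<ge> 0" "b \<ge> 0"
  shows "(a + b) * ln (a + b) - ln 2 * (a + b) \<le> a * ln a + b * ln b"
proof (cases "a + b = 0")
  case True
  then have "a = 0" "b = 0" using assms by auto
  then show ?thesis by simp
next
  case False
  define m where "m = (a + b) / 2"
  have m: "m > 0" using False assms unfolding m_def by simp
  \<comment> \<open>Gibbs' inequality against the even split \<open>m\<close>. The linear terms
    cancel in the sum because \<open>a + b = 2 * m\<close>, which leaves the bound
    \<open>ln 2\<close> on a binary entropy.\<close>
  have *: "x - m \<le> x * ln x - x * ln m" if "x \<ge> 0" for x
  proof (cases "x = 0")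
    case False
    then have "ln (m / x) \<le> m / x - 1" using m that by (intro ln_le_minus_one) auto
    then have "x * ln (m / x) \<le> x * (m / x - 1)" using that by (intro mult_left_mono)
    then show ?thesis using False m that by (simp add: ln_div algebra_simps)
  qed (use m in simp)
  have "ln m = ln (a + b) - ln 2" using m unfolding m_def by (simp add: ln_div)
  then have "(a + b) * ln m = (a + b) * ln (a + b) - ln 2 * (a + b)"
    by (simp only: right_diff_distrib mult.commute[of "ln 2"])
  moreover have "a + b = 2 * m" unfolding m_def by simp
  moreover have "(a + b) * ln m = a * ln m + b * ln m" by (rule distrib_right)
  ultimately show ?thesis using *[OF assms(1)] *[OF assms(2)] by linarith
qed

text \<open>With \<open>sz R * ln (sz R)\<close> as potential, a received bit lowers the total by at
  most \<open>ln 2\<close> per input that passes it, by \<open>entropy_split\<close>. A bit sent to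
  a site leaves the rectangle unchanged and is merely counted.\<close>

lemma leaf_sum_entropy:
  fixes I :: "nat set" and R :: "nat \<Rightarrow> 'x set"
  assumes "finite I" "sites_used t \<subseteq> I" "\<And>i. i \<in> I \<Longrightarrow> finite (R i)"
  defines "sz \<equiv> \<lambda>R. real (card (PiE I R))"
  shows "sz R * ln (sz R) - ln 2 * (\<Sum>x\<in>PiE I R. real (snd (execute t \<sigma> x h)))
    \<le> leaf_sum (\<lambda>out R. sz R * ln (sz R)) t \<sigma> h R"
  using assms(2,3)
proof (induction t arbitrary: h R)
  case (Send i b t)
  have "(\<Sum>x\<in>PiE I R. real (snd (execute t \<sigma> x (h(i := h i @ [To_Site b])))))
     \<le> (\<Sum>x\<in>PiE I R. real (snd (execute (Send i b t) \<sigma> x h)))"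
    by (intro sum_mono) simp
  then have "ln 2 * (\<Sum>x\<in>PiE I R. real (snd (execute t \<sigma> x (h(i := h i @ [To_Site b])))))
     \<le> ln 2 * (\<Sum>x\<in>PiE I R. real (snd (execute (Send i b t) \<sigma> x h)))"
    by (intro mult_left_mono) auto
  moreover have "sz R * ln (sz R) - ln 2 * (\<Sum>x\<in>PiE I R. real (snd (execute t \<sigma> x (h(i := h i @ [To_Site b])))))
     \<le> leaf_sum (\<lambda>out R. sz R * ln (sz R)) t \<sigma> (h(i := h i @ [To_Site b])) R"
    by (rule Send.IH) (use Send.prems in auto)
  ultimately show ?case unfolding leaf_sum.simps by linarith
next
  case (Receive i t1 t0)
  let ?R1 = "R(i := {x \<in> R i. \<sigma> i x (h i)})" and ?R0 = "R(i := {x \<in> R i. \<not> \<sigma> i x (h i)})"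
  let ?h1 = "h(i := h i @ [From_Site True])" and ?h0 = "h(i := h i @ [From_Site False])"
  have i: "i \<in> I" using Receive.prems by simp
  have fin: "finite (?R1 j)" "finite (?R0 j)" if "j \<in> I" for j
    using Receive.prems(2)[OF that] by (auto split: if_splits)
  have x1: "\<sigma> i (x i) (h i)" if "x \<in> PiE I ?R1" for x using PiE_mem[OF that i] by simp
  have x0: "\<not> \<sigma> i (x i) (h i)" if "x \<in> PiE I ?R0" for x using PiE_mem[OF that i] by simp
  note split = sum_PiE_split[OF assms(1) i Receive.prems(2), where P="\<lambda>x. \<sigma> i x (h i)"]
  have sz: "sz R = sz ?R1 + sz ?R0"
    using split[where f="\<lambda>_. 1::real"] Receive.prems(2) unfolding sz_def by simp
  have "(\<Sum>x\<in>PiE I R. real (snd (execute (Receive i t1 t0) \<sigma> x h))) =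
      (\<Sum>x\<in>PiE I ?R1. 1 + real (snd (execute t1 \<sigma> x ?h1))) +
      (\<Sum>x\<in>PiE I ?R0. 1 + real (snd (execute t0 \<sigma> x ?h0)))"
    by (subst split, use Receive.prems(2) in simp,
        intro arg_cong2[where f=plus] sum.cong refl) (simp_all add: x1 x0)
  also have "\<dots> = sz R + (\<Sum>x\<in>PiE I ?R1. real (snd (execute t1 \<sigma> x ?h1))) +
      (\<Sum>x\<in>PiE I ?R0. real (snd (execute t0 \<sigma> x ?h0)))"
    unfolding sz by (simp add: sum.distrib sz_def)
  finally have bits: "ln 2 * (\<Sum>x\<in>PiE I R. real (snd (execute (Receive i t1 t0) \<sigma> x h))) =
      ln 2 * sz R + ln 2 * (\<Sum>x\<in>PiE I ?R1. real (snd (execute t1 \<sigma> x ?h1))) +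
      ln 2 * (\<Sum>x\<in>PiE I ?R0. real (snd (execute t0 \<sigma> x ?h0)))" by (simp add: algebra_simps)
  have "sz R * ln (sz R) - ln 2 * sz R \<le> sz ?R1 * ln (sz ?R1) + sz ?R0 * ln (sz ?R0)"
    using entropy_split[of "sz ?R1" "sz ?R0"] unfolding sz by (simp add: sz_def)
  moreover have "sz ?R1 * ln (sz ?R1) - ln 2 * (\<Sum>x\<in>PiE I ?R1. real (snd (execute t1 \<sigma> x ?h1)))
      \<le> leaf_sum (\<lambda>out R. sz R * ln (sz R)) t1 \<sigma> ?h1 ?R1"
    by (rule Receive.IH(1)) (use Receive.prems fin in auto)
  moreover have "sz ?R0 * ln (sz ?R0) - ln 2 * (\<Sum>x\<in>PiE I ?R0. real (snd (execute t0 \<sigma> x ?h0)))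
      \<le> leaf_sum (\<lambda>out R. sz R * ln (sz R)) t0 \<sigma> ?h0 ?R0"
    by (rule Receive.IH(2)) (use Receive.prems fin in auto)
  ultimately show ?case unfolding bits leaf_sum.simps by linarith
qed simp

section \<open>Second moments on a rectangle\<close>

text \<open>\<open>mean {} f = 0\<close>, so the identities for rectangles below also hold for empty ones.\<close>

definition mean :: "'x set \<Rightarrow> ('x \<Rightarrow> real) \<Rightarrow> real" where
  "mean A f = (\<Sum>x\<in>A. f x) / real (card A)"

lemma mean_0 [simp]: "mean A (\<lambda>_. 0) = 0" unfolding mean_def by simp

lemma mean_sum: "mean A (\<lambda>x. \<Sum>v\<in>V. c v * f v x) = (\<Sum>v\<in>V. c v * mean A (f v))"
  unfolding mean_def by (subst sum.swap) (simp add: sum_distrib_left sum_divide_distrib)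

lemma mean_mono: "(\<And>x. x \<in> A \<Longrightarrow> f x \<le> g x) \<Longrightarrow> mean A f \<le> mean A g"
  unfolding mean_def by (intro divide_right_mono sum_mono) auto

lemma mean_cmult: "mean A (\<lambda>x. c * f x) = c * mean A f"
  unfolding mean_def by (simp flip: sum_distrib_left)

text \<open>The coordinates of a uniform point of a rectangle are independent: writing
  \<open>g (x i)\<close> as a product over all coordinates, with trivial factors elsewhere, lets the
  sum factor.\<close>

lemma sum_PiE_coordinate:
  assumes I: "finite I" and fin: "\<And>i. i \<in> I \<Longrightarrow> finite (R i)" and i: "i \<in> I"
  shows "(\<Sum>x\<in>PiE I R. g (x i)) = real (card (PiE I R)) * mean (R i) g"
proof (cases "R i = {}")
  case True
  then have "PiE I R = {}" using i by (auto simp: PiE_eq_empty_iff)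
  then show ?thesis by simp
next
  case False
  then have ne: "card (R i) \<noteq> 0" using fin i by simp
  define F where "F l y = (if l = i then g y else 1)" for l y
  have "(\<Sum>x\<in>PiE I R. g (x i)) = (\<Sum>x\<in>PiE I R. \<Prod>l\<in>I. F l (x l))"
    using I i by (simp add: F_def prod.delta)
  also have "\<dots> = (\<Prod>l\<in>I. \<Sum>y\<in>R l. F l y)" by (rule prod_sum_PiE[symmetric]) (use I fin in auto)
  also have "\<dots> = (\<Sum>y\<in>R i. g y) * (\<Prod>l\<in>I - {i}. real (card (R l)))"
    by (subst prod.remove[OF I i]) (auto simp: F_def intro!: prod.cong)
  also have "\<dots> = (\<Prod>l\<in>I. real (card (R l))) * mean (R i) g"
    by (subst prod.remove[OF I i]) (use ne in \<open>auto simp: mean_def\<close>)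
  finally show ?thesis using I by (simp add: card_PiE)
qed

lemma sum_PiE_coordinates:
  assumes I: "finite I" and fin: "\<And>i. i \<in> I \<Longrightarrow> finite (R i)" and ij: "i \<in> I" "j \<in> I" "i \<noteq> j"
  shows "(\<Sum>x\<in>PiE I R. f (x i) * g (x j)) = real (card (PiE I R)) * (mean (R i) f * mean (R j) g)"
proof (cases "R i = {} \<or> R j = {}")
  case True
  then have "PiE I R = {}" using ij by (auto simp: PiE_eq_empty_iff)
  then show ?thesis by simp
next
  case False
  then have ne: "card (R i) \<noteq> 0" "card (R j) \<noteq> 0" using fin ij by auto
  define F where "F l y = (if l = i then f y else if l = j then g y else 1)" for l y
  have J: "finite (I - {i})" "j \<in> I - {i}" using I ij by auto
  have "(\<Prod>l\<in>I. F l (x l)) = f (x i) * g (x j)" for x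
    by (subst prod.remove[OF I ij(1)], subst prod.remove[OF J])
      (use ij in \<open>auto simp: F_def intro!: prod.neutral\<close>)
  then have "(\<Sum>x\<in>PiE I R. f (x i) * g (x j)) = (\<Sum>x\<in>PiE I R. \<Prod>l\<in>I. F l (x l))" by simp
  also have "\<dots> = (\<Prod>l\<in>I. \<Sum>y\<in>R l. F l y)" by (rule prod_sum_PiE[symmetric]) (use I fin in auto)
  also have "\<dots> = (\<Sum>y\<in>R i. f y) * ((\<Sum>y\<in>R j. g y) * (\<Prod>l\<in>I - {i} - {j}. real (card (R l))))"
    by (subst prod.remove[OF I ij(1)], subst prod.remove[OF J])
      (use ij in \<open>auto simp: F_def intro!: prod.cong\<close>)
  also have "\<dots> = (\<Prod>l\<in>I. real (card (R l))) * (mean (R i) f * mean (R j) g)"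
    by (subst prod.remove[OF I ij(1)], subst prod.remove[OF J])
      (use ne in \<open>auto simp: mean_def\<close>)
  finally show ?thesis using I by (simp add: card_PiE)
qed

text \<open>A second moment is variance plus squared mean, and variances of independent terms add
  up. The first and the third sum together form the total variance.\<close>

lemma sum_PiE_square:
  assumes I: "finite I" and fin: "\<And>i. i \<in> I \<Longrightarrow> finite (R i)"
  shows "(\<Sum>x\<in>PiE I R. (\<Sum>i\<in>I. f i (x i))\<^sup>2) = real (card (PiE I R)) *
    ((\<Sum>i\<in>I. mean (R i) (\<lambda>y. (f i y)\<^sup>2)) + (\<Sum>i\<in>I. mean (R i) (f i))\<^sup>2
      - (\<Sum>i\<in>I. (mean (R i) (f i))\<^sup>2))"
proof -
  let ?n = "real (card (PiE I R))"
  \<comment> \<open>\<open>e i j\<close> is the mean of \<open>f i (x i) * f j (x j)\<close>; the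
    correction on the diagonal is a variance.\<close>
  define e where "e i j = mean (R i) (f i) * mean (R j) (f j) +
    (if i = j then mean (R i) (\<lambda>y. (f i y)\<^sup>2) - (mean (R i) (f i))\<^sup>2 else 0)" for i j
  have "(\<Sum>x\<in>PiE I R. f i (x i) * f j (x j)) = ?n * e i j" if "i \<in> I" "j \<in> I" for i j
  proof (cases "i = j")
    case True
    then show ?thesis using sum_PiE_coordinate[OF I fin that(1), where g="\<lambda>y. (f i y)\<^sup>2"]
      by (simp add: e_def power2_eq_square)
  next
    case False
    then show ?thesis using sum_PiE_coordinates[OF I fin that False, where f="f i" and g="f j"] by (simp add: e_def)
  qed
  note * = this
  have "(\<Sum>x\<in>PiE I R. (\<Sum>i\<in>I. f i (x i))\<^sup>2) = (\<Sum>x\<in>PiE I R. \<Sum>i\<in>I. \<Sum>j\<in>I. f i (x i) * f j (x j))"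
    by (simp add: power2_eq_square sum_product)
  also have "\<dots> = (\<Sum>i\<in>I. \<Sum>j\<in>I. \<Sum>x\<in>PiE I R. f i (x i) * f j (x j))"
    by (subst sum.swap, intro sum.cong refl, subst sum.swap) simp
  also have "\<dots> = ?n * (\<Sum>i\<in>I. \<Sum>j\<in>I. e i j)"
    by (simp add: * sum_distrib_left)
  also have "(\<Sum>i\<in>I. \<Sum>j\<in>I. e i j) = (\<Sum>i\<in>I. mean (R i) (f i))\<^sup>2 +
     (\<Sum>i\<in>I. mean (R i) (\<lambda>y. (f i y)\<^sup>2) - (mean (R i) (f i))\<^sup>2)"
    unfolding e_def using I by (simp add: sum.distrib sum_product power2_eq_square)
  finally show ?thesis by (simp add: sum_subtractf algebra_simps)
qed


text \<open>
  \<open>\<xi> i v y\<close> is the sign that site \<open>i\<close> with input \<open>y\<close> contributes to column \<open>v\<close>, and \<open>\<kappa> i = 0\<close> is meant for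
  sites without a vote. The last assumption is an exponential moment bound on a subset \<open>A\<close> of the
  inputs; taking \<open>c\<close> to be the vector of means on \<open>A\<close> gives the level-one inequality.
\<close>

locale site_signs =
  fixes I :: "nat set" and U :: "nat \<Rightarrow> 'x set" and N :: nat
    and \<xi> :: "nat \<Rightarrow> nat \<Rightarrow> 'x \<Rightarrow> real" and \<kappa> :: "nat \<Rightarrow> real"
  assumes finite_I: "finite I"
    and finite_U: "i \<in> I \<Longrightarrow> finite (U i)" and U_nonempty: "i \<in> I \<Longrightarrow> U i \<noteq> {}"
    and centred: "i \<in> I \<Longrightarrow> v < N \<Longrightarrow> mean (U i) (\<xi> i v) = 0"
    and bounded: "i \<in> I \<Longrightarrow> v < N \<Longrightarrow> y \<in> U i \<Longrightarrow> \<bar>\<xi> i v y\<bar> \<le> 1"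
    and \<kappa>: "0 \<le> \<kappa> i" "\<kappa> i \<le> 1"
    and tail: "i \<in> I \<Longrightarrow> A \<subseteq> U i \<Longrightarrow> A \<noteq> {} \<Longrightarrow> mean A (\<lambda>y. \<bar>\<Sum>v<N. c v * \<xi> i v y\<bar>)
      \<le> ln (real (card (U i)) / real (card A)) + \<kappa> i * (1 + (\<Sum>v<N. (c v)\<^sup>2) / 2)"
begin

definition W :: "nat \<Rightarrow> (nat \<Rightarrow> 'x) \<Rightarrow> real" where
  "W v x = (\<Sum>i\<in>I. \<xi> i v (x i))"

text \<open>The Kullback-Leibler divergence, in nats, of the uniform distribution on a nonempty
  \<open>A\<close> from the one on \<open>U i\<close>.\<close>

definition deficit :: "nat \<Rightarrow> 'x set \<Rightarrow> real" where
  "deficit i A = ln (real (card (U i)) / real (card A))"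

abbreviation vol :: "(nat \<Rightarrow> 'x set) \<Rightarrow> real" where
  "vol R \<equiv> real (card (PiE I R))"

text \<open>The logarithm turns the product of the coordinate sizes into a sum. The factor
  \<open>vol R\<close> makes the identity true for empty rectangles too, which a leaf sum may
  contain.\<close>

lemma vol_mult_deficit:
  assumes R: "\<And>i. i \<in> I \<Longrightarrow> R i \<subseteq> U i"
  shows "vol R * (\<Sum>i\<in>I. deficit i (R i)) = vol R * ln (vol U) - vol R * ln (vol R)"
proof (cases "\<exists>i\<in>I. R i = {}")
  case True
  then have "PiE I R = {}" by (auto simp: PiE_eq_empty_iff)
  then show ?thesis by simp
next
  case False
  have fR: "finite (R i)" if "i \<in> I" for i using R[OF that] finite_U[OF that] finite_subset by blast
  have pos: "real (card (R i)) > 0" "real (card (U i)) > 0" if "i \<in> I" for i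
    using that False fR[OF that] finite_U[OF that] U_nonempty[OF that] by (auto simp: card_gt_0_iff)
  have "(\<Sum>i\<in>I. deficit i (R i)) = (\<Sum>i\<in>I. ln (real (card (U i))) - ln (real (card (R i))))"
    proof (intro sum.cong refl)
    fix i assume "i \<in> I"
    then show "deficit i (R i) = ln (real (card (U i))) - ln (real (card (R i)))"
      using pos[of i] by (simp add: deficit_def ln_div)
  qed
  also have "\<dots> = ln (\<Prod>i\<in>I. real (card (U i))) - ln (\<Prod>i\<in>I. real (card (R i)))"
    using pos by (subst (1 2) ln_prod) (auto simp: sum_subtractf finite_I)
  also have "\<dots> = ln (vol U) - ln (vol R)" by (simp add: card_PiE finite_I)
  finally show ?thesis by (simp add: right_diff_distrib)
qed

lemma level_one:
  assumes i: "i \<in> I" and A: "A \<subseteq> U i" "A \<noteq> {}"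
  shows "(\<Sum>v<N. (mean A (\<xi> i v))\<^sup>2) \<le> 2 * (deficit i A + \<kappa> i)"
proof -
  define a where "a v = mean A (\<xi> i v)" for v
  define s where "s = (\<Sum>v<N. (a v)\<^sup>2)"
  have s: "s \<ge> 0" unfolding s_def by (intro sum_nonneg) auto
  have "s = mean A (\<lambda>y. \<Sum>v<N. a v * \<xi> i v y)"
    unfolding mean_sum s_def a_def by (simp add: power2_eq_square)
  also have "\<dots> \<le> mean A (\<lambda>y. \<bar>\<Sum>v<N. a v * \<xi> i v y\<bar>)" by (intro mean_mono) auto
  also have "\<dots> \<le> deficit i A + \<kappa> i * (1 + s / 2)"
    unfolding deficit_def s_def by (rule tail[OF i A])
  finally have "s \<le> deficit i A + \<kappa> i + \<kappa> i * s / 2" by (simp add: algebra_simps)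
  \<comment> \<open>The quadratic term of \<open>tail\<close> returns at most \<open>s / 2\<close>,
    which the left side absorbs; hence the factor 2 in the conclusion.\<close>
  moreover have "\<kappa> i * s \<le> s" using \<kappa>[of i] s by (simp add: mult_left_le_one_le)
  ultimately show ?thesis unfolding s_def a_def by simp
qed

text \<open>One factor of the square is bounded trivially by \<open>N\<close>, the other by
  \<open>tail\<close> for the coefficients \<open>l * c v\<close>. The scale \<open>l\<close> trades
  the deficit, which is divided by \<open>l\<close>, against the quadratic term, which grows with
  \<open>l\<close>; it is fixed in \<open>communication_lower_bound\<close>.\<close>

lemma mean_square_linear_form:
  assumes i: "i \<in> I" and A: "A \<subseteq> U i" "A \<noteq> {}" and c: "\<And>v. v < N \<Longrightarrow> \<bar>c v\<bar> \<le> 1" and l: "l > 0"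
  shows "mean A (\<lambda>y. (\<Sum>v<N. c v * \<xi> i v y)\<^sup>2)
    \<le> N * ((deficit i A + \<kappa> i) / l + \<kappa> i * l * N / 2)"
proof -
  let ?f = "\<lambda>y. \<Sum>v<N. c v * \<xi> i v y"
  have f: "\<bar>?f y\<bar> \<le> N" if "y \<in> A" for y
  proof -
    have "\<bar>?f y\<bar> \<le> (\<Sum>v<N. \<bar>c v * \<xi> i v y\<bar>)" by (rule sum_abs)
    also have "\<dots> \<le> (\<Sum>v<N. 1)"
      using that A c bounded[OF i] by (intro sum_mono) (auto simp: abs_mult intro!: mult_le_one)
    finally show ?thesis by simp
  qed
  have "mean A (\<lambda>y. (?f y)\<^sup>2) \<le> mean A (\<lambda>y. N * \<bar>?f y\<bar>)"
  proof (rule mean_mono)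
    fix y assume "y \<in> A"
    then have "\<bar>?f y\<bar> * \<bar>?f y\<bar> \<le> N * \<bar>?f y\<bar>" using f by (intro mult_right_mono) auto
    then show "(?f y)\<^sup>2 \<le> N * \<bar>?f y\<bar>" by (simp add: power2_eq_square)
  qed
  also have "\<dots> = N / l * mean A (\<lambda>y. \<bar>\<Sum>v<N. (l * c v) * \<xi> i v y\<bar>)"
  proof -
    have "\<bar>\<Sum>v<N. (l * c v) * \<xi> i v y\<bar> = l * \<bar>?f y\<bar>" for y
      using l abs_mult[of l "?f y"] by (simp add: sum_distrib_left mult.assoc)
    then show ?thesis using l by (simp add: mean_cmult)
  qed
  also have "\<dots> \<le> N / l * (deficit i A + \<kappa> i * (1 + (\<Sum>v<N. (l * c v)\<^sup>2) / 2))"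
    unfolding deficit_def using l by (intro mult_left_mono tail[OF i A]) auto
  also have "\<dots> \<le> N / l * (deficit i A + \<kappa> i * (1 + (\<Sum>v<N. l\<^sup>2) / 2))"
  proof -
    have "(l * c v)\<^sup>2 \<le> l\<^sup>2" if "v < N" for v
      using c[OF that] by (simp add: power_mult_distrib abs_square_le_1 mult_left_le)
    then have "(\<Sum>v<N. (l * c v)\<^sup>2) \<le> (\<Sum>v<N. l\<^sup>2)" by (intro sum_mono) auto
    then show ?thesis using l \<kappa>[of i] by (intro mult_left_mono add_left_mono divide_right_mono) auto
  qed
  also have "\<dots> = N * ((deficit i A + \<kappa> i) / l + \<kappa> i * l * N / 2)"
    using l by (simp add: field_simps power2_eq_square)
  finally show ?thesis .
qed

text \<open>By \<open>sum_PiE_square\<close> the second moment is at most the sum of the second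
  moments of the sites plus the squared mean. The latter is only split into columns here, because it
  becomes small only after averaging over the leaves.\<close>

lemma sum_square_rectangle:
  fixes S :: real
  assumes R: "\<And>i. R i \<subseteq> U i" and c: "\<And>v. v < N \<Longrightarrow> \<bar>c v\<bar> \<le> 1" and l: "l > 0"
  defines "S \<equiv> \<Sum>i\<in>I. \<kappa> i"
  shows "(\<Sum>x\<in>PiE I R. (\<Sum>v<N. c v * W v x)\<^sup>2) \<le>
    N / l * (vol R * ln (vol U) - vol R * ln (vol R)) + N * (S / l + S * l * N / 2) * vol R
      + N * (\<Sum>v<N. vol R * (\<Sum>i\<in>I. mean (R i) (\<xi> i v))\<^sup>2)"
proof (cases "\<exists>i\<in>I. R i = {}")
  case True
  then have "PiE I R = {}" by (auto simp: PiE_eq_empty_iff)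
  then show ?thesis by simp
next
  case False
  have fR: "finite (R i)" if "i \<in> I" for i using R[of i] finite_U[OF that] finite_subset by blast
  define f where "f i y = (\<Sum>v<N. c v * \<xi> i v y)" for i y
  have eq: "(\<Sum>v<N. c v * W v x) = (\<Sum>i\<in>I. f i (x i))" for x
    unfolding W_def f_def sum_distrib_left by (rule sum.swap)
  have mf: "(\<Sum>i\<in>I. mean (R i) (f i)) = (\<Sum>v<N. c v * (\<Sum>i\<in>I. mean (R i) (\<xi> i v)))"
    unfolding f_def mean_sum sum_distrib_left by (rule sum.swap)
  \<comment> \<open>Cauchy-Schwarz over the \<open>N\<close> columns.\<close>
  have "(\<Sum>i\<in>I. mean (R i) (f i))\<^sup>2 \<le> N * (\<Sum>v<N. (\<Sum>i\<in>I. mean (R i) (\<xi> i v))\<^sup>2)"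
  proof -
    have "(\<Sum>i\<in>I. mean (R i) (f i))\<^sup>2 \<le> (\<Sum>v<N. (c v * (\<Sum>i\<in>I. mean (R i) (\<xi> i v)))\<^sup>2) * N"
      unfolding mf using sum_squared_le_sum_of_squares[of "\<lambda>v. c v * (\<Sum>i\<in>I. mean (R i) (\<xi> i v))" "{..<N}"]
      by simp
    also have "\<dots> \<le> (\<Sum>v<N. (\<Sum>i\<in>I. mean (R i) (\<xi> i v))\<^sup>2) * N"
      using c by (intro mult_right_mono sum_mono)
        (auto simp: power_mult_distrib abs_square_le_1 mult_left_le_one_le)
    finally show ?thesis by (simp add: mult.commute)
  qed
  moreover have "(\<Sum>i\<in>I. mean (R i) (\<lambda>y. (f i y)\<^sup>2)) \<le>
      (\<Sum>i\<in>I. N * ((deficit i (R i) + \<kappa> i) / l + \<kappa> i * l * N / 2))"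
    unfolding f_def using False R c l by (intro sum_mono mean_square_linear_form) auto
  moreover have "(\<Sum>i\<in>I. N * ((deficit i (R i) + \<kappa> i) / l + \<kappa> i * l * N / 2)) =
      N / l * (\<Sum>i\<in>I. deficit i (R i)) + N * (S / l + S * l * N / 2)"
    unfolding S_def by (simp add: sum.distrib sum_distrib_left sum_divide_distrib
        sum_distrib_right add_divide_distrib algebra_simps)
  moreover have "(\<Sum>i\<in>I. (mean (R i) (f i))\<^sup>2) \<ge> 0" by (intro sum_nonneg) auto
  ultimately have "(\<Sum>i\<in>I. mean (R i) (\<lambda>y. (f i y)\<^sup>2)) + (\<Sum>i\<in>I. mean (R i) (f i))\<^sup>2
      - (\<Sum>i\<in>I. (mean (R i) (f i))\<^sup>2) \<le> N / l * (\<Sum>i\<in>I. deficit i (R i)) + N * (S / l + S * l * N / 2)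
      + N * (\<Sum>v<N. (\<Sum>i\<in>I. mean (R i) (\<xi> i v))\<^sup>2)" by linarith
  then have "(\<Sum>x\<in>PiE I R. (\<Sum>v<N. c v * W v x)\<^sup>2) \<le> vol R * (N / l * (\<Sum>i\<in>I. deficit i (R i))
      + N * (S / l + S * l * N / 2) + N * (\<Sum>v<N. (\<Sum>i\<in>I. mean (R i) (\<xi> i v))\<^sup>2))"
    unfolding eq by (subst sum_PiE_square[OF finite_I fR]) (auto intro!: mult_left_mono)
  also have "\<dots> = N / l * (vol R * (\<Sum>i\<in>I. deficit i (R i))) + N * (S / l + S * l * N / 2) * vol R
      + N * (\<Sum>v<N. vol R * (\<Sum>i\<in>I. mean (R i) (\<xi> i v))\<^sup>2)"
    by (simp add: algebra_simps flip: sum_distrib_left)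
  finally show ?thesis unfolding vol_mult_deficit[OF R] .
qed

context
  fixes t :: "'o coordinator" and \<sigma> :: "'x site_strategy" and h :: "nat \<Rightarrow> message list" and B :: real
  assumes sites: "sites_used t \<subseteq> I"
    and bits: "\<And>x. x \<in> PiE I U \<Longrightarrow> real (snd (execute t \<sigma> x h)) \<le> B"
begin

lemma leaf_sum_vol: "leaf_sum (\<lambda>out. vol) t \<sigma> h U = vol U"
  using leaf_sum_PiE[OF finite_I sites finite_U, where G="\<lambda>_ _. 1"] by simp

text \<open>The average deficit of the leaves is the entropy lost along the tree, at most
  \<open>ln 2\<close> per bit sent; \<open>ln 2\<close> is rounded up to 1.\<close>

lemma leaf_sum_deficit:
  "leaf_sum (\<lambda>out R. vol R * ln (vol U) - vol R * ln (vol R)) t \<sigma> h U \<le> B * vol U"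
proof -
  have "leaf_sum (\<lambda>out R. vol R * ln (vol U) - vol R * ln (vol R)) t \<sigma> h U =
      ln (vol U) * vol U - leaf_sum (\<lambda>out R. vol R * ln (vol R)) t \<sigma> h U"
    using leaf_sum_add[of "\<lambda>out R. ln (vol U) * vol R" "\<lambda>out R. (-1) * (vol R * ln (vol R))" t \<sigma> h U]
    unfolding leaf_sum_cmult leaf_sum_vol by (simp add: mult.commute)
  also have "\<dots> \<le> ln 2 * (\<Sum>x\<in>PiE I U. real (snd (execute t \<sigma> x h)))"
  proof -
    have "vol U * ln (vol U) - ln 2 * (\<Sum>x\<in>PiE I U. real (snd (execute t \<sigma> x h)))
        \<le> leaf_sum (\<lambda>out R. vol R * ln (vol R)) t \<sigma> h U"
      by (rule leaf_sum_entropy[OF finite_I sites finite_U])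
    then show ?thesis by (simp add: mult.commute)
  qed
  also have "\<dots> \<le> 1 * (\<Sum>x\<in>PiE I U. real (snd (execute t \<sigma> x h)))"
    using ln_2_less_1 by (intro mult_right_mono sum_nonneg) auto
  also have "\<dots> \<le> 1 * (\<Sum>x\<in>PiE I U. B)" by (intro mult_left_mono sum_mono bits) auto
  finally show ?thesis by (simp add: mult.commute)
qed

text \<open>
  Averaged over the leaves, the square of the mean of \<open>W v\<close> is the sum of the squares of the means of
  its terms: the cross terms vanish on the whole cube, although not on a single leaf.
\<close>

lemma leaf_sum_square_mean:
  assumes v: "v < N"
  shows "leaf_sum (\<lambda>out R. vol R * (\<Sum>i\<in>I. mean (R i) (\<xi> i v))\<^sup>2) t \<sigma> h U =
    leaf_sum (\<lambda>out R. vol R * (\<Sum>i\<in>I. (mean (R i) (\<xi> i v))\<^sup>2)) t \<sigma> h U"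
proof -
  define q where "q R = (\<Sum>x\<in>PiE I R. (\<Sum>i\<in>I. (\<xi> i v (x i))\<^sup>2))" for R
  have q: "q R = vol R * (\<Sum>i\<in>I. mean (R i) (\<lambda>y. (\<xi> i v y)\<^sup>2))"
    if "\<And>i. R i \<subseteq> U i" for R
  proof -
    have fR: "finite (R i)" if "i \<in> I" for i
      using \<open>R i \<subseteq> U i\<close> finite_U[OF that] finite_subset by blast
    have "(\<Sum>x\<in>PiE I R. (\<xi> i v (x i))\<^sup>2) = vol R * mean (R i) (\<lambda>y. (\<xi> i v y)\<^sup>2)" if "i \<in> I" for i
      using fR that by (intro sum_PiE_coordinate[OF finite_I]) auto
    then show ?thesis unfolding q_def
      by (subst sum.swap) (simp add: sum_distrib_left)
  qed
  \<comment> \<open>The square of \<open>W v\<close> and the summand of \<open>q\<close> are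
    functions of the input alone, so their leaf sums equal their sums over the whole cube, where
    \<open>centred\<close> makes the two agree. The leaf sums of the two remaining terms must then
    agree as well.\<close>
  have W2: "(\<Sum>x\<in>PiE I R. (W v x)\<^sup>2) + vol R * (\<Sum>i\<in>I. (mean (R i) (\<xi> i v))\<^sup>2) =
      q R + vol R * (\<Sum>i\<in>I. mean (R i) (\<xi> i v))\<^sup>2"
    if R: "\<And>i. R i \<subseteq> U i" for R
  proof -
    have fR: "finite (R i)" if "i \<in> I" for i
      using R[of i] finite_U[OF that] finite_subset by blast
    have "(\<Sum>x\<in>PiE I R. (W v x)\<^sup>2) = vol R * ((\<Sum>i\<in>I. mean (R i) (\<lambda>y. (\<xi> i v y)\<^sup>2))
        + (\<Sum>i\<in>I. mean (R i) (\<xi> i v))\<^sup>2 - (\<Sum>i\<in>I. (mean (R i) (\<xi> i v))\<^sup>2))"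
      unfolding W_def by (rule sum_PiE_square[OF finite_I fR])
    then show ?thesis unfolding q[OF R] by (simp add: algebra_simps)
  qed
  have "leaf_sum (\<lambda>out R. \<Sum>x\<in>PiE I R. (W v x)\<^sup>2) t \<sigma> h U
      + leaf_sum (\<lambda>out R. vol R * (\<Sum>i\<in>I. (mean (R i) (\<xi> i v))\<^sup>2)) t \<sigma> h U
    = leaf_sum (\<lambda>out. q) t \<sigma> h U
      + leaf_sum (\<lambda>out R. vol R * (\<Sum>i\<in>I. mean (R i) (\<xi> i v))\<^sup>2) t \<sigma> h U"
    unfolding leaf_sum_add[symmetric] by (rule leaf_sum_cong) (rule W2)
  moreover have "leaf_sum (\<lambda>out R. \<Sum>x\<in>PiE I R. (W v x)\<^sup>2) t \<sigma> h U = (\<Sum>x\<in>PiE I U. (W v x)\<^sup>2)"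
    by (rule leaf_sum_PiE[OF finite_I sites finite_U])
  moreover have "leaf_sum (\<lambda>out. q) t \<sigma> h U = q U"
    unfolding q_def by (rule leaf_sum_PiE[OF finite_I sites finite_U])
  moreover have "(\<Sum>x\<in>PiE I U. (W v x)\<^sup>2) = q U" using W2[of U] centred[OF _ v] by simp
  ultimately show ?thesis by simp
qed

text \<open>The coefficients may depend on the output, since it is constant on a leaf. The second
  moments of the sites give \<open>(B + S) / l + S * l * N / 2\<close>; the squared means give
  \<open>2 * (B + S)\<close>, by \<open>leaf_sum_square_mean\<close> and
  \<open>level_one\<close>.\<close>

theorem sum_square_protocol:
  fixes S :: real
  assumes c: "\<And>out v. v < N \<Longrightarrow> \<bar>c out v\<bar> \<le> 1" and l: "l > 0"
  defines "S \<equiv> \<Sum>i\<in>I. \<kappa> i"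
  shows "(\<Sum>x\<in>PiE I U. (\<Sum>v<N. c (fst (execute t \<sigma> x h)) v * W v x)\<^sup>2) \<le>
    vol U * N * ((B + S) / l + S * l * N / 2 + 2 * (B + S))"
proof -
  let ?A = "\<lambda>R. vol R * ln (vol U) - vol R * ln (vol R)"
  have "(\<Sum>x\<in>PiE I U. (\<Sum>v<N. c (fst (execute t \<sigma> x h)) v * W v x)\<^sup>2) =
      leaf_sum (\<lambda>out R. \<Sum>x\<in>PiE I R. (\<Sum>v<N. c out v * W v x)\<^sup>2) t \<sigma> h U"
    by (rule leaf_sum_PiE[OF finite_I sites finite_U, symmetric])
  also have "\<dots> \<le> leaf_sum (\<lambda>out R. (N / l * ?A R + N * (S / l + S * l * N / 2) * vol R)
      + N * (\<Sum>v<N. vol R * (\<Sum>i\<in>I. mean (R i) (\<xi> i v))\<^sup>2)) t \<sigma> h U"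
    unfolding S_def by (intro leaf_sum_mono sum_square_rectangle c l)
  also have "\<dots> = N / l * leaf_sum (\<lambda>out. ?A) t \<sigma> h U + N * (S / l + S * l * N / 2) * vol U
      + N * (\<Sum>v<N. leaf_sum (\<lambda>out R. vol R * (\<Sum>i\<in>I. mean (R i) (\<xi> i v))\<^sup>2) t \<sigma> h U)"
    unfolding leaf_sum_add leaf_sum_cmult leaf_sum_vol leaf_sum_sum ..
  finally have bound: "(\<Sum>x\<in>PiE I U. (\<Sum>v<N. c (fst (execute t \<sigma> x h)) v * W v x)\<^sup>2) \<le>
      N / l * leaf_sum (\<lambda>out. ?A) t \<sigma> h U + N * (S / l + S * l * N / 2) * vol U
      + N * (\<Sum>v<N. leaf_sum (\<lambda>out R. vol R * (\<Sum>i\<in>I. mean (R i) (\<xi> i v))\<^sup>2) t \<sigma> h U)" .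
  have "(\<Sum>v<N. leaf_sum (\<lambda>out R. vol R * (\<Sum>i\<in>I. mean (R i) (\<xi> i v))\<^sup>2) t \<sigma> h U) =
      leaf_sum (\<lambda>out R. \<Sum>v<N. vol R * (\<Sum>i\<in>I. (mean (R i) (\<xi> i v))\<^sup>2)) t \<sigma> h U"
    unfolding leaf_sum_sum by (intro sum.cong refl leaf_sum_square_mean) simp
  also have "\<dots> \<le> leaf_sum (\<lambda>out R. 2 * ?A R + 2 * S * vol R) t \<sigma> h U"
  proof (rule leaf_sum_mono)
    fix R assume R: "\<And>i. R i \<subseteq> U i"
    have "(\<Sum>v<N. vol R * (\<Sum>i\<in>I. (mean (R i) (\<xi> i v))\<^sup>2)) =
        vol R * (\<Sum>i\<in>I. \<Sum>v<N. (mean (R i) (\<xi> i v))\<^sup>2)"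
      by (subst sum.swap) (simp add: sum_distrib_left)
    also have "\<dots> \<le> vol R * (\<Sum>i\<in>I. 2 * (deficit i (R i) + \<kappa> i))"
    proof (cases "\<exists>i\<in>I. R i = {}")
      case True
      then have "PiE I R = {}" by (auto simp: PiE_eq_empty_iff)
      then show ?thesis by simp
    next
      case False
      then show ?thesis using R by (intro mult_left_mono sum_mono level_one) auto
    qed
    also have "\<dots> = 2 * (vol R * (\<Sum>i\<in>I. deficit i (R i))) + 2 * S * vol R"
      unfolding S_def sum_distrib_left[symmetric] sum.distrib by (simp add: algebra_simps)
    finally show "(\<Sum>v<N. vol R * (\<Sum>i\<in>I. (mean (R i) (\<xi> i v))\<^sup>2)) \<le> 2 * ?A R + 2 * S * vol R"
      unfolding vol_mult_deficit[OF R] .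
  qed
  also have "\<dots> = 2 * leaf_sum (\<lambda>out. ?A) t \<sigma> h U + 2 * S * vol U"
    unfolding leaf_sum_add leaf_sum_cmult leaf_sum_vol ..
  also have "\<dots> \<le> 2 * (B * vol U) + 2 * S * vol U"
    using leaf_sum_deficit by simp
  finally have "(\<Sum>v<N. leaf_sum (\<lambda>out R. vol R * (\<Sum>i\<in>I. mean (R i) (\<xi> i v))\<^sup>2) t \<sigma> h U)
      \<le> 2 * (B * vol U) + 2 * S * vol U" .
  then have "N / l * leaf_sum (\<lambda>out. ?A) t \<sigma> h U + N * (S / l + S * l * N / 2) * vol U
      + N * (\<Sum>v<N. leaf_sum (\<lambda>out R. vol R * (\<Sum>i\<in>I. mean (R i) (\<xi> i v))\<^sup>2) t \<sigma> h U) \<le>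
      N / l * (B * vol U) + N * (S / l + S * l * N / 2) * vol U + N * (2 * (B * vol U) + 2 * S * vol U)"
    using l by (intro add_mono mult_left_mono leaf_sum_deficit order.refl) auto
  also have "\<dots> = vol U * N * ((B + S) / l + S * l * N / 2 + 2 * (B + S))"
    by (simp add: algebra_simps add_divide_distrib)
  finally show ?thesis using bound by linarith
qed

end

end

section \<open>Random signs\<close>

lemma tanh_le_self: "x \<ge> 0 \<Longrightarrow> tanh x \<le> (x::real)"
proof -
  assume x: "x \<ge> 0"
  have "(\<lambda>x::real. x - tanh x) 0 \<le> (\<lambda>x. x - tanh x) x"
  proof (rule DERIV_nonneg_imp_nondecreasing[OF x])
    fix y :: real
    have "((\<lambda>x. x - tanh x) has_real_derivative (1 - (1 - (tanh y)\<^sup>2))) (at y)"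
      by (auto intro!: derivative_eq_intros simp: cosh_real_pos less_imp_neq[symmetric])
    then show "\<exists>d. ((\<lambda>x. x - tanh x) has_real_derivative d) (at y) \<and> 0 \<le> d" by force
  qed
  then show ?thesis by simp
qed

text \<open>This makes a random sign sub-Gaussian. The derivative of
  \<open>x^2 / 2 - ln (cosh x)\<close> is \<open>x - tanh x\<close>, which is nonnegative for
  nonnegative \<open>x\<close>.\<close>

lemma cosh_le_exp_half_square: "cosh x \<le> exp (x\<^sup>2 / 2)" for x :: real
proof -
  have pos: "cosh y \<le> exp (y\<^sup>2 / 2)" if y: "y \<ge> 0" for y :: real
  proof -
    have "(\<lambda>x. x\<^sup>2 / 2 - ln (cosh x)) 0 \<le> (\<lambda>x. x\<^sup>2 / 2 - ln (cosh x)) y"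
    proof (rule DERIV_nonneg_imp_nondecreasing[OF y])
      fix z :: real assume z: "0 \<le> z"
      have "((\<lambda>x. x\<^sup>2 / 2 - ln (cosh x)) has_real_derivative (z - tanh z)) (at z)"
        by (auto intro!: derivative_eq_intros simp: tanh_def)
      then show "\<exists>d. ((\<lambda>x. x\<^sup>2 / 2 - ln (cosh x)) has_real_derivative d) (at z) \<and> 0 \<le> d"
        using tanh_le_self[OF z] by force
    qed
    then have "ln (cosh y) \<le> y\<^sup>2 / 2" by simp
    then show ?thesis by (metis cosh_real_pos exp_le_cancel_iff exp_ln)
  qed
  show ?thesis using pos[of x] pos[of "- x"] by (cases "x \<ge> 0") auto
qed

definition membership_sign :: "nat \<Rightarrow> nat set \<Rightarrow> real" where
  "membership_sign v r = (if v \<in> r then 1 else - 1)"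

text \<open>Expanding the product chooses a sign for every \<open>v\<close>, that is, a subset
  \<open>r\<close>.\<close>

lemma sum_Pow_exp_signs:
  fixes c :: "nat \<Rightarrow> real"
  shows "(\<Sum>r\<in>Pow {..<N}. exp (\<Sum>v<N. c v * membership_sign v r)) = (\<Prod>v<N. exp (c v) + exp (- c v))"
proof -
  have "(\<Prod>v\<in>r. exp (c v)) * (\<Prod>v\<in>{..<N} - r. exp (- c v)) =
      exp (\<Sum>v<N. c v * membership_sign v r)" if "r \<subseteq> {..<N}" for r
  proof -
    have "(\<Sum>v<N. c v * membership_sign v r) =
        (\<Sum>v\<in>{..<N} - r. c v * membership_sign v r) + (\<Sum>v\<in>r. c v * membership_sign v r)"
      by (rule sum.subset_diff) (use that in auto)
    also have "\<dots> = (\<Sum>v\<in>{..<N} - r. - c v) + (\<Sum>v\<in>r. c v)"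
      by (intro arg_cong2[where f=plus] sum.cong refl) (auto simp: membership_sign_def)
    finally show ?thesis
      using finite_subset[OF that] by (simp only: exp_add exp_sum finite_Diff finite_lessThan mult.commute)
  qed
  then show ?thesis by (subst prod_add) (auto intro!: sum.cong)
qed

text \<open>Jensen's inequality, from the tangent to \<open>exp\<close> at the mean.\<close>

lemma exp_mean_le:
  assumes "finite A" "A \<noteq> {}"
  shows "exp (mean A f) \<le> mean A (\<lambda>x. exp (f x))"
proof -
  let ?m = "mean A f"
  have n: "real (card A) > 0" using assms by (simp add: card_gt_0_iff)
  have "exp ?m * (1 + (f x - ?m)) \<le> exp (f x)" for x
    using mult_left_mono[OF exp_ge_add_one_self[of "f x - ?m"], of "exp ?m"] by (simp flip: exp_add)
  then have "mean A (\<lambda>x. exp ?m * (1 + (f x - ?m))) \<le> mean A (\<lambda>x. exp (f x))" by (intro mean_mono)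
  moreover have "mean A (\<lambda>x. exp ?m * (1 + (f x - ?m))) = exp ?m"
  proof -
    have "(\<Sum>x\<in>A. 1 + (f x - ?m)) = card A" using n
      by (simp add: sum.distrib sum_subtractf) (simp add: mean_def)
    then show ?thesis unfolding mean_cmult using n by (simp add: mean_def)
  qed
  ultimately show ?thesis by simp
qed

text \<open>Jensen's inequality reduces the mean on \<open>A\<close> to an exponential moment, and
  enlarging \<open>A\<close> to the full cube costs the ratio of the cardinalities, whose logarithm
  is the deficit. Replacing \<open>exp \<bar>z\<bar>\<close> by \<open>exp z + exp (- z)\<close>
  leads to a factor 2, whose logarithm is rounded up to the summand 1.\<close>

lemma mean_abs_linear_form_signs:
  assumes A: "A \<subseteq> Pow {..<N}" "A \<noteq> {}"
  shows "mean A (\<lambda>r. \<bar>\<Sum>v<N. c v * membership_sign v r\<bar>)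
    \<le> ln (real (card (Pow {..<N})) / real (card A)) + 1 + (\<Sum>v<N. (c v)\<^sup>2) / 2"
proof -
  let ?f = "\<lambda>r. \<Sum>v<N. c v * membership_sign v r" and ?s = "\<Sum>v<N. (c v)\<^sup>2"
  have finA: "finite A" using A(1) finite_subset by blast
  then have n: "real (card A) > 0" using A(2) by (simp add: card_gt_0_iff)
  have prod: "(\<Prod>v<N. exp (a v) + exp (- a v)) \<le> 2 ^ N * exp ((\<Sum>v<N. (a v)\<^sup>2) / 2)"
    for a :: "nat \<Rightarrow> real"
  proof -
    have "exp (a v) + exp (- a v) \<le> 2 * exp ((a v)\<^sup>2 / 2)" for v
      using cosh_le_exp_half_square[of "a v"] by (simp add: cosh_def)
    then have "(\<Prod>v<N. exp (a v) + exp (- a v)) \<le> (\<Prod>v<N. 2 * exp ((a v)\<^sup>2 / 2))"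
      by (intro prod_mono) (auto intro: add_nonneg_nonneg)
    also have "\<dots> = 2 ^ N * exp ((\<Sum>v<N. (a v)\<^sup>2) / 2)"
      by (simp add: prod.distrib exp_sum sum_divide_distrib)
    finally show ?thesis .
  qed
  have "exp (mean A (\<lambda>r. \<bar>?f r\<bar>)) \<le> mean A (\<lambda>r. exp \<bar>?f r\<bar>)" by (rule exp_mean_le[OF finA A(2)])
  also have "\<dots> \<le> (\<Sum>r\<in>Pow {..<N}. exp \<bar>?f r\<bar>) / card A"
    unfolding mean_def by (intro divide_right_mono sum_mono2) (use A in auto)
  also have "\<dots> \<le> (\<Sum>r\<in>Pow {..<N}. exp (?f r) + exp (- ?f r)) / card A"
    by (intro divide_right_mono sum_mono) (auto simp: abs_if)
  also have "(\<Sum>r\<in>Pow {..<N}. exp (?f r) + exp (- ?f r)) =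
      (\<Prod>v<N. exp (c v) + exp (- c v)) + (\<Prod>v<N. exp (- c v) + exp (- (- c v)))"
    unfolding sum.distrib sum_Pow_exp_signs[symmetric] by (simp add: sum_negf)
  also have "\<dots> / card A \<le> (2 ^ N * exp (?s / 2) + 2 ^ N * exp (?s / 2)) / card A"
    using prod[of c] prod[of "\<lambda>v. - c v"] by (intro divide_right_mono add_mono) auto
  also have "\<dots> = 2 * (real (card (Pow {..<N})) / card A) * exp (?s / 2)" by (simp add: card_Pow)
  finally have "exp (mean A (\<lambda>r. \<bar>?f r\<bar>)) \<le> 2 * (real (card (Pow {..<N})) / card A) * exp (?s / 2)" .
  then have "mean A (\<lambda>r. \<bar>?f r\<bar>) \<le> ln (2 * (real (card (Pow {..<N})) / card A) * exp (?s / 2))"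
    using n by (subst ln_ge_iff) (auto simp: card_Pow)
  also have "\<dots> = ln 2 + ln (real (card (Pow {..<N})) / card A) + ?s / 2"
    using n by (simp add: ln_mult ln_div card_Pow)
  finally show ?thesis using ln_2_less_1 by linarith
qed

lemma card_Pow_containing:
  assumes "v < N"
  shows "2 * card {r \<in> Pow {..<N}. v \<in> r} = 2 ^ N" "2 * card {r \<in> Pow {..<N}. v \<notin> r} = 2 ^ N"
proof -
  have "bij_betw (insert v) {r \<in> Pow {..<N}. v \<notin> r} {r \<in> Pow {..<N}. v \<in> r}"
    by (rule bij_betw_byWitness[where f'="\<lambda>r. r - {v}"]) (use assms in auto)
  then have eq: "card {r \<in> Pow {..<N}. v \<notin> r} = card {r \<in> Pow {..<N}. v \<in> r}"
    by (rule bij_betw_same_card)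
  have "card ({r \<in> Pow {..<N}. v \<in> r} \<union> {r \<in> Pow {..<N}. v \<notin> r}) =
      card {r \<in> Pow {..<N}. v \<in> r} + card {r \<in> Pow {..<N}. v \<notin> r}"
    by (rule card_Un_disjoint) auto
  moreover have "{r \<in> Pow {..<N}. v \<in> r} \<union> {r \<in> Pow {..<N}. v \<notin> r} = Pow {..<N}" by blast
  ultimately have "card (Pow {..<N}) = card {r \<in> Pow {..<N}. v \<in> r} + card {r \<in> Pow {..<N}. v \<notin> r}"
    by (simp only:)
  then show "2 * card {r \<in> Pow {..<N}. v \<in> r} = 2 ^ N" "2 * card {r \<in> Pow {..<N}. v \<notin> r} = 2 ^ N"
    using eq by (simp_all add: card_Pow)
qed

lemma mean_membership_sign:
  assumes "v < N"
  shows "mean (Pow {..<N}) (membership_sign v) = 0"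
proof -
  have "(\<Sum>r\<in>Pow {..<N}. membership_sign v r) =
      (\<Sum>r\<in>Pow {..<N} \<inter> {r. v \<in> r}. 1) + (\<Sum>r\<in>Pow {..<N} \<inter> - {r. v \<in> r}. - 1)"
    unfolding membership_sign_def by (subst sum.If_cases) auto
  also have "\<dots> = real (card {r \<in> Pow {..<N}. v \<in> r}) - real (card {r \<in> Pow {..<N}. v \<notin> r})"
    by (simp add: Int_def)
  also have "\<dots> = 0" using card_Pow_containing[OF assms] by simp
  finally show ?thesis by (simp add: mean_def)
qed

section \<open>Anticoncentration\<close>

text \<open>The factor \<open>sqrt (2 * m + 1)\<close> makes the induction close: consecutive
  central binomials have ratio \<open>2 * (2 * m + 1) / (m + 1)\<close>, and the geometric mean of
  \<open>2 * m + 1\<close> and \<open>2 * m + 3\<close> is at most \<open>2 * m + 2\<close>.\<close>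

lemma central_binomial_le: "real ((2 * m) choose m) * sqrt (real (2 * m + 1)) \<le> 4 ^ m"
proof (induction m)
  case (Suc m)
  have "Suc m * ((2 * Suc m) choose Suc m) = 2 * (2 * m + 1) * ((2 * m) choose m)"
  proof -
    have "Suc m * ((2 * Suc m) choose Suc m) = (2 * Suc m) * (Suc (2 * m) choose m)"
      using Suc_times_binomial_eq[of "Suc (2 * m)" m] by simp
    also have "Suc (2 * m) choose m = Suc (2 * m) choose Suc m"
      using binomial_symmetric[of m "Suc (2 * m)"] by simp
    also have "2 * Suc m * (Suc (2 * m) choose Suc m) = 2 * (Suc (2 * m) * ((2 * m) choose m))"
      using Suc_times_binomial_eq[of "2 * m" m] by (simp only: mult.assoc mult.commute[of "Suc (2 * m) choose Suc m"])
    finally show ?thesis by simp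
  qed
  then have eq: "real (Suc m) * real ((2 * Suc m) choose Suc m) = 2 * (2 * m + 1) * real ((2 * m) choose m)"
    by (metis of_nat_mult of_nat_numeral)
  define a where "a = real m"
  have "sqrt (2 * a + 1) * sqrt (2 * a + 3) \<le> 2 * a + 2"
  proof -
    have "(2 * a + 1) * (2 * a + 3) \<le> (2 * a + 2)\<^sup>2" by (simp add: power2_eq_square algebra_simps)
    then have "sqrt ((2 * a + 1) * (2 * a + 3)) \<le> 2 * a + 2"
      by (intro real_le_lsqrt) (auto simp: a_def)
    then show ?thesis by (simp add: real_sqrt_mult)
  qed
  then have "(real ((2 * m) choose m) * sqrt (2 * a + 1)) * (sqrt (2 * a + 1) * sqrt (2 * a + 3))
      \<le> 4 ^ m * (2 * a + 2)"
    using Suc.IH by (intro mult_mono) (auto simp: a_def add.commute)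
  also have "(real ((2 * m) choose m) * sqrt (2 * a + 1)) * (sqrt (2 * a + 1) * sqrt (2 * a + 3)) =
      (2 * a + 1) * real ((2 * m) choose m) * sqrt (2 * a + 3)"
    by (simp add: a_def)
  finally have "2 * (2 * a + 1) * real ((2 * m) choose m) * sqrt (2 * a + 3) \<le> 4 ^ Suc m * (a + 1)"
    by (simp add: algebra_simps)
  moreover have "2 * (2 * a + 1) * real ((2 * m) choose m) = (a + 1) * real ((2 * Suc m) choose Suc m)"
    using eq by (simp add: a_def add.commute del: binomial_Suc_Suc)
  ultimately have "(a + 1) * real ((2 * Suc m) choose Suc m) * sqrt (2 * a + 3) \<le> 4 ^ Suc m * (a + 1)"
    by (simp only:)
  then have "(a + 1) * (real ((2 * Suc m) choose Suc m) * sqrt (2 * a + 3)) \<le> (a + 1) * 4 ^ Suc m"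
    by (simp only: mult_ac)
  then have "real ((2 * Suc m) choose Suc m) * sqrt (2 * a + 3) \<le> 4 ^ Suc m"
    by (rule mult_left_le_imp_le) (simp add: a_def)
  moreover have "2 * a + 3 = real (2 * Suc m + 1)" by (simp add: a_def)
  ultimately show ?case by simp
qed simp

text \<open>The largest coefficient for odd \<open>s\<close> is half the central one for
  \<open>s + 1\<close>, by Pascal's rule and symmetry.\<close>

lemma odd_binomial_le:
  assumes "odd s"
  shows "real (s choose j) * sqrt (real s) \<le> 2 ^ s"
proof -
  obtain m where s: "s = 2 * m + 1" using assms by (auto elim: oddE)
  have "s choose j \<le> s choose (s div 2)" by (rule binomial_maximum)
  also have "s div 2 = m" using s by simp
  finally have le: "s choose j \<le> s choose m" .
  have "2 * (s choose m) = (2 * Suc m) choose Suc m"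
  proof -
    have "(2 * Suc m) choose Suc m = (s choose m) + (s choose Suc m)" using s by simp
    also have "s choose Suc m = s choose m" using binomial_symmetric[of m s] s by simp
    finally show ?thesis by simp
  qed
  then have eq: "2 * real (s choose m) = real ((2 * Suc m) choose Suc m)"
    by (metis of_nat_mult of_nat_numeral)
  have "real ((2 * Suc m) choose Suc m) * sqrt (real s)
      \<le> real ((2 * Suc m) choose Suc m) * sqrt (real (2 * Suc m + 1))"
    using s by (intro mult_left_mono) auto
  then have "2 * real (s choose m) * sqrt (real s) \<le> 4 ^ Suc m"
    unfolding eq using central_binomial_le[of "Suc m"] by linarith
  also have "(4::real) ^ Suc m = 2 * 2 ^ s" using s by (simp add: power_add power_mult)
  finally have "real (s choose m) * sqrt (real s) \<le> 2 ^ s" by simp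
  moreover have "real (s choose j) * sqrt (real s) \<le> real (s choose m) * sqrt (real s)"
    using le by (intro mult_right_mono) auto
  ultimately show ?thesis by linarith
qed

text \<open>For odd \<open>s\<close> the numbers \<open>2 * j - s\<close> are odd, so none of them
  is below 1 in absolute value. This avoids an additive constant in the bound, which would be fatal
  for small \<open>s\<close>, where \<open>b\<close> may be below 1.\<close>

lemma card_odd_deviation:
  fixes b :: real
  assumes "odd s" and b: "b \<ge> 0"
  shows "real (card {j. \<bar>2 * real j - real s\<bar> < b}) \<le> 2 * b"
proof -
  obtain m where s: "s = 2 * m + 1" using assms by (auto elim: oddE)
  \<comment> \<open>The number of odd values \<open>2 * e + 1\<close> below \<open>b\<close>; each
    is the deviation of at most one \<open>j\<close> on either side of \<open>s / 2\<close>.\<close>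
  define k where "k = nat \<lceil>(b - 1) / 2\<rceil>"
  have "e < k" if "2 * real e + 1 < b" for e
    using that unfolding k_def by (simp add: zless_nat_eq_int_zless less_ceiling_iff)
  then have "j \<in> (\<lambda>e. m + 1 + e) ` {..<k} \<union> (\<lambda>e. m - e) ` {..<k}"
    if "\<bar>2 * real j - real s\<bar> < b" for j
  proof (cases "j \<ge> m + 1")
    case True
    then have "2 * real (j - (m + 1)) + 1 < b" using that s by (simp add: of_nat_diff abs_if split: if_splits)
    then have "j - (m + 1) < k" using \<open>\<And>e. 2 * real e + 1 < b \<Longrightarrow> e < k\<close> by blast
    then show ?thesis using True by (intro UnI1 image_eqI[of _ _ "j - (m + 1)"]) auto
  next
    case False
    then have "2 * real (m - j) + 1 < b" using that s by (simp add: of_nat_diff abs_if split: if_splits)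
    then have "m - j < k" using \<open>\<And>e. 2 * real e + 1 < b \<Longrightarrow> e < k\<close> by blast
    then show ?thesis using False by (intro UnI2 image_eqI[of _ _ "m - j"]) auto
  qed
  then have "card {j. \<bar>2 * real j - real s\<bar> < b} \<le> card ((\<lambda>e. m + 1 + e) ` {..<k} \<union> (\<lambda>e. m - e) ` {..<k})"
    by (intro card_mono) auto
  also have "\<dots> \<le> card ((\<lambda>e. m + 1 + e) ` {..<k}) + card ((\<lambda>e. m - e) ` {..<k})" by (rule card_Un_le)
  also have "\<dots> \<le> k + k" using card_image_le[of "{..<k}" "\<lambda>e. m + 1 + e"] card_image_le[of "{..<k}" "\<lambda>e. m - e"]
    by (intro add_mono) auto
  finally have "real (card {j. \<bar>2 * real j - real s\<bar> < b}) \<le> 2 * real k" by simp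
  moreover have "real k \<le> b"
  proof (cases "b \<ge> 1")
    case True
    then have "\<lceil>(b - 1) / 2\<rceil> \<ge> 0" by simp
    then have "real k = of_int \<lceil>(b - 1) / 2\<rceil>" unfolding k_def by simp
    also have "\<dots> \<le> (b - 1) / 2 + 1" by (rule of_int_ceiling_le_add_one)
    finally show ?thesis using True by (simp add: field_simps)
  next
    case False
    then have "\<lceil>(b - 1) / 2\<rceil> \<le> 0" by (simp add: ceiling_le_iff)
    then show ?thesis unfolding k_def using b by simp
  qed
  ultimately show ?thesis by simp
qed

lemma card_subsets_near_half:
  fixes b :: real
  assumes "odd s" and b: "b \<ge> 0"
  shows "real (card {Y \<in> Pow {..<s}. \<bar>2 * real (card Y) - real s\<bar> < b}) * sqrt (real s) \<le> 2 ^ s * (2 * b)"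
proof -
  let ?J = "{j. \<bar>2 * real j - real s\<bar> < b}"
  have finJ: "finite ?J"
  proof (rule finite_subset)
    show "?J \<subseteq> {..nat \<lceil>real s + b\<rceil>}"
    proof
      fix j assume "j \<in> ?J"
      then have "real j \<le> real s + b" by auto
      then show "j \<in> {..nat \<lceil>real s + b\<rceil>}" by (simp add: le_nat_iff le_ceiling_iff)
    qed
  qed simp
  have "{Y \<in> Pow {..<s}. \<bar>2 * real (card Y) - real s\<bar> < b} = (\<Union>j\<in>?J. {Y. Y \<subseteq> {..<s} \<and> card Y = j})"
    by auto
  also have "card \<dots> \<le> (\<Sum>j\<in>?J. card {Y. Y \<subseteq> {..<s} \<and> card Y = j})"
    by (rule card_UN_le[OF finJ])
  also have "\<dots> = (\<Sum>j\<in>?J. s choose j)" by (simp add: n_subsets)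
  finally have "real (card {Y \<in> Pow {..<s}. \<bar>2 * real (card Y) - real s\<bar> < b}) \<le> (\<Sum>j\<in>?J. real (s choose j))"
    unfolding of_nat_sum[symmetric] by (rule of_nat_mono)
  then have "real (card {Y \<in> Pow {..<s}. \<bar>2 * real (card Y) - real s\<bar> < b}) * sqrt (real s)
      \<le> (\<Sum>j\<in>?J. real (s choose j)) * sqrt (real s)" by (intro mult_right_mono) auto
  also have "\<dots> \<le> (\<Sum>j\<in>?J. 2 ^ s)"
    unfolding sum_distrib_right by (intro sum_mono odd_binomial_le assms)
  also have "\<dots> = 2 ^ s * real (card ?J)" by simp
  also have "\<dots> \<le> 2 ^ s * (2 * b)" by (intro mult_left_mono card_odd_deviation assms) auto
  finally show ?thesis .
qed


section \<open>Protocols that guess many majorities\<close>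

text \<open>Only the first \<open>m\<close> sites hold private bits: site \<open>i\<close> holds the set of columns with bit one.\<close>

definition sign_inputs :: "nat \<Rightarrow> nat \<Rightarrow> nat \<Rightarrow> nat set set" where
  "sign_inputs m N i = (if i < m then Pow {..<N} else {{}})"

definition site_sign :: "nat \<Rightarrow> nat \<Rightarrow> nat \<Rightarrow> nat set \<Rightarrow> real" where
  "site_sign m i v r = (if i < m then membership_sign v r else 0)"

lemma site_signs_cube:
  "site_signs {..<s} (sign_inputs m N) N (site_sign m) (\<lambda>i. if i < m then 1 else 0)"
proof
  fix i v assume "i \<in> {..<s}" "v < N"
  then show "mean (sign_inputs m N i) (site_sign m i v) = 0"
    using mean_membership_sign[of v N] unfolding sign_inputs_def site_sign_def by auto
next
  fix i A and c :: "nat \<Rightarrow> real"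
  assume "i \<in> {..<s}" "A \<subseteq> sign_inputs m N i" "A \<noteq> {}"
  then show "mean A (\<lambda>y. \<bar>\<Sum>v<N. c v * site_sign m i v y\<bar>)
      \<le> ln (real (card (sign_inputs m N i)) / real (card A))
        + (if i < m then 1 else 0) * (1 + (\<Sum>v<N. (c v)\<^sup>2) / 2)"
    using mean_abs_linear_form_signs[of A N c] unfolding sign_inputs_def site_sign_def
    by (auto simp: subset_singleton_iff)
qed (auto simp: sign_inputs_def site_sign_def membership_sign_def)

abbreviation column_sum :: "nat \<Rightarrow> nat \<Rightarrow> (nat \<Rightarrow> nat set) \<Rightarrow> real" where
  "column_sum m v x \<equiv> (\<Sum>i<m. membership_sign v (x i))"

abbreviation sign_cube :: "nat \<Rightarrow> nat \<Rightarrow> nat \<Rightarrow> (nat \<Rightarrow> nat set) set" where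
  "sign_cube s m N \<equiv> PiE {..<s} (sign_inputs m N)"

text \<open>Prescribing the bit of \<open>v\<close> halves each of the first \<open>m\<close>
  factors of the cube and leaves the one-point factors alone, so all vote patterns of a column are
  equally likely.\<close>

lemma card_column_fiber:
  assumes m: "m \<le> s" and v: "v < N" and Y: "Y \<subseteq> {..<m}"
  shows "card {x \<in> sign_cube s m N. {i \<in> {..<m}. v \<in> x i} = Y} * 2 ^ m = card (sign_cube s m N)"
proof -
  define R where "R i = {r \<in> sign_inputs m N i. i < m \<longrightarrow> (v \<in> r \<longleftrightarrow> i \<in> Y)}" for i
  have "{x \<in> sign_cube s m N. {i \<in> {..<m}. v \<in> x i} = Y} = PiE {..<s} R"
    using m Y by (auto simp: R_def PiE_iff extensional_def)
  then have "card {x \<in> sign_cube s m N. {i \<in> {..<m}. v \<in> x i} = Y} = (\<Prod>i<s. card (R i))"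
    by (simp only: card_PiE finite_lessThan)
  note f1 = this
  have f2: "(2::nat) ^ m = (\<Prod>i<s. if i < m then 2 else 1)"
  proof -
    have "{i \<in> {..<s}. i < m} = {..<m}" using m by auto
    then show ?thesis by (simp add: prod.If_cases Int_def)
  qed
  have f3: "card (R i) * (if i < m then 2 else 1) = card (sign_inputs m N i)" for i
  proof (cases "i < m")
    case True
    then have "R i = (if i \<in> Y then {r \<in> Pow {..<N}. v \<in> r} else {r \<in> Pow {..<N}. v \<notin> r})"
      unfolding R_def sign_inputs_def by auto
    then show ?thesis using True card_Pow_containing[OF v]
      by (auto simp: sign_inputs_def card_Pow mult.commute)
  next
    case False
    then have "R i = {{}}" unfolding R_def sign_inputs_def by auto
    then show ?thesis using False by (simp add: sign_inputs_def)
  qed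
  have "card {x \<in> sign_cube s m N. {i \<in> {..<m}. v \<in> x i} = Y} * 2 ^ m =
      (\<Prod>i<s. card (R i) * (if i < m then 2 else 1))" unfolding f1 f2 prod.distrib ..
  also have "\<dots> = (\<Prod>i<s. card (sign_inputs m N i))" by (intro prod.cong refl f3)
  also have "\<dots> = card (sign_cube s m N)" by (simp add: card_PiE)
  finally show ?thesis .
qed

lemma column_sum_eq:
  "column_sum m v x = 2 * real (card {i \<in> {..<m}. v \<in> x i}) - real m"
proof -
  have "card ({i \<in> {..<m}. v \<in> x i} \<union> {i \<in> {..<m}. v \<notin> x i}) =
      card {i \<in> {..<m}. v \<in> x i} + card {i \<in> {..<m}. v \<notin> x i}"
    by (rule card_Un_disjoint) auto
  moreover have "{i \<in> {..<m}. v \<in> x i} \<union> {i \<in> {..<m}. v \<notin> x i} = {..<m}" by blast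
  ultimately have "card {..<m} = card {i \<in> {..<m}. v \<in> x i} + card {i \<in> {..<m}. v \<notin> x i}"
    by (simp only:)
  then have "m = card {i \<in> {..<m}. v \<in> x i} + card {i \<in> {..<m}. v \<notin> x i}"
    by (simp only: card_lessThan)
  then have "real m = real (card {i \<in> {..<m}. v \<in> x i}) + real (card {i \<in> {..<m}. v \<notin> x i})"
    by (metis of_nat_add)
  moreover have "column_sum m v x = (\<Sum>i\<in>{..<m} \<inter> {i. v \<in> x i}. 1) + (\<Sum>i\<in>{..<m} \<inter> - {i. v \<in> x i}. - 1)"
    unfolding membership_sign_def by (subst sum.If_cases) auto
  ultimately show ?thesis by (simp add: Int_def)
qed

lemma finite_sign_cube: "finite (sign_cube s m N)"
  by (intro finite_PiE) (auto simp: sign_inputs_def)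

lemma card_column_sum_small:
  assumes m: "odd m" "m \<le> s" and v: "v < N" and b: "b \<ge> 0"
  shows "real (card {x \<in> sign_cube s m N. \<bar>column_sum m v x\<bar> < b * sqrt (real m)})
    \<le> 2 * b * real (card (sign_cube s m N))"
proof -
  let ?\<Y> = "{Y \<in> Pow {..<m}. \<bar>2 * real (card Y) - real m\<bar> < b * sqrt (real m)}"
  have m0: "real m > 0" using m by (auto intro: odd_pos)
  have un: "{x \<in> sign_cube s m N. \<bar>column_sum m v x\<bar> < b * sqrt (real m)} =
      (\<Union>Y\<in>?\<Y>. {x \<in> sign_cube s m N. {i \<in> {..<m}. v \<in> x i} = Y})"
    unfolding column_sum_eq by auto
  have "card {x \<in> sign_cube s m N. \<bar>column_sum m v x\<bar> < b * sqrt (real m)} \<le>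
      (\<Sum>Y\<in>?\<Y>. card {x \<in> sign_cube s m N. {i \<in> {..<m}. v \<in> x i} = Y})"
    unfolding un by (rule card_UN_le) simp
  then have "card {x \<in> sign_cube s m N. \<bar>column_sum m v x\<bar> < b * sqrt (real m)} * 2 ^ m \<le>
      (\<Sum>Y\<in>?\<Y>. card {x \<in> sign_cube s m N. {i \<in> {..<m}. v \<in> x i} = Y}) * 2 ^ m"
    by (rule mult_le_mono1)
  also have "\<dots> = (\<Sum>Y\<in>?\<Y>. card {x \<in> sign_cube s m N. {i \<in> {..<m}. v \<in> x i} = Y} * 2 ^ m)"
    by (rule sum_distrib_right)
  also have "\<dots> = (\<Sum>Y\<in>?\<Y>. card (sign_cube s m N))"
    by (intro sum.cong refl card_column_fiber m v) auto
  also have "\<dots> = card ?\<Y> * card (sign_cube s m N)" by simp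
  finally have "real (card {x \<in> sign_cube s m N. \<bar>column_sum m v x\<bar> < b * sqrt (real m)}) * 2 ^ m \<le>
      real (card ?\<Y>) * real (card (sign_cube s m N))"
    by (subst of_nat_mult[symmetric], subst of_nat_numeral[symmetric], subst of_nat_power[symmetric],
        subst of_nat_mult[symmetric]) (rule of_nat_mono)
  also have "\<dots> \<le> (2 ^ m * (2 * b)) * real (card (sign_cube s m N))"
  proof (rule mult_right_mono)
    have "real (card ?\<Y>) * sqrt (real m) \<le> 2 ^ m * (2 * (b * sqrt (real m)))"
      using m b by (intro card_subsets_near_half) auto
    then have "real (card ?\<Y>) * sqrt (real m) \<le> (2 ^ m * (2 * b)) * sqrt (real m)" by (simp add: mult.assoc)
    then show "real (card ?\<Y>) \<le> 2 ^ m * (2 * b)"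
      by (rule mult_right_le_imp_le) (use m0 in simp)
  qed simp
  finally have "2 ^ m * real (card {x \<in> sign_cube s m N. \<bar>column_sum m v x\<bar> < b * sqrt (real m)})
      \<le> 2 ^ m * (2 * b * real (card (sign_cube s m N)))" by (simp only: mult_ac)
  then show ?thesis by (rule mult_left_le_imp_le) simp
qed

text \<open>Correct guesses on half of the cube make the mean square of the guessed sum at least
  \<open>\<tau> * N^2 * m\<close>, whereas \<open>sum_square_protocol\<close> keeps it strictly
  below that if \<open>B\<close> is small.\<close>

lemma communication_lower_bound:
  fixes t :: "'o coordinator" and d \<tau> B :: real and m s N :: nat and c :: "'o \<Rightarrow> nat \<Rightarrow> real"
  assumes m: "odd m" "m \<le> s" and d: "0 < d" "d \<le> 1" and sites: "sites_used t \<subseteq> {..<s}"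
    and Z: "Z \<subseteq> sign_cube s m N" "2 * card Z \<ge> card (sign_cube s m N)"
    and c: "\<And>out v. v < N \<Longrightarrow> \<bar>c out v\<bar> \<le> 1"
    and guess: "\<And>x. x \<in> Z \<Longrightarrow> \<exists>T\<subseteq>{..<N}. real (card T) \<ge> d * real N \<and>
      (\<Sum>v\<in>T. \<bar>column_sum m v x\<bar>) \<le> \<bar>\<Sum>v<N. c (fst (execute t \<sigma> x h)) v * column_sum m v x\<bar>"
    and \<tau>_def: "\<tau> = d ^ 4 / 4096" and N: "real N \<ge> 16 / \<tau>\<^sup>2"
    and bits: "\<And>x. x \<in> sign_cube s m N \<Longrightarrow> real (snd (execute t \<sigma> x h)) \<le> B"
  shows "B > \<tau>\<^sup>2 / 16 * real N * real m"
proof (rule ccontr)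
  assume "\<not> B > \<tau>\<^sup>2 / 16 * real N * real m"
  then have B: "B \<le> \<tau>\<^sup>2 / 16 * real N * real m" by simp
  let ?\<Omega> = "sign_cube s m N" and ?w = "\<lambda>v x. column_sum m v x"
  interpret site_signs "{..<s}" "sign_inputs m N" N "site_sign m" "\<lambda>i. if i < m then 1 else 0"
    by (rule site_signs_cube)
  have \<tau>: "0 < \<tau>" "\<tau> \<le> 1" unfolding \<tau>_def using d power_le_one[of d 4] by auto
  have m0: "real m \<ge> 1" using m by (cases m) auto
  have N0: "real N > 0" using N \<tau> by (smt (verit) divide_pos_pos zero_less_power)
  have "?\<Omega> \<noteq> {}" by (auto simp: PiE_eq_empty_iff sign_inputs_def)
  then have \<Omega>: "real (card ?\<Omega>) > 0" using finite_sign_cube by (simp add: card_gt_0_iff)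
  have sub: "{i \<in> {..<s}. i < m} = {..<m}" using m by auto
  have Wc: "W v x = ?w v x" for v x
    unfolding W_def site_sign_def using sub by (simp add: sum.If_cases Int_def)
  have S: "(\<Sum>i<s. (if i < m then 1 else 0)) = real m" using sub by (simp add: sum.If_cases Int_def)

  \<comment> \<open>With this scale \<open>B / l\<close> contributes at most an eighth of
    \<open>\<tau> * N * m\<close>, the term with \<open>l * N\<close> a quarter,
    \<open>2 * B\<close> another eighth, and the terms without \<open>N\<close> a quarter because
    \<open>N\<close> is large.\<close>
  define l where "l = \<tau> / 2"
  have "(\<Sum>x\<in>?\<Omega>. (\<Sum>v<N. c (fst (execute t \<sigma> x h)) v * ?w v x)\<^sup>2) \<le>
      real (card ?\<Omega>) * N * ((B + m) / l + m * l * N / 2 + 2 * (B + m))"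
  proof -
    have "(\<Sum>x\<in>?\<Omega>. (\<Sum>v<N. c (fst (execute t \<sigma> x h)) v * W v x)\<^sup>2) \<le> real (card ?\<Omega>) * N *
        ((B + (\<Sum>i<s. (if i < m then 1 else 0))) / l + (\<Sum>i<s. (if i < m then 1 else 0)) * l * N / 2
          + 2 * (B + (\<Sum>i<s. (if i < m then 1 else 0))))"
      by (rule sum_square_protocol[OF sites]) (use bits c \<tau> in \<open>auto simp: l_def\<close>)
    then show ?thesis unfolding Wc S .
  qed
  also have "\<dots> < real (card ?\<Omega>) * N * (\<tau> * N * m)"
  proof -
    have "(B + m) / l \<le> (\<tau>\<^sup>2 / 16 * N * m + m) / l"
      using B \<tau> by (intro divide_right_mono) (auto simp: l_def)
    also have "\<dots> = \<tau> * N * m / 8 + 2 * (m / \<tau>)" using \<tau> by (simp add: l_def field_simps power2_eq_square)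
    finally have 1: "(B + m) / l \<le> \<tau> * N * m / 8 + 2 * (m / \<tau>)" .
    have 2: "m * l * N / 2 = \<tau> * N * m / 4" by (simp add: l_def)
    have "\<tau>\<^sup>2 * N * m \<le> \<tau> * N * m" using \<tau> by (intro mult_right_mono) (auto simp: power2_eq_square mult_left_le)
    then have 3: "2 * (B + m) \<le> \<tau> * N * m / 8 + 2 * m" using B by simp
    have "real m \<le> m / \<tau>" using \<tau> by (simp add: field_simps mult_left_le_one_le)
    moreover have "4 * (m / \<tau>) \<le> \<tau> * N * m / 4"
    proof -
      have "16 \<le> N * \<tau>\<^sup>2" using N \<tau> by (simp add: field_simps)
      then have "4 / \<tau> \<le> \<tau> * N / 4" using \<tau> by (simp add: field_simps power2_eq_square)
      then have "4 / \<tau> * m \<le> \<tau> * N / 4 * m" by (intro mult_right_mono) auto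
      then show ?thesis by simp
    qed
    moreover have "\<tau> * N * m > 0" using \<tau> N0 m0 by simp
    ultimately have "(B + m) / l + m * l * N / 2 + 2 * (B + m) < \<tau> * N * m"
      using 1 2 3 by linarith
    then show ?thesis using \<Omega> N0 by (intro mult_strict_left_mono) auto
  qed
  finally have upper: "(\<Sum>x\<in>?\<Omega>. (\<Sum>v<N. c (fst (execute t \<sigma> x h)) v * ?w v x)\<^sup>2)
      < real (card ?\<Omega>) * N * (\<tau> * N * m)" .

  \<comment> \<open>A column is bad with probability at most \<open>2 * b = d / 8\<close>, so by
    Markov's inequality more than \<open>d * N / 2\<close> columns are bad on at most a quarter of
    the cube. Of the half on which the guess succeeds, at least a quarter of the cube
    remains.\<close>
  define b where "b = d / 16"
  define bad where "bad x = {v \<in> {..<N}. \<bar>?w v x\<bar> < b * sqrt (real m)}" for x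
  define X where "X = {x \<in> ?\<Omega>. real (card (bad x)) > d * N / 2}"
  have b: "b > 0" using d by (simp add: b_def)
  have Xsub: "X \<subseteq> ?\<Omega>" unfolding X_def by (rule Collect_restrict)
  have "(\<Sum>x\<in>?\<Omega>. real (card (bad x))) =
      (\<Sum>x\<in>?\<Omega>. \<Sum>v<N. if \<bar>?w v x\<bar> < b * sqrt (real m) then 1 else 0)"
    by (intro sum.cong refl) (simp add: bad_def sum.If_cases Int_def)
  also have "\<dots> = (\<Sum>v<N. \<Sum>x\<in>?\<Omega>. if \<bar>?w v x\<bar> < b * sqrt (real m) then 1 else 0)"
    by (rule sum.swap)
  also have "\<dots> = (\<Sum>v<N. real (card {x \<in> ?\<Omega>. \<bar>?w v x\<bar> < b * sqrt (real m)}))"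
    by (intro sum.cong refl) (simp add: sum.If_cases Int_def finite_sign_cube)
  also have "\<dots> \<le> (\<Sum>v<N. 2 * b * real (card ?\<Omega>))"
    using m b by (intro sum_mono card_column_sum_small) auto
  also have "\<dots> = d * N / 8 * real (card ?\<Omega>)" by (simp add: b_def)
  finally have badsum: "(\<Sum>x\<in>?\<Omega>. real (card (bad x))) \<le> d * N / 8 * real (card ?\<Omega>)" .
  have "real (card X) * (d * N / 2) = (\<Sum>x\<in>X. d * N / 2)" by simp
  also have "\<dots> \<le> (\<Sum>x\<in>X. real (card (bad x)))" by (intro sum_mono) (auto simp: X_def)
  also have "\<dots> \<le> (\<Sum>x\<in>?\<Omega>. real (card (bad x)))"
    by (intro sum_mono2 finite_sign_cube Xsub) simp
  finally have "real (card X) * (d * N / 2) \<le> d * N / 8 * real (card ?\<Omega>)" using badsum by linarith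
  then have "real (card X) * (d * N / 2) \<le> (real (card ?\<Omega>) / 4) * (d * N / 2)" by (simp add: mult_ac)
  then have X: "real (card X) \<le> real (card ?\<Omega>) / 4"
    by (rule mult_right_le_imp_le) (use d N0 in simp)
  have finZ: "finite Z" by (rule finite_subset[OF Z(1) finite_sign_cube])
  have "finite X" by (rule finite_subset[OF Xsub finite_sign_cube])
  then have "card Z - card X \<le> card (Z - X)" by (rule diff_card_le_card_Diff)
  then have "real (card Z) - real (card X) \<le> real (card (Z - X))" by linarith
  then have ZX: "real (card ?\<Omega>) / 4 \<le> real (card (Z - X))" using X Z(2) by linarith
  have big: "real N * (\<tau> * N * m) * 4 \<le> (\<Sum>v<N. c (fst (execute t \<sigma> x h)) v * ?w v x)\<^sup>2"
    if x: "x \<in> Z - X" for x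
  proof -
    obtain T where T: "T \<subseteq> {..<N}" "real (card T) \<ge> d * N"
      "(\<Sum>v\<in>T. \<bar>?w v x\<bar>) \<le> \<bar>\<Sum>v<N. c (fst (execute t \<sigma> x h)) v * ?w v x\<bar>"
      using guess[of x] x by blast
    have finT: "finite T" using T(1) finite_subset by blast
    have "real (card (bad x)) \<le> d * N / 2" using x subsetD[OF Z(1), of x] by (simp add: X_def not_less)
    moreover have "card T - card (bad x) \<le> card (T - bad x)"
      by (rule diff_card_le_card_Diff) (simp add: bad_def)
    ultimately have "d * N / 2 \<le> real (card (T - bad x))" using T(2) by linarith
    then have "d * N / 2 * (b * sqrt m) \<le> real (card (T - bad x)) * (b * sqrt m)"
      using b by (intro mult_right_mono) auto
    also have "\<dots> = (\<Sum>v\<in>T - bad x. b * sqrt m)" by simp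
    also have "\<dots> \<le> (\<Sum>v\<in>T - bad x. \<bar>?w v x\<bar>)"
      using T(1) by (intro sum_mono) (auto simp: bad_def not_less)
    also have "\<dots> \<le> (\<Sum>v\<in>T. \<bar>?w v x\<bar>)" using finT by (intro sum_mono2) auto
    finally have "d * N / 2 * (b * sqrt m) \<le> \<bar>\<Sum>v<N. c (fst (execute t \<sigma> x h)) v * ?w v x\<bar>"
      using T(3) by linarith
    then have "(d * N / 2 * (b * sqrt m))\<^sup>2 \<le> \<bar>\<Sum>v<N. c (fst (execute t \<sigma> x h)) v * ?w v x\<bar>\<^sup>2"
      using d b by (intro power_mono) auto
    \<comment> \<open>The square is \<open>d ^ 4 / 1024\<close> times \<open>N^2 * m\<close>, and
      4096 is 4 times 1024: the factor 4 compensates for having only a quarter of the cube.\<close>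
    moreover have "(d * N / 2 * (b * sqrt m))\<^sup>2 = real N * (\<tau> * N * m) * 4"
      by (simp add: power_mult_distrib \<tau>_def b_def field_simps power2_eq_square power4_eq_xxxx)
    ultimately show ?thesis by simp
  qed
  have "real (card ?\<Omega>) * N * (\<tau> * N * m) = (real (card ?\<Omega>) / 4) * (real N * (\<tau> * N * m) * 4)" by simp
  also have "\<dots> \<le> real (card (Z - X)) * (real N * (\<tau> * N * m) * 4)"
    using \<tau> by (intro mult_right_mono ZX) auto
  also have "\<dots> = (\<Sum>x\<in>Z - X. real N * (\<tau> * N * m) * 4)" by simp
  also have "\<dots> \<le> (\<Sum>x\<in>Z - X. (\<Sum>v<N. c (fst (execute t \<sigma> x h)) v * ?w v x)\<^sup>2)"
    by (intro sum_mono big)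
  also have "\<dots> \<le> (\<Sum>x\<in>?\<Omega>. (\<Sum>v<N. c (fst (execute t \<sigma> x h)) v * ?w v x)\<^sup>2)"
    by (intro sum_mono2 finite_sign_cube) (use Z(1) in blast, simp)
  finally show False using upper by linarith
qed

section \<open>Cliques with attached vertices\<close>

text \<open>The index set \<open>J\<close> and the outer set are arbitrary because the subgraph
  induced by one cluster is again such a graph, with \<open>J = {j}\<close>; that instance yields
  the expansion of the clusters. \<open>D\<close> bounds the weight between one core vertex and the
  outer vertices, and \<open>16 * D \<le> q\<close> is the sense in which the cliques
  dominate.\<close>

locale core_graph =
  fixes w :: weight and J :: "nat set" and q :: nat and C Out :: "nat set"
    and h :: "nat \<Rightarrow> nat" and D :: real
  assumes finite_C: "finite C" and finite_Out: "finite Out" and disjoint: "C \<inter> Out = {}"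
    and finite_J: "finite J"
    and sym: "w u v = w v u" and nonneg: "0 \<le> w u v"
    and core_weight: "u \<in> C \<Longrightarrow> v \<in> C \<Longrightarrow> w u v = (if u \<noteq> v \<and> h u = h v then 1 else 0)"
    and out_weight: "u \<in> Out \<Longrightarrow> v \<in> Out \<Longrightarrow> w u v = 0"
    and home_core: "u \<in> C \<Longrightarrow> h u \<in> J" and home_out: "u \<in> Out \<Longrightarrow> h u \<in> J"
    and core_size: "i \<in> J \<Longrightarrow> card {u \<in> C. h u = i} = q"
    and load: "u \<in> C \<Longrightarrow> (\<Sum>x\<in>Out. w u x) \<le> D"
    and D_le: "16 * D \<le> real q" and q_ge: "q \<ge> 2"
begin

abbreviation V :: "nat set" where "V \<equiv> C \<union> Out"

lemma finite_V: "finite V"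
  using finite_C finite_Out by simp

lemma sum_V: "(\<Sum>u\<in>V. f u) = (\<Sum>u\<in>C. f u) + (\<Sum>u\<in>Out. f u)" for f :: "nat \<Rightarrow> real"
  using finite_C finite_Out disjoint by (rule sum.union_disjoint)

lemma sum_core_weight:
  assumes "u \<in> C"
  shows "(\<Sum>v\<in>C. w u v) = real q - 1"
proof -
  have "(\<Sum>v\<in>C. w u v) = (\<Sum>v\<in>C. if v \<in> {v \<in> C. h v = h u} - {u} then 1 else 0)"
    using assms by (intro sum.cong refl) (auto simp: core_weight)
  also have "\<dots> = real (card ({v \<in> C. h v = h u} - {u}))"
    using finite_C by (subst sum.inter_restrict[symmetric]) (auto intro!: arg_cong[where f=card])
  also have "\<dots> = real q - 1"
    using core_size[OF home_core[OF assms]] assms finite_C q_ge by (simp add: card_Diff_singleton_if of_nat_diff)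
  finally show ?thesis .
qed

lemma load_out_le:
  assumes "P \<subseteq> C" "Q \<subseteq> Out"
  shows "(\<Sum>x\<in>Q. \<Sum>u\<in>P. w x u) \<le> real (card P) * D"
proof -
  have "(\<Sum>x\<in>Q. \<Sum>u\<in>P. w x u) = (\<Sum>u\<in>P. \<Sum>x\<in>Q. w u x)"
    by (subst sum.swap) (simp add: sym)
  also have "\<dots> \<le> (\<Sum>u\<in>P. D)"
  proof (rule sum_mono)
    fix u assume u: "u \<in> P"
    have "(\<Sum>x\<in>Q. w u x) \<le> (\<Sum>x\<in>Out. w u x)"
      by (intro sum_mono2 finite_Out assms nonneg)
    then show "(\<Sum>x\<in>Q. w u x) \<le> D" using load[of u] u assms(1) by auto
  qed
  finally show ?thesis by simp
qed

text \<open>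
  At least a quarter of every core lies outside \<open>P\<close>, so a core vertex of \<open>P\<close> already sends a constant
  fraction of its degree across; the edges leaving the outer part of \<open>P\<close> are either cut or charged to
  core vertices of \<open>P\<close>.
\<close>

lemma cut_ge_volume:
  assumes P: "P \<subseteq> V" and light: "\<And>i. i \<in> J \<Longrightarrow> 4 * card {u \<in> P \<inter> C. h u = i} \<le> 3 * q"
  shows "volume w V P / 8 \<le> cut w P (V - P)"
proof -
  define Pc where "Pc = P \<inter> C"
  define Po where "Po = P \<inter> Out"
  define e where "e = (\<Sum>x\<in>Po. \<Sum>u\<in>C. w x u)"
  define s where "s = (\<Sum>x\<in>Po. \<Sum>u\<in>C - P. w x u)"
  have fin: "finite Pc" "finite Po" "Pc \<subseteq> C" "Po \<subseteq> Out" "Pc \<inter> Po = {}" "P = Pc \<union> Po"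
    using finite_C finite_Out disjoint P unfolding Pc_def Po_def by auto
  have sumP: "(\<Sum>u\<in>P. f u) = (\<Sum>u\<in>Pc. f u) + (\<Sum>u\<in>Po. f u)" for f :: "nat \<Rightarrow> real"
    unfolding fin(6) using fin by (intro sum.union_disjoint) auto
  have "volume w V P = (\<Sum>u\<in>Pc. (\<Sum>v\<in>C. w u v) + (\<Sum>v\<in>Out. w u v)) + (\<Sum>x\<in>Po. (\<Sum>v\<in>C. w x v) + (\<Sum>v\<in>Out. w x v))"
    unfolding volume_def degree_def sum_V sumP ..
  also have "(\<Sum>x\<in>Po. (\<Sum>v\<in>C. w x v) + (\<Sum>v\<in>Out. w x v)) = e"
    unfolding e_def using fin(4) by (intro sum.cong refl) (auto simp: out_weight)
  also have "(\<Sum>u\<in>Pc. (\<Sum>v\<in>C. w u v) + (\<Sum>v\<in>Out. w u v)) \<le> (\<Sum>u\<in>Pc. real q + D)"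
    using fin(3) load by (intro sum_mono add_mono) (auto simp: sum_core_weight)
  finally have vol: "volume w V P \<le> real (card Pc) * (real q + D) + e" by simp
  have inner: "real q / 4 \<le> (\<Sum>v\<in>C - P. w u v)" if u: "u \<in> Pc" for u
  proof -
    have uC: "u \<in> C" and uP: "u \<in> P" using u unfolding Pc_def by auto
    have i: "h u \<in> J" by (rule home_core[OF uC])
    have "(\<Sum>v\<in>C - P. w u v) = (\<Sum>v\<in>C - P. if v \<in> {v \<in> C. h v = h u} - {v \<in> P \<inter> C. h v = h u} then 1 else 0)"
      using uC uP by (intro sum.cong refl) (auto simp: core_weight)
    also have "\<dots> = real (card ({v \<in> C. h v = h u} - {v \<in> P \<inter> C. h v = h u}))"
      using finite_C by (subst sum.inter_restrict[symmetric]) (auto intro!: arg_cong[where f=card])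
    also have "\<dots> = real q - real (card {v \<in> P \<inter> C. h v = h u})"
      using finite_C core_size[OF i] light[OF i] by (subst card_Diff_subset) (auto simp: of_nat_diff)
    finally show ?thesis using light[OF i] by simp
  qed
  have "cut w P (V - P) = (\<Sum>u\<in>Pc. \<Sum>v\<in>V - P. w u v) + (\<Sum>u\<in>Po. \<Sum>v\<in>V - P. w u v)"
    unfolding cut_def sumP ..
  also have "\<dots> \<ge> (\<Sum>u\<in>Pc. \<Sum>v\<in>C - P. w u v) + s"
    unfolding s_def using finite_V by (intro add_mono sum_mono sum_mono2 nonneg) auto
  finally have "(\<Sum>u\<in>Pc. \<Sum>v\<in>C - P. w u v) + s \<le> cut w P (V - P)" .
  moreover have "(\<Sum>u\<in>Pc. real q / 4) \<le> (\<Sum>u\<in>Pc. \<Sum>v\<in>C - P. w u v)"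
    by (intro sum_mono inner)
  ultimately have cut: "real (card Pc) * (real q / 4) + s \<le> cut w P (V - P)" by simp
  have s0: "s \<ge> 0" unfolding s_def by (intro sum_nonneg nonneg)
  have "e = s + (\<Sum>x\<in>Po. \<Sum>u\<in>Pc. w x u)"
  proof -
    have "(\<Sum>u\<in>C. w x u) = (\<Sum>u\<in>C - P. w x u) + (\<Sum>u\<in>Pc. w x u)" for x
      using sum.subset_diff[OF fin(3) finite_C, of "w x"] by (simp add: Pc_def Diff_Int)
    then show ?thesis unfolding e_def s_def by (simp add: sum.distrib)
  qed
  then have "e \<le> s + real (card Pc) * D" using load_out_le[OF fin(3,4)] by simp
  then have es: "e / 8 \<le> s + real (card Pc) * D / 8" using s0 by simp
  have "real (card Pc) * (real q + D) / 8 + real (card Pc) * D / 8 = real (card Pc) * ((real q + 2 * D) / 8)"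
    by (simp add: field_simps)
  also have "\<dots> \<le> real (card Pc) * (real q / 4)" using D_le by (intro mult_left_mono) auto
  finally show ?thesis using vol cut es by linarith
qed

lemma degree_out: "x \<in> Out \<Longrightarrow> degree w V x = (\<Sum>u\<in>C. w x u)"
  unfolding degree_def sum_V by (simp add: out_weight)

lemma degree_core: "u \<in> C \<Longrightarrow> degree w V u = real q - 1 + (\<Sum>x\<in>Out. w u x)"
  unfolding degree_def sum_V by (simp add: sum_core_weight)

lemma conductance_ge:
  assumes P: "P \<subseteq> V" "P \<noteq> {}" and pos: "\<And>v. v \<in> P \<Longrightarrow> degree w V v > 0"
    and light: "\<And>i. i \<in> J \<Longrightarrow> 4 * card {u \<in> P \<inter> C. h u = i} \<le> 3 * q"
  shows "1 / 8 \<le> conductance w V P"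
proof -
  have "volume w V P > 0" unfolding volume_def
    using P pos finite_V finite_subset by (intro sum_pos) auto
  then show ?thesis unfolding conductance_def
    using cut_ge_volume[OF P(1) light] by (simp add: field_simps)
qed

text \<open>A set with more than three quarters of the only core has more than half of the volume,
  because the outer edges add at most \<open>2 * q * D\<close> to \<open>q * (q - 1)\<close>. The
  sets to be tested are therefore light, and \<open>conductance_ge\<close> applies.\<close>

lemma single_core_expansion:
  assumes J: "J = {j}" and pos: "\<And>v. v \<in> V \<Longrightarrow> degree w V v > 0"
  shows "expansion_at_least (1 / 8) w V"
  unfolding expansion_at_least_def
proof (intro allI impI)
  fix S assume S: "S \<noteq> {} \<and> S \<subset> V \<and> volume w V S \<le> volume w V V / 2"
  have hC: "{u \<in> C. h u = j} = C" using home_core J by auto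
  have cC: "card C = q" using core_size[of j] J hC by simp
  show "1 / 8 \<le> conductance w V S"
  proof (rule conductance_ge)
    fix i assume "i \<in> J"
    then have i: "i = j" using J by simp
    show "4 * card {u \<in> S \<inter> C. h u = i} \<le> 3 * q"
    proof (rule ccontr)
      assume "\<not> ?thesis"
      then have big: "3 * real q < 4 * real (card {u \<in> S \<inter> C. h u = i})" by linarith
      have fS: "finite S" using S finite_V finite_subset by blast
      have "{u \<in> S \<inter> C. h u = i} = S \<inter> C" using hC i by auto
      then have big: "3 * real q < 4 * real (card (S \<inter> C))" using big by simp
      have "real (card (S \<inter> C)) * (real q - 1) = (\<Sum>u\<in>S \<inter> C. real q - 1)" by simp
      also have "\<dots> \<le> (\<Sum>u\<in>S \<inter> C. degree w V u)"
        by (intro sum_mono) (auto simp: degree_core intro!: sum_nonneg nonneg)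
      also have "\<dots> \<le> volume w V S"
        unfolding volume_def using fS by (intro sum_mono2) (auto simp: degree_def intro!: sum_nonneg nonneg)
      finally have "real (card (S \<inter> C)) * (real q - 1) \<le> volume w V S" .
      moreover have "volume w V V \<le> real q * (real q - 1) + 2 * (real q * D)"
      proof -
        have "volume w V V = (\<Sum>u\<in>C. real q - 1 + (\<Sum>x\<in>Out. w u x)) + (\<Sum>x\<in>Out. \<Sum>u\<in>C. w x u)"
          unfolding volume_def sum_V by (simp add: degree_core degree_out)
        also have "\<dots> \<le> (\<Sum>u\<in>C. real q - 1 + D) + real (card C) * D"
          by (intro add_mono sum_mono load load_out_le order.refl)
        finally show ?thesis unfolding cC[symmetric] by (simp add: algebra_simps)
      qed
      moreover have "3 * (real q * (real q - 1)) < 4 * (real (card (S \<inter> C)) * (real q - 1))"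
        using mult_strict_right_mono[OF big, of "real q - 1"] q_ge by (simp only: mult.assoc)
      moreover have "2 * volume w V S \<le> volume w V V" using S by simp
      ultimately have "real q * (real q - 1) < 4 * (real q * D)" by linarith
      then have "real q * ((real q - 1) / 4) < real q * D" by simp
      then have "(real q - 1) / 4 < D" using q_ge by simp
      then show False using D_le q_ge by simp
    qed
  qed (use S pos in auto)
qed

text \<open>Every cut edge is counted twice.\<close>

definition cost :: "(nat \<Rightarrow> nat) \<Rightarrow> real" where
  "cost p = (\<Sum>u\<in>V. \<Sum>v\<in>V. if p u \<noteq> p v then w u v else 0)"

lemma cost_eq:
  "cost p = (\<Sum>u\<in>C. \<Sum>v\<in>C. if p u \<noteq> p v then w u v else 0)
    + 2 * (\<Sum>x\<in>Out. \<Sum>u\<in>C. if p u \<noteq> p x then w x u else 0)"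
proof -
  have "(\<Sum>u\<in>C. \<Sum>x\<in>Out. if p u \<noteq> p x then w u x else 0) = (\<Sum>x\<in>Out. \<Sum>u\<in>C. if p u \<noteq> p x then w x u else 0)"
    by (subst sum.swap) (simp add: sym cong: if_cong)
  moreover have "(\<Sum>x\<in>Out. \<Sum>v\<in>Out. if p x \<noteq> p v then w x v else 0) = 0"
    by (intro sum.neutral ballI) (auto simp: out_weight)
  moreover have "(\<Sum>x\<in>Out. \<Sum>u\<in>C. if p x \<noteq> p u then w x u else 0) = (\<Sum>x\<in>Out. \<Sum>u\<in>C. if p u \<noteq> p x then w x u else 0)"
    by (intro sum.cong refl) auto
  ultimately show ?thesis unfolding cost_def sum_V by (simp add: sum.distrib)
qed

text \<open>The passage from \<open>p\<close> to \<open>h\<close> is made in two stages. A misplaced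
  core vertex cuts at least \<open>3 / 4 * q\<close> edges of its clique, which outweighs the outer
  weight at it, at most \<open>D\<close>. Once the core is corrected, each misplaced outer vertex
  loses at least 1 by \<open>majority\<close>. Every saving counts twice, hence the 2.\<close>

lemma cost_home_minimal:
  assumes heavy: "\<And>i. i \<in> J \<Longrightarrow> 4 * card {u \<in> C. h u = i \<and> p u \<noteq> i} \<le> q"
    and pJ: "\<And>x. x \<in> Out \<Longrightarrow> p x \<in> J"
    and majority: "\<And>x i. x \<in> Out \<Longrightarrow> i \<in> J \<Longrightarrow> i \<noteq> h x \<Longrightarrow>
      (\<Sum>u | u \<in> C \<and> h u = i. w x u) + 1 \<le> (\<Sum>u | u \<in> C \<and> h u = h x. w x u)"
    and differs: "\<exists>u\<in>V. p u \<noteq> h u"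
  shows "cost h + 2 \<le> cost p"
proof -
  define B where "B = {u \<in> C. p u \<noteq> h u}"
  define X where "X = {x \<in> Out. p x \<noteq> h x}"
  have finB: "finite B" "B \<subseteq> C" and finX: "finite X" "X \<subseteq> Out"
    unfolding B_def X_def using finite_C finite_Out by auto
  let ?out = "\<lambda>p f. (\<Sum>x\<in>Out. \<Sum>u\<in>C. if f u \<noteq> p x then w x u else (0::real))"
  have hh: "(\<Sum>u\<in>C. \<Sum>v\<in>C. if h u \<noteq> h v then w u v else 0) = 0"
    by (intro sum.neutral ballI) (auto simp: core_weight)
  have "(\<Sum>u\<in>C. \<Sum>v\<in>C. if p u \<noteq> p v then w u v else 0) \<ge> (3 / 2 * real q) * real (card B)"
  proof -
    let ?good = "\<lambda>u. {v \<in> C. h v = h u \<and> p v = h v}"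
    have good: "3 / 4 * real q \<le> real (card (?good u))" if "u \<in> B" for u
    proof -
      have i: "h u \<in> J" using that finB home_core by auto
      have "?good u = {v \<in> C. h v = h u} - {v \<in> C. h v = h u \<and> p v \<noteq> h u}" by auto
      then have "card (?good u) = q - card {v \<in> C. h v = h u \<and> p v \<noteq> h u}"
        using finite_C core_size[OF i] by (simp add: card_Diff_subset Collect_mono)
      then show ?thesis using heavy[OF i] by simp
    qed
    have cr: "(\<Sum>u\<in>B. \<Sum>v\<in>C - B. if p u \<noteq> p v then w u v else 0) \<ge> (\<Sum>u\<in>B. 3 / 4 * real q)"
    proof (rule sum_mono)
      fix u assume u: "u \<in> B"
      have "real (card (?good u)) = (\<Sum>v\<in>?good u. 1)" by simp
      also have "\<dots> = (\<Sum>v\<in>?good u. if p u \<noteq> p v then w u v else 0)"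
        using u by (intro sum.cong refl) (auto simp: B_def core_weight)
      also have "\<dots> \<le> (\<Sum>v\<in>C - B. if p u \<noteq> p v then w u v else 0)"
        using finite_C by (intro sum_mono2) (auto simp: B_def nonneg)
      finally show "3 / 4 * real q \<le> (\<Sum>v\<in>C - B. if p u \<noteq> p v then w u v else 0)"
        using good[OF u] by linarith
    qed
    have split: "(\<Sum>u\<in>C. f u) = (\<Sum>u\<in>C - B. f u) + (\<Sum>u\<in>B. f u)" for f :: "nat \<Rightarrow> real"
      by (rule sum.subset_diff[OF finB(2) finite_C])
    have "(\<Sum>u\<in>C - B. \<Sum>v\<in>B. if p u \<noteq> p v then w u v else 0) = (\<Sum>u\<in>B. \<Sum>v\<in>C - B. if p u \<noteq> p v then w u v else 0)"
      by (subst sum.swap) (auto intro!: sum.cong simp: sym)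
    moreover have "(\<Sum>u\<in>C - B. \<Sum>v\<in>C - B. if p u \<noteq> p v then w u v else 0) \<ge> 0"
      "(\<Sum>u\<in>B. \<Sum>v\<in>B. if p u \<noteq> p v then w u v else 0) \<ge> 0"
      by (auto intro!: sum_nonneg simp: nonneg)
    moreover have "3 / 2 * real q * real (card B) = 2 * (\<Sum>u\<in>B. 3 / 4 * real q)" by simp
    ultimately show ?thesis using cr unfolding split sum.distrib by linarith
  qed
  \<comment> \<open>Relabelling the core by \<open>h\<close>, with the outer labels kept, affects
    only the outer edges at \<open>B\<close>.\<close>
  moreover have "?out p p \<ge> ?out p h - D * real (card B)"
  proof -
    have "?out p h \<le> (\<Sum>x\<in>Out. (\<Sum>u\<in>C. if p u \<noteq> p x then w x u else 0) + (\<Sum>u\<in>B. w x u))"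
    proof (rule sum_mono)
      fix x
      have "(\<Sum>u\<in>C. if h u \<noteq> p x then w x u else 0) \<le> (\<Sum>u\<in>C. (if p u \<noteq> p x then w x u else 0) + (if u \<in> B then w x u else 0))"
        by (intro sum_mono) (auto simp: B_def nonneg)
      also have "\<dots> = (\<Sum>u\<in>C. if p u \<noteq> p x then w x u else 0) + (\<Sum>u\<in>B. w x u)"
        using finite_C finB(2) by (simp add: sum.distrib sum.inter_restrict[symmetric] Int_absorb1)
      finally show "(\<Sum>u\<in>C. if h u \<noteq> p x then w x u else 0) \<le> (\<Sum>u\<in>C. if p u \<noteq> p x then w x u else 0) + (\<Sum>u\<in>B. w x u)" .
    qed
    then show ?thesis using load_out_le[OF finB(2) order.refl] by (simp add: sum.distrib mult.commute)
  qed
  \<comment> \<open>With the core at home, \<open>?out p h\<close> is the weight that outer vertices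
    send to cores other than their own label, so \<open>majority\<close> compares the labels vertex
    by vertex.\<close>
  moreover have "?out p h \<ge> ?out h h + real (card X)"
  proof -
    have "(\<Sum>x\<in>Out. (\<Sum>u\<in>C. if h u \<noteq> h x then w x u else 0) + (if x \<in> X then 1 else 0)) \<le> ?out p h"
    proof (rule sum_mono)
      fix x assume x: "x \<in> Out"
      have cmp: "(\<Sum>u\<in>C. if h u \<noteq> i then w x u else 0) = (\<Sum>u\<in>C. w x u) - (\<Sum>u | u \<in> C \<and> h u = i. w x u)" for i
      proof -
        have "(\<Sum>u\<in>C. w x u) = (\<Sum>u\<in>C. (if h u \<noteq> i then w x u else 0) + (if h u = i then w x u else 0))"
          by (intro sum.cong) auto
        also have "\<dots> = (\<Sum>u\<in>C. if h u \<noteq> i then w x u else 0) + (\<Sum>u | u \<in> C \<and> h u = i. w x u)"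
          using finite_C by (simp add: sum.distrib sum.inter_filter)
        finally show ?thesis by simp
      qed
      show "(\<Sum>u\<in>C. if h u \<noteq> h x then w x u else 0) + (if x \<in> X then 1 else 0) \<le> (\<Sum>u\<in>C. if h u \<noteq> p x then w x u else 0)"
        using majority[OF x pJ[OF x]] x unfolding cmp X_def by auto
    qed
    then show ?thesis using finite_Out finX(2)
      by (simp add: sum.distrib sum.inter_restrict[symmetric] Int_absorb1)
  qed
  ultimately have "cost p \<ge> (3 / 2 * real q) * real (card B) + 2 * (?out h h + real (card X) - D * real (card B))"
    unfolding cost_eq[of p] distrib_left right_diff_distrib by linarith
  moreover have "cost h = 2 * ?out h h" unfolding cost_eq[of h] hh by simp
  moreover have "(3 / 2 * real q) * real (card B) + 2 * (real (card X) - D * real (card B)) \<ge> 2 * (real (card B) + real (card X))"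
  proof -
    \<comment> \<open>Each vertex of \<open>B\<close> gains \<open>3 / 2 * q\<close> and loses at
      most \<open>2 * D\<close>; at least 2 remains.\<close>
    have "2 + 2 * D \<le> 3 / 2 * real q" using D_le q_ge by simp
    then have "(2 + 2 * D) * real (card B) \<le> 3 / 2 * real q * real (card B)" by (intro mult_right_mono) auto
    then show ?thesis by (simp add: algebra_simps)
  qed
  moreover have "card B + card X \<ge> 1"
  proof -
    obtain u where "u \<in> V" "p u \<noteq> h u" using differs by blast
    then have "u \<in> B \<union> X" unfolding B_def X_def by auto
    then have "card B > 0 \<or> card X > 0" using finB finX by (auto simp: card_gt_0_iff)
    then show ?thesis by auto
  qed
  then have "1 \<le> real (card B) + real (card X)" by linarith
  ultimately show ?thesis by (simp add: algebra_simps)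
qed

text \<open>The right side counts every edge twice, so the normalized Rayleigh quotient is at least
  one half. For balanced \<open>f\<close> the cliques contribute \<open>2 * q\<close> times the
  squared norm of \<open>f\<close> on \<open>C\<close>, about twice what the core degrees require,
  and the surplus pays for the outer edges.\<close>

lemma rayleigh_ge_half:
  assumes balanced: "\<And>i. i \<in> J \<Longrightarrow> (\<Sum>u | u \<in> C \<and> h u = i. f u) = 0"
  shows "(\<Sum>v\<in>V. degree w V v * (f v)\<^sup>2) \<le> (\<Sum>u\<in>V. \<Sum>v\<in>V. w u v * (f u - f v)\<^sup>2)"
proof -
  define F where "F = (\<Sum>u\<in>C. (f u)\<^sup>2)"
  have cc: "(\<Sum>u\<in>C. \<Sum>v\<in>C. w u v * (f u - f v)\<^sup>2) = 2 * real q * F"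
  proof -
    have "(\<Sum>v\<in>C. w u v * (f u - f v)\<^sup>2) = real q * (f u)\<^sup>2 + (\<Sum>v | v \<in> C \<and> h v = h u. (f v)\<^sup>2)"
      if u: "u \<in> C" for u
    proof -
      have "(\<Sum>v\<in>C. w u v * (f u - f v)\<^sup>2) = (\<Sum>v\<in>C. if h v = h u then (f u - f v)\<^sup>2 else 0)"
        using u by (intro sum.cong refl) (auto simp: core_weight)
      also have "\<dots> = (\<Sum>v | v \<in> C \<and> h v = h u. (f u - f v)\<^sup>2)"
        using finite_C by (simp add: sum.inter_filter)
      also have "\<dots> = (\<Sum>v | v \<in> C \<and> h v = h u. (f u)\<^sup>2 + (f v)\<^sup>2 - 2 * f u * f v)"
        by (intro sum.cong refl) (simp add: power2_eq_square algebra_simps)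
      also have "\<dots> = real q * (f u)\<^sup>2 + (\<Sum>v | v \<in> C \<and> h v = h u. (f v)\<^sup>2)
          - 2 * f u * (\<Sum>v | v \<in> C \<and> h v = h u. f v)"
        using core_size[OF home_core[OF u]] by (simp add: sum.distrib sum_subtractf sum_distrib_left)
      finally show ?thesis using balanced[OF home_core[OF u]] by simp
    qed
    then have "(\<Sum>u\<in>C. \<Sum>v\<in>C. w u v * (f u - f v)\<^sup>2) =
        real q * F + (\<Sum>u\<in>C. \<Sum>v | v \<in> C \<and> h v = h u. (f v)\<^sup>2)"
      by (simp add: F_def sum.distrib sum_distrib_left)
    also have "(\<Sum>u\<in>C. \<Sum>v | v \<in> C \<and> h v = h u. (f v)\<^sup>2) = (\<Sum>u\<in>C. \<Sum>v\<in>C. if h v = h u then (f v)\<^sup>2 else 0)"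
      using finite_C by (simp add: sum.inter_filter)
    also have "\<dots> = (\<Sum>v\<in>C. \<Sum>u\<in>C. if h v = h u then (f v)\<^sup>2 else 0)" by (rule sum.swap)
    also have "\<dots> = (\<Sum>v\<in>C. \<Sum>u\<in>C. if h u = h v then (f v)\<^sup>2 else 0)"
      by (intro sum.cong refl) auto
    also have "\<dots> = (\<Sum>v\<in>C. \<Sum>u | u \<in> C \<and> h u = h v. (f v)\<^sup>2)"
      by (intro sum.cong refl sum.inter_filter[symmetric] finite_C)
    also have "\<dots> = real q * F"
      unfolding F_def sum_distrib_left by (intro sum.cong refl) (simp add: core_size home_core)
    finally show ?thesis by simp
  qed
  have co: "(\<Sum>u\<in>C. \<Sum>x\<in>Out. w u x * (f u - f x)\<^sup>2) \<ge> (\<Sum>x\<in>Out. degree w V x * (f x)\<^sup>2) / 2 - D * F"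
  proof -
    have "(\<Sum>u\<in>C. \<Sum>x\<in>Out. w u x * ((f x)\<^sup>2 / 2 - (f u)\<^sup>2)) \<le> (\<Sum>u\<in>C. \<Sum>x\<in>Out. w u x * (f u - f x)\<^sup>2)"
    proof (intro sum_mono mult_left_mono nonneg)
      fix u x
      \<comment> \<open>The difference of the two sides below is half of this square.\<close>
      have "0 \<le> (2 * f u - f x)\<^sup>2" by simp
      then show "(f x)\<^sup>2 / 2 - (f u)\<^sup>2 \<le> (f u - f x)\<^sup>2" by (simp add: power2_eq_square algebra_simps)
    qed
    moreover have "(\<Sum>u\<in>C. \<Sum>x\<in>Out. w u x * ((f x)\<^sup>2 / 2 - (f u)\<^sup>2)) =
        (\<Sum>x\<in>Out. degree w V x * (f x)\<^sup>2) / 2 - (\<Sum>u\<in>C. (\<Sum>x\<in>Out. w u x) * (f u)\<^sup>2)"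
    proof -
      have "(\<Sum>u\<in>C. \<Sum>x\<in>Out. w u x * (f x)\<^sup>2) = (\<Sum>x\<in>Out. degree w V x * (f x)\<^sup>2)"
        by (subst sum.swap) (simp add: degree_out sum_distrib_right sym)
      then show ?thesis
        by (simp add: right_diff_distrib sum_subtractf sum_distrib_right sum_divide_distrib[symmetric])
    qed
    moreover have "(\<Sum>u\<in>C. (\<Sum>x\<in>Out. w u x) * (f u)\<^sup>2) \<le> D * F"
      unfolding F_def sum_distrib_left by (intro sum_mono mult_right_mono load) auto
    ultimately show ?thesis by linarith
  qed
  have "(\<Sum>u\<in>V. \<Sum>v\<in>V. w u v * (f u - f v)\<^sup>2) = 2 * real q * F + 2 * (\<Sum>u\<in>C. \<Sum>x\<in>Out. w u x * (f u - f x)\<^sup>2)"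
  proof -
    have "(\<Sum>x\<in>Out. \<Sum>u\<in>C. w x u * (f x - f u)\<^sup>2) = (\<Sum>u\<in>C. \<Sum>x\<in>Out. w u x * (f u - f x)\<^sup>2)"
      by (subst sum.swap) (simp add: sym power2_commute)
    then show ?thesis unfolding sum_V sum.distrib cc by (simp add: out_weight)
  qed
  moreover have "(\<Sum>v\<in>V. degree w V v * (f v)\<^sup>2) \<le> (real q + D) * F + (\<Sum>x\<in>Out. degree w V x * (f x)\<^sup>2)"
  proof -
    have "(\<Sum>u\<in>C. degree w V u * (f u)\<^sup>2) \<le> (\<Sum>u\<in>C. (real q + D) * (f u)\<^sup>2)"
    proof (intro sum_mono mult_right_mono)
      fix u assume "u \<in> C"
      then show "degree w V u \<le> real q + D" using load[of u] by (simp add: degree_core)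
    qed simp
    then show ?thesis unfolding sum_V F_def sum_distrib_left by simp
  qed
  moreover have "(real q + D) * F \<le> 2 * real q * F - 2 * D * F"
  proof -
    have "F \<ge> 0" unfolding F_def by (intro sum_nonneg) auto
    then have "(real q + D) * F \<le> (2 * real q - 2 * D) * F" using D_le by (intro mult_right_mono) auto
    then show ?thesis by (simp add: algebra_simps)
  qed
  ultimately show ?thesis using co by linarith
qed

end

section \<open>The normalized Laplacian of a clique graph\<close>

lemma norm_laplacian_eq:
  "norm_laplacian w n = mat n n (\<lambda>(i, j).
    ((if i = j then degree w {..<n} i else 0) - w i j) / (sqrt (degree w {..<n} i) * sqrt (degree w {..<n} j)))"
proof -
  let ?d = "degree w {..<n}"
  have "mat_diag n ?d - mat n n (\<lambda>(i, j). w i j) = mat n n (\<lambda>(i, j). (if i = j then ?d i else 0) - w i j)"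
    by (intro eq_matI) (auto simp: mat_diag_def)
  then show ?thesis unfolding norm_laplacian_def Let_def
    by (subst mat_diag_mult_left[of _ n n], simp, subst mat_diag_mult_right[of _ n n], simp)
      (auto intro!: eq_matI)
qed

lemma (in core_graph) eigenvalue_ge_half:
  assumes V: "V = {..<n}" and J: "J = {..<k}" and kn: "k < n"
    and pos: "\<And>v. v < n \<Longrightarrow> degree w {..<n} v > 0"
  shows "1 / 2 \<le> eigenvalue_nth (norm_laplacian w n) (k + 1)"
proof (rule courant_fischer_lower_bound[where n = n])
  show "norm_laplacian w n \<in> carrier_mat n n" unfolding norm_laplacian_eq by simp
  show "(norm_laplacian w n)\<^sup>T = norm_laplacian w n"
    unfolding norm_laplacian_eq by (intro eq_matI) (auto simp: sym mult.commute)
  show "k < n" by (rule kn)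
  fix j assume "j < k"
  \<comment> \<open>Orthogonality of \<open>g\<close> to this vector says that \<open>g\<close>
    divided by the square roots of the degrees sums to zero over core \<open>j\<close>, which is the
    balance required by \<open>rayleigh_ge_half\<close>.\<close>
  show "vec n (\<lambda>u. if u \<in> C \<and> h u = j then 1 / sqrt (degree w {..<n} u) else 0) \<in> carrier_vec n" by simp
next
  define d where "d = degree w {..<n}"
  have d: "d v > 0" if "v < n" for v using pos[OF that] unfolding d_def .
  define M where "M = norm_laplacian w n"
  have M_eq: "M = mat n n (\<lambda>(i, j). ((if i = j then d i else 0) - w i j) / (sqrt (d i) * sqrt (d j)))"
    unfolding M_def d_def by (rule norm_laplacian_eq)
  fix g :: "real vec"
  assume g: "g \<in> carrier_vec n"
    and orth: "\<And>j. j < k \<Longrightarrow> vec n (\<lambda>u. if u \<in> C \<and> h u = j then 1 / sqrt (degree w {..<n} u) else 0) \<bullet> g = 0"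
  define f where "f u = g $ u / sqrt (d u)" for u
  have Cn: "C \<subseteq> {..<n}" using V by auto
  have balanced: "(\<Sum>u | u \<in> C \<and> h u = i. f u) = 0" if "i \<in> J" for i
  proof -
    have "(\<Sum>u | u \<in> C \<and> h u = i. f u) = (\<Sum>u\<in>{..<n} \<inter> {u. u \<in> C \<and> h u = i}. f u)"
      using Cn by (intro sum.cong) auto
    also have "\<dots> = (\<Sum>u<n. if u \<in> {u. u \<in> C \<and> h u = i} then f u else 0)"
      by (rule sum.inter_restrict) simp
    also have "\<dots> = vec n (\<lambda>u. if u \<in> C \<and> h u = i then 1 / sqrt (degree w {..<n} u) else 0) \<bullet> g"
      using g by (auto simp: scalar_prod_def f_def d_def atLeast0LessThan intro!: sum.cong)
    finally show ?thesis using orth[of i] that J by simp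
  qed
  have gf: "g $ u = sqrt (d u) * f u" if "u < n" for u
    using d[OF that] by (simp add: f_def)
  have gg: "g \<bullet> g = (\<Sum>v<n. d v * (f v)\<^sup>2)"
  proof -
    have "g $ u * g $ u = d u * (f u)\<^sup>2" if "u < n" for u
      using d[OF that] unfolding gf[OF that] by (simp add: power_mult_distrib flip: power2_eq_square)
    then show ?thesis using g by (simp add: scalar_prod_def atLeast0LessThan)
  qed
  have gMg: "g \<bullet> (M *\<^sub>v g) = (\<Sum>u<n. d u * (f u)\<^sup>2) - (\<Sum>u<n. \<Sum>v<n. w u v * (f u * f v))"
  proof -
    have "(M *\<^sub>v g) $ u = (d u * f u - (\<Sum>v<n. w u v * f v)) / sqrt (d u)" if u: "u < n" for u
    proof -
      have "(M *\<^sub>v g) $ u = (\<Sum>v<n. ((if u = v then d u else 0) - w u v) / (sqrt (d u) * sqrt (d v)) * (g $ v))"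
        using u g by (simp add: M_eq scalar_prod_def atLeast0LessThan)
      also have "\<dots> = (\<Sum>v<n. ((if u = v then d u * f u else 0) - w u v * f v) / sqrt (d u))"
      proof (intro sum.cong refl)
        fix v assume "v \<in> {..<n}"
        then have v: "v < n" by simp
        have "sqrt (d v) \<noteq> 0" using d[OF v] by simp
        then show "((if u = v then d u else 0) - w u v) / (sqrt (d u) * sqrt (d v)) * (g $ v) =
            ((if u = v then d u * f u else 0) - w u v * f v) / sqrt (d u)"
          unfolding gf[OF v] by (cases "u = v") (auto simp: field_simps)
      qed
      also have "\<dots> = (d u * f u - (\<Sum>v<n. w u v * f v)) / sqrt (d u)"
        using u by (simp add: sum_divide_distrib[symmetric] sum_subtractf)
      finally show ?thesis .
    qed
    note Mg = this
    have "g $ u * (M *\<^sub>v g) $ u = d u * (f u)\<^sup>2 - (\<Sum>v<n. w u v * (f u * f v))" if "u < n" for u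
    proof -
      have "g $ u * (M *\<^sub>v g) $ u = f u * (d u * f u - (\<Sum>v<n. w u v * f v))"
        unfolding Mg[OF that] gf[OF that] using d[OF that] by simp
      then show ?thesis
        by (simp add: right_diff_distrib sum_distrib_left power2_eq_square mult_ac)
    qed
    moreover have "dim_vec (M *\<^sub>v g) = n" by (simp add: M_eq)
    ultimately show ?thesis by (simp add: scalar_prod_def atLeast0LessThan sum_subtractf)
  qed
  have "(\<Sum>v\<in>V. degree w V v * (f v)\<^sup>2) \<le> (\<Sum>u\<in>V. \<Sum>v\<in>V. w u v * (f u - f v)\<^sup>2)"
    by (rule rayleigh_ge_half[OF balanced])
  then have "(\<Sum>v<n. d v * (f v)\<^sup>2) \<le> (\<Sum>u<n. \<Sum>v<n. w u v * (f u - f v)\<^sup>2)"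
    unfolding V d_def .
  also have "\<dots> = 2 * (\<Sum>u<n. d u * (f u)\<^sup>2) - 2 * (\<Sum>u<n. \<Sum>v<n. w u v * (f u * f v))"
  proof -
    have "(\<Sum>u<n. \<Sum>v<n. w u v * (f v)\<^sup>2) = (\<Sum>u<n. \<Sum>v<n. w u v * (f u)\<^sup>2)"
      by (subst sum.swap) (simp add: sym)
    moreover have "(\<Sum>u<n. \<Sum>v<n. w u v * (f u)\<^sup>2) = (\<Sum>u<n. d u * (f u)\<^sup>2)"
      unfolding d_def degree_def sum_distrib_right ..
    moreover have "(\<Sum>u<n. \<Sum>v<n. w u v * (f u - f v)\<^sup>2) =
        (\<Sum>u<n. \<Sum>v<n. w u v * (f u)\<^sup>2) + (\<Sum>u<n. \<Sum>v<n. w u v * (f v)\<^sup>2) - 2 * (\<Sum>u<n. \<Sum>v<n. w u v * (f u * f v))"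
      by (simp add: power2_diff algebra_simps sum.distrib sum_subtractf sum_distrib_left)
    ultimately show ?thesis by simp
  qed
  finally show "1 / 2 * (g \<bullet> g) \<le> g \<bullet> (norm_laplacian w n *\<^sub>v g)"
    unfolding M_def[symmetric] gg gMg by simp
qed

section \<open>Uniqueness of the optimal partition\<close>

locale clustered_graph = core_graph w "{..<k}" q C Out h D
  for w and k q :: nat and C Out h D +
  fixes n :: nat and x y :: real
  assumes V_eq: "C \<union> Out = {..<n}"
    and degree_pos: "v < n \<Longrightarrow> degree w {..<n} v > 0"
    and majority: "u \<in> Out \<Longrightarrow> i < k \<Longrightarrow> i \<noteq> h u \<Longrightarrow>
      (\<Sum>v | v \<in> C \<and> h v = i. w u v) + 1 \<le> (\<Sum>v | v \<in> C \<and> h v = h u. w u v)"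
    and cut_home: "j < k \<Longrightarrow> cut w {u \<in> {..<n}. h u = j} ({..<n} - {u \<in> {..<n}. h u = j}) = x"
    and vol_home_ge: "j < k \<Longrightarrow> y \<le> volume w {..<n} {u \<in> {..<n}. h u = j}"
    and vol_home_le: "j < k \<Longrightarrow> volume w {..<n} {u \<in> {..<n}. h u = j} \<le> y + 2"
    \<comment> \<open>\<open>x\<close> is the common cut and \<open>y\<close> the common volume up
      to one pendant edge, which counts twice. \<open>8 * x < y\<close> puts the home conductance
      below the 1/8 of \<open>conductance_ge\<close>, and \<open>k * x < y\<close> keeps the slack
      in the volume from hiding a misplaced vertex.\<close>
    and x_pos: "x > 0" and x8: "8 * x < y" and kx: "real k * x < y" and k_pos: "k \<ge> 1"
begin

definition home_part :: "nat \<Rightarrow> nat set" where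
  "home_part j = {u \<in> {..<n}. h u = j}"

lemma y_pos: "y > 0" using x_pos x8 by linarith

lemma core_part_nonempty: "j < k \<Longrightarrow> {u \<in> C. h u = j} \<noteq> {}"
proof
  assume "j < k" and empty: "{u \<in> C. h u = j} = {}"
  then show False using core_size[of j] q_ge unfolding empty by simp
qed

lemma home_partition: "home_part ` {..<k} \<in> kway_partitions {..<n} k"
proof -
  have ne: "home_part j \<noteq> {}" if "j < k" for j
    using core_part_nonempty[OF that] V_eq by (auto simp: home_part_def)
  have "inj_on home_part {..<k}"
  proof (rule inj_onI)
    fix i j assume "i \<in> {..<k}" "j \<in> {..<k}" and eq: "home_part i = home_part j"
    then obtain u where u: "u \<in> home_part i" using ne[of i] by auto
    then show "i = j" using u[unfolded eq] by (simp add: home_part_def)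
  qed
  then have "card (home_part ` {..<k}) = k" by (simp add: card_image)
  moreover have "partition_on {..<n} (home_part ` {..<k})"
  proof (rule partition_onI)
    show "\<Union> (home_part ` {..<k}) = {..<n}"
      using home_core home_out V_eq by (auto simp: home_part_def)
    fix p p' assume "p \<in> home_part ` {..<k}" "p' \<in> home_part ` {..<k}" "p \<noteq> p'"
    then show "disjnt p p'" by (auto simp: home_part_def disjnt_def)
  next
    show "{} \<notin> home_part ` {..<k}" using ne by fastforce
  qed
  ultimately show ?thesis unfolding kway_partitions_def by simp
qed

lemma conductance_home: "j < k \<Longrightarrow> conductance w {..<n} (home_part j) \<le> x / y"
  "j < k \<Longrightarrow> conductance w {..<n} (home_part j) > 0"
proof -
  assume j: "j < k"
  show "conductance w {..<n} (home_part j) \<le> x / y"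
    unfolding conductance_def home_part_def cut_home[OF j]
    using vol_home_ge[OF j] x_pos y_pos by (intro divide_left_mono) auto
  show "conductance w {..<n} (home_part j) > 0"
    unfolding conductance_def home_part_def cut_home[OF j]
    using vol_home_ge[OF j] x_pos y_pos by (intro divide_pos_pos) auto
qed

lemma sum_partition:
  fixes F :: "nat \<Rightarrow> real"
  assumes "partition_on {..<n} \<A>"
  shows "(\<Sum>A\<in>\<A>. \<Sum>u\<in>A. F u) = (\<Sum>u<n. F u)"
proof -
  have "(\<Sum>u\<in>\<Union>\<A>. F u) = (sum \<circ> sum) F \<A>"
  proof (rule sum.Union_disjoint)
    show "\<forall>A\<in>\<A>. finite A"
      using partition_onD1[OF assms] by (metis Sup_upper finite_lessThan finite_subset)
    show "\<forall>A\<in>\<A>. \<forall>B\<in>\<A>. A \<noteq> B \<longrightarrow> A \<inter> B = {}"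
      using partition_onD2[OF assms] by (auto simp: disjoint_def)
  qed
  then show ?thesis using partition_onD1[OF assms] by simp
qed

lemma cost_partition:
  assumes "partition_on {..<n} \<A>"
    and p: "\<And>A u v. A \<in> \<A> \<Longrightarrow> u \<in> A \<Longrightarrow> v < n \<Longrightarrow> p u \<noteq> p v \<longleftrightarrow> v \<notin> A"
  shows "cost p = (\<Sum>A\<in>\<A>. cut w A ({..<n} - A))"
proof -
  have "cut w A ({..<n} - A) = (\<Sum>u\<in>A. \<Sum>v<n. if p u \<noteq> p v then w u v else 0)" if "A \<in> \<A>" for A
  proof -
    have *: "(\<Sum>v\<in>{..<n} - A. w u v) = (\<Sum>v<n. if p u \<noteq> p v then w u v else 0)" if "u \<in> A" for u
    proof -
      have "{..<n} - A = {v \<in> {..<n}. p u \<noteq> p v}" using p[OF \<open>A \<in> \<A>\<close> that] by auto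
      then show ?thesis by (simp only:) (rule sum.inter_filter, simp)
    qed
    show ?thesis unfolding cut_def by (rule sum.cong[OF refl]) (rule *)
  qed
  then show ?thesis unfolding cost_def V_eq by (simp add: sum_partition[OF assms(1)])
qed

text \<open>A part of conductance below 1/8 holds more than three quarters of some core, and
  distinct parts hold distinct cores, so the cores label the parts bijectively. Summing the cuts,
  each at most \<open>x / y\<close> times a volume, bounds the total by
  \<open>k * x * (y + 2) / y < k * x + 2\<close>, while by \<open>cost_home_minimal\<close> a
  labelling other than \<open>h\<close> costs at least \<open>k * x + 2\<close>.\<close>

lemma optimal_partition:
  assumes \<A>: "\<A> \<in> kway_partitions {..<n} k" and opt: "max_conductance w {..<n} \<A> \<le> x / y"
  shows "\<A> = home_part ` {..<k}"
proof -
  have part: "partition_on {..<n} \<A>" and card\<A>: "card \<A> = k" using \<A> by (auto simp: kway_partitions_def)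
  have fin\<A>: "finite \<A>" using card\<A> k_pos card.infinite by fastforce
  have sub: "A \<subseteq> {..<n}" "A \<noteq> {}" if "A \<in> \<A>" for A
    using partition_onD1[OF part] partition_onD3[OF part] that by auto
  have disj: "A = B" if "A \<in> \<A>" "B \<in> \<A>" "u \<in> A" "u \<in> B" for A B u
    using partition_onD2[OF part] that by (auto simp: disjoint_def)
  have cond: "conductance w {..<n} A \<le> x / y" if "A \<in> \<A>" for A
  proof -
    have "conductance w {..<n} A \<le> max_conductance w {..<n} \<A>"
      unfolding max_conductance_def using fin\<A> that by (intro Max_ge) auto
    then show ?thesis using opt by linarith
  qed
  have "\<exists>i\<in>{..<k}. 3 * q < 4 * card {u \<in> A \<inter> C. h u = i}" if A: "A \<in> \<A>" for A
  proof (rule ccontr)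
    assume "\<not> ?thesis"
    then have "1 / 8 \<le> conductance w (C \<union> Out) A"
      using sub[OF A] degree_pos unfolding V_eq[symmetric]
      by (intro conductance_ge) (auto simp: not_less V_eq)
    then have "1 / 8 \<le> x / y" using cond[OF A] unfolding V_eq by linarith
    then show False using x8 y_pos by (simp add: field_simps)
  qed
  then obtain g where g: "\<And>A. A \<in> \<A> \<Longrightarrow> g A < k"
    and heavy: "\<And>A. A \<in> \<A> \<Longrightarrow> 3 * q < 4 * card {u \<in> A \<inter> C. h u = g A}" by (metis lessThan_iff)
  have inj: "inj_on g \<A>"
  proof (rule inj_onI, rule ccontr)
    fix A B assume AB: "A \<in> \<A>" "B \<in> \<A>" "g A = g B" "A \<noteq> B"
    have "card {u \<in> A \<inter> C. h u = g A} + card {u \<in> B \<inter> C. h u = g A} =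
        card ({u \<in> A \<inter> C. h u = g A} \<union> {u \<in> B \<inter> C. h u = g A})"
      using finite_C disj[OF AB(1,2)] AB(4) by (intro card_Un_disjoint[symmetric]) auto
    also have "\<dots> \<le> card {u \<in> C. h u = g A}" using finite_C by (intro card_mono) auto
    also have "\<dots> = q" using core_size g[OF AB(1)] by simp
    finally show False using heavy[OF AB(1)] heavy[OF AB(2)] AB(3) by simp
  qed
  have img: "g ` \<A> = {..<k}"
    using g card_image[OF inj] card\<A> by (intro card_subset_eq) auto
  define p where "p u = g (THE A. A \<in> \<A> \<and> u \<in> A)" for u
  have p: "p u = g A" if "A \<in> \<A>" "u \<in> A" for A u
    unfolding p_def using that disj by (intro arg_cong[where f=g] the_equality) auto
  have cover: "\<exists>A\<in>\<A>. u \<in> A" if "u < n" for u using partition_onD1[OF part] that by auto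
  have p_eq: "p u \<noteq> p v \<longleftrightarrow> v \<notin> A" if A: "A \<in> \<A>" "u \<in> A" "v < n" for A u v
  proof -
    obtain B where B: "B \<in> \<A>" "v \<in> B" using cover[OF A(3)] by blast
    have "p u = p v \<longleftrightarrow> A = B"
      using p[OF A(1,2)] p[OF B] inj_onD[OF inj _ A(1) B(1)] by auto
    also have "\<dots> \<longleftrightarrow> v \<in> A" using B disj A(1) by blast
    finally show ?thesis by blast
  qed
  have "p u = h u" if u: "u < n" for u
  proof (rule ccontr)
    assume ne: "p u \<noteq> h u"
    have "cost h + 2 \<le> cost p"
    proof (rule cost_home_minimal)
      fix i assume "i \<in> {..<k}"
      then obtain A where A: "A \<in> \<A>" "g A = i" using img by (metis imageE)
      have "{u \<in> C. h u = i \<and> p u \<noteq> i} \<subseteq> {u \<in> C. h u = i} - {u \<in> A \<inter> C. h u = i}"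
        using p[OF A(1)] A(2) by auto
      then have "card {u \<in> C. h u = i \<and> p u \<noteq> i} \<le> card ({u \<in> C. h u = i} - {u \<in> A \<inter> C. h u = i})"
        using finite_C by (intro card_mono) auto
      also have "\<dots> = q - card {u \<in> A \<inter> C. h u = i}"
        using finite_C core_size[OF \<open>i \<in> {..<k}\<close>] by (subst card_Diff_subset) auto
      finally show "4 * card {u \<in> C. h u = i \<and> p u \<noteq> i} \<le> q" using heavy[OF A(1)] A(2) by simp
    next
      fix z assume "z \<in> Out"
      then have "z < n" using V_eq by auto
      then show "p z \<in> {..<k}" using cover[of z] p g by auto
    next
      fix z i assume "z \<in> Out" "i \<in> {..<k}" "i \<noteq> h z"
      then show "(\<Sum>u | u \<in> C \<and> h u = i. w z u) + 1 \<le> (\<Sum>u | u \<in> C \<and> h u = h z. w z u)"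
        using majority by simp
    next
      show "\<exists>u\<in>C \<union> Out. p u \<noteq> h u" unfolding V_eq using u ne by auto
    qed
    moreover have "cost h = real k * x"
    proof -
      have "cost h = (\<Sum>A\<in>home_part ` {..<k}. cut w A ({..<n} - A))"
        using home_partition by (intro cost_partition) (auto simp: kway_partitions_def home_part_def)
      also have "\<dots> = (\<Sum>A\<in>home_part ` {..<k}. x)"
        using cut_home by (intro sum.cong refl) (auto simp: home_part_def)
      also have "\<dots> = real k * x" using home_partition by (simp add: kway_partitions_def)
      finally show ?thesis .
    qed
    moreover have "cost p = (\<Sum>A\<in>\<A>. cut w A ({..<n} - A))" by (rule cost_partition[OF part p_eq])
    moreover have "\<dots> \<le> (\<Sum>A\<in>\<A>. x / y * volume w {..<n} A)"
    proof (rule sum_mono)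
      fix A assume A: "A \<in> \<A>"
      have "volume w {..<n} A > 0" unfolding volume_def
        using sub[OF A] degree_pos finite_subset[OF sub(1)[OF A]] by (intro sum_pos) auto
      then show "cut w A ({..<n} - A) \<le> x / y * volume w {..<n} A"
        using cond[OF A] unfolding conductance_def by (simp add: pos_divide_le_eq)
    qed
    moreover have "(\<Sum>A\<in>\<A>. x / y * volume w {..<n} A) = x / y * (\<Sum>u<n. degree w {..<n} u)"
      unfolding volume_def sum_distrib_left[symmetric] sum_partition[OF part] ..
    moreover have "(\<Sum>u<n. degree w {..<n} u) = (\<Sum>A\<in>home_part ` {..<k}. volume w {..<n} A)"
      unfolding volume_def using home_partition by (intro sum_partition[symmetric]) (simp add: kway_partitions_def)
    moreover have "\<dots> \<le> (\<Sum>A\<in>home_part ` {..<k}. y + 2)"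
      using vol_home_le by (intro sum_mono) (auto simp: home_part_def)
    moreover have "(\<Sum>A\<in>home_part ` {..<k}. y + 2) = real k * (y + 2)"
      using home_partition by (simp add: kway_partitions_def)
    ultimately have "real k * x + 2 \<le> x / y * (\<Sum>u<n. degree w {..<n} u)"
      "(\<Sum>u<n. degree w {..<n} u) \<le> real k * (y + 2)" by linarith+
    then have "real k * x + 2 \<le> x / y * (real k * (y + 2))"
      using x_pos y_pos by (meson divide_pos_pos less_imp_le mult_left_mono order_trans)
    then have "2 * y \<le> 2 * (real k * x)" using y_pos by (simp add: field_simps)
    then show False using kx by simp
  qed
  then have "A = home_part (g A)" if "A \<in> \<A>" for A
    using p[OF that] p_eq[OF that] sub[OF that] by (fastforce simp: home_part_def)
  then have "\<A> = home_part ` g ` \<A>" by (auto simp: image_image)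
  then show ?thesis unfolding img .
qed

lemma finite_kway: "finite (kway_partitions {..<n} k)"
  by (rule finite_subset[of _ "Pow (Pow {..<n})"]) (auto simp: kway_partitions_def partition_on_def)

lemma max_conductance_home:
  "max_conductance w {..<n} (home_part ` {..<k}) \<le> x / y" "max_conductance w {..<n} (home_part ` {..<k}) > 0"
proof -
  have "0 \<in> {..<k}" using k_pos by simp
  then have "conductance w {..<n} ` home_part ` {..<k} \<noteq> {}" by blast
  then show "max_conductance w {..<n} (home_part ` {..<k}) \<le> x / y"
    unfolding max_conductance_def using conductance_home(1) by (subst Max_le_iff) auto
  have "conductance w {..<n} (home_part 0) \<le> max_conductance w {..<n} (home_part ` {..<k})"
    unfolding max_conductance_def using k_pos by (intro Max_ge) auto
  then show "max_conductance w {..<n} (home_part ` {..<k}) > 0"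
    using conductance_home(2)[of 0] k_pos by linarith
qed

lemma expansion_const_eq: "expansion_const w {..<n} k = max_conductance w {..<n} (home_part ` {..<k})"
proof -
  let ?S = "max_conductance w {..<n} ` kway_partitions {..<n} k"
  have "?S \<noteq> {}" using home_partition by auto
  then have "Min ?S \<in> ?S" using finite_kway by (intro Min_in) auto
  then obtain \<A> where \<A>: "\<A> \<in> kway_partitions {..<n} k" "Min ?S = max_conductance w {..<n} \<A>" by auto
  have "Min ?S \<le> max_conductance w {..<n} (home_part ` {..<k})"
    using finite_kway home_partition by (intro Min_le) auto
  then have "\<A> = home_part ` {..<k}"
    using max_conductance_home(1) \<A> by (intro optimal_partition) auto
  then show ?thesis unfolding expansion_const_def using \<A> by simp
qed

lemma is_cluster_iff: "is_cluster w {..<n} k A \<longleftrightarrow> A \<in> home_part ` {..<k}"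
proof
  assume "is_cluster w {..<n} k A"
  then obtain \<A> where "\<A> \<in> kway_partitions {..<n} k" "max_conductance w {..<n} \<A> = expansion_const w {..<n} k" "A \<in> \<A>"
    by (auto simp: is_cluster_def)
  then show "A \<in> home_part ` {..<k}"
    using optimal_partition[of \<A>] max_conductance_home(1) expansion_const_eq by auto
next
  assume "A \<in> home_part ` {..<k}"
  then show "is_cluster w {..<n} k A"
    unfolding is_cluster_def using home_partition expansion_const_eq by auto
qed

lemma cluster_expansion:
  assumes "is_cluster w {..<n} k A"
  shows "expansion_at_least (1 / 8) w A"
proof -
  obtain j where j: "j < k" "A = home_part j" using assms unfolding is_cluster_iff by auto
  let ?C = "{u \<in> C. h u = j}" and ?Out = "{u \<in> Out. h u = j}"
  have A: "A = ?C \<union> ?Out" unfolding j home_part_def V_eq[symmetric] by auto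
  interpret part: core_graph w "{j}" q ?C ?Out h D
  proof
    fix u assume u: "u \<in> ?C"
    have "(\<Sum>x\<in>?Out. w u x) \<le> (\<Sum>x\<in>Out. w u x)" by (intro sum_mono2 finite_Out nonneg) auto
    then show "(\<Sum>x\<in>?Out. w u x) \<le> D" using load[of u] u by auto
  next
    fix i assume "i \<in> {j}"
    then have "{u \<in> ?C. h u = i} = ?C" by auto
    then show "card {u \<in> ?C. h u = i} = q" using core_size[of j] j by simp
  qed (use finite_C finite_Out disjoint sym nonneg core_weight out_weight D_le q_ge in auto)
  have "degree w (?C \<union> ?Out) v > 0" if v: "v \<in> ?C \<union> ?Out" for v
  proof (cases "v \<in> ?C")
    case True
    then show ?thesis using part.degree_core[OF True] q_ge
      by (auto intro!: add_pos_nonneg sum_nonneg nonneg)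
  next
    case False
    then have x: "v \<in> ?Out" "v \<in> Out" "h v = j" using v by auto
    have nn: "0 \<le> (\<Sum>u | u \<in> C \<and> h u = i. w v u)" for i by (intro sum_nonneg nonneg)
    \<comment> \<open>In the induced graph an outer vertex keeps only the edges into its home core.
      If another core exists, \<open>majority\<close> makes their weight positive; otherwise the
      home core is all of \<open>C\<close>.\<close>
    have "0 < (\<Sum>u | u \<in> C \<and> h u = j. w v u)"
    proof (cases "\<exists>i<k. i \<noteq> j")
      case True
      then obtain i where "i < k" "i \<noteq> j" by blast
      then show ?thesis using majority[of v i] x nn[of i] by simp
    next
      case False
      then have "h u = j" if "u \<in> C" for u using home_core[OF that] by auto
      then have "{u. u \<in> C \<and> h u = j} = C" by auto
      moreover have "degree w {..<n} v = (\<Sum>u\<in>C. w v u)" using degree_out[OF x(2)] unfolding V_eq .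
      moreover have "v < n" using x(2) V_eq by auto
      ultimately show ?thesis using degree_pos[of v] by simp
    qed
    then show ?thesis using part.degree_out[OF x(1)] by simp
  qed
  then show ?thesis unfolding A by (intro part.single_core_expansion) auto
qed

text \<open>The eigenvalue is at least 1/2 and the expansion constant at most
  \<open>x / y\<close>.\<close>

lemma eigenvalue_ratio:
  assumes "k < n" and "2 * M * x \<le> y" and "M \<ge> 0"
  shows "M \<le> eigenvalue_nth (norm_laplacian w n) (k + 1) / expansion_const w {..<n} k"
proof -
  have "1 / 2 \<le> eigenvalue_nth (norm_laplacian w n) (k + 1)"
    using degree_pos by (intro eigenvalue_ge_half V_eq refl assms) auto
  moreover have "M * expansion_const w {..<n} k \<le> M * (x / y)"
    using max_conductance_home(1) assms by (intro mult_left_mono) (auto simp: expansion_const_eq)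
  moreover have "M * (x / y) \<le> 1 / 2" using assms y_pos by (simp add: field_simps)
  ultimately have "M * expansion_const w {..<n} k \<le> eigenvalue_nth (norm_laplacian w n) (k + 1)"
    by linarith
  then show ?thesis using max_conductance_home(2) by (simp add: expansion_const_eq pos_le_divide_eq)
qed

end

section \<open>Cut and volume of an intended cluster\<close>

context core_graph
begin

text \<open>Only edges between core and outer vertices can be cut. Those with exactly one end in the
  part are the edges at its core plus the edges at its outer vertices, minus twice those with both
  ends inside. In the vote graph only the last count depends on the bits.\<close>

lemma cut_home_eq:
  "cut w {u \<in> V. h u = j} (V - {u \<in> V. h u = j}) =
    (\<Sum>z\<in>Out. \<Sum>u | u \<in> C \<and> h u = j. w z u) + (\<Sum>z | z \<in> Out \<and> h z = j. \<Sum>u\<in>C. w z u)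
    - 2 * (\<Sum>z | z \<in> Out \<and> h z = j. \<Sum>u | u \<in> C \<and> h u = j. w z u)"
proof -
  let ?A = "{u \<in> V. h u = j}" and ?Ac = "{u. u \<in> C \<and> h u = j}" and ?Ao = "{z. z \<in> Out \<and> h z = j}"
  let ?Bc = "C - ?Ac" and ?Bo = "Out - ?Ao"
  have fin: "finite ?Ac" "finite ?Ao" "finite ?Bc" "finite ?Bo" using finite_C finite_Out by auto
  have A: "?A = ?Ac \<union> ?Ao" and B: "V - ?A = ?Bc \<union> ?Bo" using disjoint by auto
  have sA: "sum f ?A = sum f ?Ac + sum f ?Ao" for f :: "nat \<Rightarrow> real"
    unfolding A using fin disjoint by (intro sum.union_disjoint) auto
  have sB: "sum f (V - ?A) = sum f ?Bc + sum f ?Bo" for f :: "nat \<Rightarrow> real"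
    unfolding B using fin disjoint by (intro sum.union_disjoint) auto
  have cc: "(\<Sum>u\<in>?Ac. \<Sum>v\<in>?Bc. w u v) = 0"
    by (intro sum.neutral ballI) (auto simp: core_weight)
  have oo: "(\<Sum>u\<in>?Ao. \<Sum>v\<in>?Bo. w u v) = 0"
    by (intro sum.neutral ballI) (auto simp: out_weight)
  have "cut w ?A (V - ?A) = (\<Sum>u\<in>?Ac. \<Sum>z\<in>?Bo. w u z) + (\<Sum>z\<in>?Ao. \<Sum>u\<in>?Bc. w z u)"
    unfolding cut_def sA sB sum.distrib cc oo by simp
  also have "(\<Sum>u\<in>?Ac. \<Sum>z\<in>?Bo. w u z) = (\<Sum>z\<in>?Bo. \<Sum>u\<in>?Ac. w z u)"
    by (subst sum.swap) (simp add: sym)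
  also have "\<dots> = (\<Sum>z\<in>Out. \<Sum>u\<in>?Ac. w z u) - (\<Sum>z\<in>?Ao. \<Sum>u\<in>?Ac. w z u)"
    using finite_Out by (intro sum_diff) auto
  also have "(\<Sum>z\<in>?Ao. \<Sum>u\<in>?Bc. w z u) = (\<Sum>z\<in>?Ao. (\<Sum>u\<in>C. w z u) - (\<Sum>u\<in>?Ac. w z u))"
    using finite_C by (intro sum.cong refl sum_diff) auto
  finally show ?thesis by (simp add: sum_subtractf)
qed

lemma vol_home_eq:
  assumes "j \<in> J"
  shows "volume w V {u \<in> V. h u = j} = real q * (real q - 1) +
    (\<Sum>z\<in>Out. \<Sum>u | u \<in> C \<and> h u = j. w z u) + (\<Sum>z | z \<in> Out \<and> h z = j. \<Sum>u\<in>C. w z u)"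
proof -
  let ?Ac = "{u. u \<in> C \<and> h u = j}" and ?Ao = "{z. z \<in> Out \<and> h z = j}"
  have A: "{u \<in> V. h u = j} = ?Ac \<union> ?Ao" by auto
  have "volume w V {u \<in> V. h u = j} = (\<Sum>u\<in>?Ac. degree w V u) + (\<Sum>z\<in>?Ao. degree w V z)"
    unfolding volume_def A using finite_C finite_Out disjoint by (intro sum.union_disjoint) auto
  also have "(\<Sum>u\<in>?Ac. degree w V u) = (\<Sum>u\<in>?Ac. (real q - 1) + (\<Sum>z\<in>Out. w u z))"
    by (intro sum.cong refl) (simp add: degree_core)
  also have "\<dots> = real q * (real q - 1) + (\<Sum>u\<in>?Ac. \<Sum>z\<in>Out. w u z)"
    using core_size[OF assms] by (simp add: sum.distrib)
  also have "(\<Sum>u\<in>?Ac. \<Sum>z\<in>Out. w u z) = (\<Sum>z\<in>Out. \<Sum>u\<in>?Ac. w z u)"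
    by (subst sum.swap) (simp add: sym)
  also have "(\<Sum>z\<in>?Ao. degree w V z) = (\<Sum>z\<in>?Ao. \<Sum>u\<in>C. w z u)"
    by (intro sum.cong refl) (simp add: degree_out)
  finally show ?thesis .
qed

end

section \<open>The graph of a vote matrix\<close>

text \<open>
  Core vertex \<open>(j, a)\<close> with \<open>j < k\<close>, \<open>a < q\<close> is numbered \<open>j q + a\<close>, and the outer vertex \<open>(v, t)\<close> of column
  \<open>v\<close> with \<open>t < k\<close> is numbered \<open>k q + v k + t\<close>. In column \<open>v\<close>, site \<open>i\<close> joins every \<open>(v, t)\<close> either to core \<open>t\<close> or to
  core \<open>t + 1\<close>; the shift \<open>i + v\<close> spreads these edges evenly over the core. The incomplete column \<open>N\<close>
  consists of \<open>r\<close> pendant vertices that make up for the remainder of \<open>n\<close> modulo \<open>k\<close>.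
\<close>

definition vote_edges :: "nat \<Rightarrow> nat \<Rightarrow> nat \<Rightarrow> nat \<Rightarrow> nat set \<Rightarrow> nat set set" where
  "vote_edges k q N i A =
    {{k * q + v * k + t, (t + of_bool (v \<in> A)) mod k * q + (i + v) mod q} |v t. v < N \<and> t < k}"

definition fixed_edges :: "nat \<Rightarrow> nat \<Rightarrow> nat \<Rightarrow> nat \<Rightarrow> nat set set" where
  "fixed_edges k q N r = {{u, u'} |u u'. u < k * q \<and> u' < k * q \<and> u \<noteq> u' \<and> u div q = u' div q}
    \<union> {{k * q + N * k + t, t * q} |t. t < r}"

text \<open>The inverse of the shift adds \<open>k - of_bool b\<close>, which subtracts the bit
  modulo \<open>k\<close> without leaving the natural numbers.\<close>

lemma mod_shift_iff:
  fixes t j k :: nat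
  assumes "t < k" "j < k"
  shows "(t + of_bool b) mod k = j \<longleftrightarrow> t = (j + (k - of_bool b)) mod k"
proof (cases b)
  case True
  have "(j + (k - 1)) mod k = (if j = 0 then k - 1 else j - 1)"
  proof (cases "j = 0")
    case False
    then have "j + (k - 1) = (j - 1) + k" using assms by linarith
    then have "(j + (k - 1)) mod k = (j - 1) mod k" by (simp only: mod_add_self2)
    then show ?thesis using False assms by simp
  qed (use assms in simp)
  moreover have "(t + 1) mod k = (if t + 1 = k then 0 else t + 1)" using assms by simp
  ultimately have "(t + 1) mod k = j \<longleftrightarrow> t = (j + (k - 1)) mod k"
    using assms by (simp only: split: if_split) linarith
  then show ?thesis using True by (simp only: of_bool_eq)
next
  case False
  then show ?thesis using assms by auto
qed

text \<open>For either value of the bit exactly one \<open>t\<close> is sent to core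
  \<open>j\<close>. Each site therefore gives each core one edge per column, and the volumes of the
  clusters do not depend on the votes.\<close>

lemma sum_shift:
  fixes F :: "nat \<Rightarrow> real"
  assumes "j < k"
  shows "(\<Sum>t<k. if (t + of_bool b) mod k = j then F t else 0) = F ((j + (k - of_bool b)) mod k)"
proof -
  have "(\<Sum>t<k. if (t + of_bool b) mod k = j then F t else 0) =
      (\<Sum>t<k. if t = (j + (k - of_bool b)) mod k then F t else 0)"
    using assms by (intro sum.cong refl) (simp add: mod_shift_iff)
  then show ?thesis using assms by simp
qed

text \<open>\<open>load_small\<close> is the domination required by \<open>core_graph\<close>: a
  core vertex receives at most \<open>m * (N div q + 1)\<close> vote edges and one pendant edge.
  \<open>sparse\<close> provides both \<open>8 * x < y\<close> and \<open>k * x < y\<close>, as a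
  cut is at most \<open>2 * N * m\<close>. \<open>split_vote\<close> makes every column lose a vote,
  so that the cuts are positive.\<close>

locale vote_graph =
  fixes k q N r m :: nat and R :: "nat \<Rightarrow> nat set"
  assumes k2: "k \<ge> 2" and r_less: "r < k" and odd_m: "odd m" and N1: "N \<ge> 1"
    and load_small: "16 * (m * (N div q + 1) + 1) \<le> q"
    and sparse: "2 * (8 + k) * N * m < q * (q - 1)"
    and split_vote: "v < N \<Longrightarrow> (\<exists>i<m. v \<in> R i) \<and> (\<exists>i<m. v \<notin> R i)"
begin

definition n :: nat where "n = k * q + k * N + r"

definition E :: "nat set set" where
  "E = fixed_edges k q N r \<union> (\<Union>i<m. vote_edges k q N i (R i))"

definition w :: weight where "w = unit_weight E"

definition core :: "nat \<Rightarrow> nat \<Rightarrow> nat" where "core j a = j * q + a"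

definition outer :: "nat \<Rightarrow> nat \<Rightarrow> nat" where "outer v t = k * q + v * k + t"

definition majority_bit :: "nat \<Rightarrow> bool" where
  "majority_bit v \<longleftrightarrow> m < 2 * card {i \<in> {..<m}. v \<in> R i}"

definition home :: "nat \<Rightarrow> nat" where
  "home u = (if u < k * q then u div q
    else let v = (u - k * q) div k; t = (u - k * q) mod k
      in if v < N then (t + of_bool (majority_bit v)) mod k else t)"

lemma m1: "m \<ge> 1" using odd_m by (cases m) auto

lemma q_bounds: "m \<le> q" "q \<ge> 32"
proof -
  have "m * 1 \<le> m * (N div q + 1)" by (rule mult_le_mono2) simp
  moreover have "16 * (m * (N div q + 1)) + 16 \<le> q" using load_small by (simp only: distrib_left mult_1_right)
  ultimately show "m \<le> q" "q \<ge> 32" using m1 by linarith+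
qed

lemma core_less: "j < k \<Longrightarrow> a < q \<Longrightarrow> core j a < k * q"
proof -
  assume "j < k" "a < q"
  then have "j * q + a < (j + 1) * q" by simp
  also have "\<dots> \<le> k * q" using \<open>j < k\<close> by (intro mult_le_mono1) simp
  finally show ?thesis by (simp add: core_def)
qed

lemma core_div: "a < q \<Longrightarrow> core j a div q = j" and core_mod: "a < q \<Longrightarrow> core j a mod q = a"
  by (simp_all add: core_def)

lemma core_inject: "a < q \<Longrightarrow> a' < q \<Longrightarrow> core j a = core j' a' \<longleftrightarrow> j = j' \<and> a = a'"
  by (metis core_div core_mod)

lemma core_of: "u < k * q \<Longrightarrow> u = core (u div q) (u mod q) \<and> u div q < k \<and> u mod q < q"
  using q_bounds by (simp add: core_def less_mult_imp_div_less)

lemma outer_ge: "outer v t \<ge> k * q" by (simp add: outer_def)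

lemma outer_div: "t < k \<Longrightarrow> (outer v t - k * q) div k = v" and outer_mod: "t < k \<Longrightarrow> (outer v t - k * q) mod k = t"
  by (simp_all add: outer_def)

lemma outer_inject: "t < k \<Longrightarrow> t' < k \<Longrightarrow> outer v t = outer v' t' \<longleftrightarrow> v = v' \<and> t = t'"
  by (metis outer_div outer_mod)

lemma sum_cores: "(\<Sum>u<k * q. F u) = (\<Sum>j<k. \<Sum>a<q. F (core j a))" for F :: "nat \<Rightarrow> real"
proof -
  have "(\<Sum>u<k * q. F u) = (\<Sum>j<k. sum F {j * q..<j * q + q})" by (rule sum.nat_group[symmetric])
  also have "\<dots> = (\<Sum>j<k. \<Sum>a<q. F (core j a))"
  proof (rule sum.cong[OF refl])
    fix j
    show "sum F {j * q..<j * q + q} = (\<Sum>a<q. F (core j a))"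
      using sum.shift_bounds_nat_ivl[of F 0 "j * q" q] by (simp add: core_def atLeast0LessThan add.commute)
  qed
  finally show ?thesis .
qed

lemma sum_outers: "(\<Sum>z\<in>{k * q..<n}. F z) = (\<Sum>v<N. \<Sum>t<k. F (outer v t)) + (\<Sum>t<r. F (outer N t))"
  for F :: "nat \<Rightarrow> real"
proof -
  have "(\<Sum>z\<in>{k * q..<n}. F z) = (\<Sum>z\<in>{0 + k * q..<(N * k + r) + k * q}. F z)"
    by (simp add: n_def algebra_simps)
  also have "\<dots> = (\<Sum>z<N * k + r. F (k * q + z))"
    by (subst sum.shift_bounds_nat_ivl) (simp add: atLeast0LessThan add.commute)
  also have "\<dots> = (\<Sum>z<N * k. F (k * q + z)) + (\<Sum>z\<in>{N * k..<N * k + r}. F (k * q + z))"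
    using sum.atLeastLessThan_concat[of 0 "N * k" "N * k + r" "\<lambda>z. F (k * q + z)"]
    by (simp add: atLeast0LessThan)
  also have "(\<Sum>z<N * k. F (k * q + z)) = (\<Sum>v<N. sum (\<lambda>z. F (k * q + z)) {v * k..<v * k + k})"
    by (rule sum.nat_group[symmetric])
  also have "\<dots> = (\<Sum>v<N. \<Sum>t<k. F (outer v t))"
  proof (rule sum.cong[OF refl])
    fix v
    show "(\<Sum>z\<in>{v * k..<v * k + k}. F (k * q + z)) = (\<Sum>t<k. F (outer v t))"
      using sum.shift_bounds_nat_ivl[of "\<lambda>z. F (k * q + z)" 0 "v * k" k]
      by (simp add: outer_def atLeast0LessThan algebra_simps)
  qed
  also have "(\<Sum>z\<in>{N * k..<N * k + r}. F (k * q + z)) = (\<Sum>t<r. F (outer N t))"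
    using sum.shift_bounds_nat_ivl[of "\<lambda>z. F (k * q + z)" 0 "N * k" r]
    by (simp add: outer_def atLeast0LessThan algebra_simps)
  finally show ?thesis .
qed

lemma outer_cases:
  assumes "z \<in> {k * q..<n}"
  obtains v t where "z = outer v t" "v < N" "t < k" | t where "z = outer N t" "t < r"
proof -
  let ?y = "z - k * q"
  have y: "?y < N * k + r" and z: "z = k * q + ?y" using assms by (auto simp: n_def algebra_simps)
  have eq: "?y = ?y div k * k + ?y mod k" by simp
  have t: "?y mod k < k" using k2 by simp
  show ?thesis
  proof (cases "?y div k < N")
    case True
    have "z = outer (?y div k) (?y mod k)" unfolding outer_def using z eq by linarith
    then show ?thesis using that(1) True t by blast
  next
    case False
    have "?y < (N + 1) * k" using y r_less by simp
    then have "?y div k < N + 1" by (simp add: less_mult_imp_div_less)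
    then have N: "?y div k = N" using False by simp
    have "z = outer N (?y mod k)" unfolding outer_def using z eq[unfolded N] by linarith
    moreover have "?y mod k < r" using y eq[unfolded N] by linarith
    ultimately show ?thesis using that(2) by blast
  qed
qed

lemma home_of_core: "j < k \<Longrightarrow> a < q \<Longrightarrow> home (core j a) = j"
  using core_less core_div by (simp add: home_def)

lemma home_outer: "v < N \<Longrightarrow> t < k \<Longrightarrow> home (outer v t) = (t + of_bool (majority_bit v)) mod k"
  using outer_ge[of v t] by (simp add: home_def Let_def outer_div outer_mod not_less)

lemma home_pendant: "t < r \<Longrightarrow> home (outer N t) = t"
  using outer_ge[of N t] r_less by (simp add: home_def Let_def outer_div outer_mod not_less)

lemma vote_edge_in_iff:
  "e \<in> vote_edges k q N i A \<longleftrightarrow> (\<exists>v<N. \<exists>t<k. e = {outer v t, core ((t + of_bool (v \<in> A)) mod k) ((i + v) mod q)})"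
  unfolding vote_edges_def outer_def core_def mem_Collect_eq by blast

lemma fixed_edge_in_iff:
  "e \<in> fixed_edges k q N r \<longleftrightarrow>
    (\<exists>u u'. e = {u, u'} \<and> u < k * q \<and> u' < k * q \<and> u \<noteq> u' \<and> u div q = u' div q) \<or>
    (\<exists>t<r. e = {outer N t, core t 0})"
  unfolding fixed_edges_def outer_def core_def mem_Collect_eq Un_iff add_0_right by blast

lemma E_in_iff:
  "e \<in> E \<longleftrightarrow> (\<exists>u u'. e = {u, u'} \<and> u < k * q \<and> u' < k * q \<and> u \<noteq> u' \<and> u div q = u' div q) \<or>
    (\<exists>t<r. e = {outer N t, core t 0}) \<or>
    (\<exists>i<m. \<exists>v<N. \<exists>t<k. e = {outer v t, core ((t + of_bool (v \<in> R i)) mod k) ((i + v) mod q)})"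
  unfolding E_def Un_iff UN_iff fixed_edge_in_iff vote_edge_in_iff Bex_def lessThan_iff by blast

lemma core_core_edge:
  assumes "u < k * q" "u' < k * q"
  shows "{u, u'} \<in> E \<longleftrightarrow> u \<noteq> u' \<and> u div q = u' div q"
proof
  assume "{u, u'} \<in> E"
  moreover have "{u, u'} \<noteq> {outer v t, c}" for v t c
    using assms outer_ge[of v t] by (auto simp: doubleton_eq_iff)
  ultimately show "u \<noteq> u' \<and> u div q = u' div q"
    unfolding E_in_iff by (auto simp: doubleton_eq_iff)
next
  assume "u \<noteq> u' \<and> u div q = u' div q"
  then show "{u, u'} \<in> E" unfolding E_in_iff using assms by blast
qed

lemma no_outer_outer_edge:
  assumes "z \<ge> k * q" "z' \<ge> k * q"
  shows "{z, z'} \<notin> E"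
proof
  assume "{z, z'} \<in> E"
  then consider u u' where "{z, z'} = {u, u'}" "u < k * q"
    | t where "{z, z'} = {outer N t, core t 0}" "t < r"
    | i v t where "{z, z'} = {outer v t, core ((t + of_bool (v \<in> R i)) mod k) ((i + v) mod q)}" "t < k"
    unfolding E_in_iff by blast
  then show False
  proof cases
    case 1
    then show ?thesis using assms by (auto simp: doubleton_eq_iff)
  next
    case 2
    then have "core t 0 < k * q" using r_less q_bounds by (intro core_less) auto
    then show ?thesis using 2 assms by (auto simp: doubleton_eq_iff)
  next
    case 3
    then have "core ((t + of_bool (v \<in> R i)) mod k) ((i + v) mod q) < k * q" using k2 q_bounds by (intro core_less) auto
    then show ?thesis using 3 assms by (auto simp: doubleton_eq_iff)
  qed
qed

lemma outer_core_edge: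
  assumes v: "v < N" "t < k" and j: "j < k" "a < q"
  shows "{outer v t, core j a} \<in> E \<longleftrightarrow> (\<exists>i<m. (i + v) mod q = a \<and> (t + of_bool (v \<in> R i)) mod k = j)"
proof -
  have lt: "core j a < k * q" by (rule core_less[OF j])
  have 1: "{outer v t, core j a} \<noteq> {u, u'}" if "u < k * q" "u' < k * q" for u u'
    using that outer_ge[of v t] by (auto simp: doubleton_eq_iff)
  have 2: "{outer v t, core j a} \<noteq> {outer N t', c}" if "t' < r" for t' c
    using that outer_ge[of N t'] lt v r_less outer_inject[of t t' v N] by (auto simp: doubleton_eq_iff)
  have 3: "{outer v t, core j a} = {outer v' t', core j' a'} \<longleftrightarrow> v = v' \<and> t = t' \<and> j = j' \<and> a = a'"
    if "t' < k" "a' < q" for v' t' j' a'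
    using that v j lt outer_ge[of v' t'] outer_inject[of t t' v v'] core_inject[of a a' j j']
    by (auto simp: doubleton_eq_iff)
  have amod: "i mod q < q" for i using q_bounds by simp
  show ?thesis
  proof
    assume "{outer v t, core j a} \<in> E"
    then obtain i v' t' where i: "i < m" "v' < N" "t' < k"
      and eq: "{outer v t, core j a} = {outer v' t', core ((t' + of_bool (v' \<in> R i)) mod k) ((i + v') mod q)}"
      unfolding E_in_iff using 1 2 by blast
    then have "v = v' \<and> t = t' \<and> j = (t' + of_bool (v' \<in> R i)) mod k \<and> a = (i + v') mod q"
      using 3 amod by (metis)
    then show "\<exists>i<m. (i + v) mod q = a \<and> (t + of_bool (v \<in> R i)) mod k = j" using i by blast
  next
    assume "\<exists>i<m. (i + v) mod q = a \<and> (t + of_bool (v \<in> R i)) mod k = j"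
    then show "{outer v t, core j a} \<in> E" unfolding E_in_iff using v by blast
  qed
qed

lemma pendant_core_edge:
  assumes t: "t < r" and j: "j < k" "a < q"
  shows "{outer N t, core j a} \<in> E \<longleftrightarrow> j = t \<and> a = 0"
proof -
  have lt: "core j a < k * q" by (rule core_less[OF j])
  have 1: "{outer N t, core j a} \<noteq> {u, u'}" if "u < k * q" "u' < k * q" for u u'
    using that outer_ge[of N t] by (auto simp: doubleton_eq_iff)
  have 2: "{outer N t, core j a} = {outer N t', core t' 0} \<longleftrightarrow> t = t' \<and> j = t' \<and> a = 0" if "t' < r" for t'
    using that t lt r_less outer_ge[of N t'] outer_inject[of t t' N N] core_inject[of a 0 j t'] j q_bounds
    by (auto simp: doubleton_eq_iff)
  have 3: "{outer N t, core j a} \<noteq> {outer v' t', c}" if "v' < N" "t' < k" for v' t' c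
    using that t lt r_less outer_ge[of v' t'] outer_inject[of t t' N v']
    by (auto simp: doubleton_eq_iff)
  show ?thesis
  proof
    assume "{outer N t, core j a} \<in> E"
    then obtain t' where "t' < r" "{outer N t, core j a} = {outer N t', core t' 0}"
      unfolding E_in_iff using 1 3 by blast
    then show "j = t \<and> a = 0" using 2 by blast
  next
    assume "j = t \<and> a = 0"
    then show "{outer N t, core j a} \<in> E" unfolding E_in_iff using t by blast
  qed
qed


section \<open>Votes, degrees and loads\<close>

definition tally :: "nat \<Rightarrow> nat \<Rightarrow> nat \<Rightarrow> nat" where
  "tally v t j = card {i \<in> {..<m}. (t + of_bool (v \<in> R i)) mod k = j}"

definition winning_votes :: "nat \<Rightarrow> nat" where
  "winning_votes v = card {i \<in> {..<m}. (v \<in> R i) = majority_bit v}"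

lemma tally_sum: "real (tally v t j) = (\<Sum>i<m. if (t + of_bool (v \<in> R i)) mod k = j then 1 else 0)"
  unfolding tally_def by (simp add: sum.If_cases Int_def)

lemma shift_inject: "t < k \<Longrightarrow> (t + of_bool a) mod k = (t + of_bool b) mod k \<longleftrightarrow> a = b"
proof -
  assume t: "t < k"
  have "(t + 1) mod k = (if t + 1 = k then 0 else t + 1)" using t by simp
  then have "(t + 1) mod k \<noteq> t" using k2 by (simp only: split: if_split) linarith
  then show ?thesis using t by (cases a; cases b) auto
qed

lemma tally_winner:
  assumes "t < k" and "(t + of_bool (majority_bit v)) mod k = j"
  shows "tally v t j = winning_votes v"
  unfolding tally_def winning_votes_def assms(2)[symmetric] shift_inject[OF assms(1)] ..

lemma card_votes_compl: "card {i \<in> {..<m}. v \<notin> R i} = m - card {i \<in> {..<m}. v \<in> R i}"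
proof -
  have "{i \<in> {..<m}. v \<notin> R i} = {..<m} - {i \<in> {..<m}. v \<in> R i}" by auto
  then show ?thesis by (simp only:, subst card_Diff_subset) auto
qed

text \<open>\<open>m\<close> is odd, so a column cannot be tied.\<close>

lemma winning_votes_majority: "m < 2 * winning_votes v"
proof (cases "majority_bit v")
  case True
  then show ?thesis by (simp add: winning_votes_def majority_bit_def)
next
  case False
  then have "winning_votes v = m - card {i \<in> {..<m}. v \<in> R i}"
    unfolding winning_votes_def using card_votes_compl by simp
  moreover have "2 * card {i \<in> {..<m}. v \<in> R i} \<noteq> m" using odd_m by presburger
  ultimately show ?thesis using False unfolding majority_bit_def by linarith
qed

lemma tally_loser:
  assumes "t < k" and j: "j \<noteq> (t + of_bool (majority_bit v)) mod k"
  shows "tally v t j + winning_votes v \<le> m"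
proof -
  let ?A = "{i \<in> {..<m}. (t + of_bool (v \<in> R i)) mod k = j}" and ?B = "{i \<in> {..<m}. (v \<in> R i) = majority_bit v}"
  have "?A \<inter> ?B = {}" using j by (auto simp del: of_bool_eq_1_iff)
  then have "card (?A \<union> ?B) = card ?A + card ?B" by (intro card_Un_disjoint) auto
  moreover have "card (?A \<union> ?B) \<le> card {..<m}" by (intro card_mono) auto
  ultimately show ?thesis unfolding tally_def winning_votes_def by simp
qed

lemma winning_votes_less:
  assumes "v < N"
  shows "winning_votes v < m"
proof -
  obtain i where i: "i < m" "(v \<in> R i) \<noteq> majority_bit v" using split_vote[OF assms] by metis
  then have "{i \<in> {..<m}. (v \<in> R i) = majority_bit v} \<subset> {..<m}" by auto
  then have "winning_votes v < card {..<m}" unfolding winning_votes_def by (intro psubset_card_mono) auto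
  then show ?thesis by simp
qed

lemma w_sym: "w u v = w v u"
  unfolding w_def unit_weight_def by (simp add: insert_commute)

lemma w_nonneg: "0 \<le> w u v"
  unfolding w_def unit_weight_def by simp

lemma sum_core_part:
  fixes F :: "nat \<Rightarrow> real"
  assumes "j < k"
  shows "(\<Sum>u | u \<in> {..<k * q} \<and> home u = j. F u) = (\<Sum>a<q. F (core j a))"
proof -
  have "(\<Sum>u | u \<in> {..<k * q} \<and> home u = j. F u) = (\<Sum>u<k * q. if home u = j then F u else 0)"
    by (rule sum.inter_filter) simp
  also have "\<dots> = (\<Sum>j'<k. \<Sum>a<q. if home (core j' a) = j then F (core j' a) else 0)" by (rule sum_cores)
  also have "\<dots> = (\<Sum>j'<k. if j' = j then (\<Sum>a<q. F (core j a)) else 0)"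
    by (intro sum.cong[OF refl]) (auto simp: home_of_core)
  finally show ?thesis using assms by simp
qed

text \<open>Within a column the residues \<open>(i + v) mod q\<close> are distinct because
  \<open>m \<le> q\<close>, so votes for the same core are distinct edges and none is lost in the
  edge set.\<close>

lemma votes_to_core:
  assumes v: "v < N" "t < k" and j: "j < k"
  shows "(\<Sum>a<q. w (outer v t) (core j a)) = real (tally v t j)"
proof -
  let ?I = "{i \<in> {..<m}. (t + of_bool (v \<in> R i)) mod k = j}"
  have "inj_on (\<lambda>i. (i + v) mod q) ?I"
  proof (rule inj_onI)
    fix i i' assume i: "i \<in> ?I" "i' \<in> ?I" and eq: "(i + v) mod q = (i' + v) mod q"
    then have "[i + v = i' + v] (mod q)" by (simp add: cong_def)
    then have "[i = i'] (mod q)" by (simp only: cong_add_rcancel_nat)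
    then show "i = i'" using i q_bounds by (simp add: cong_def)
  qed
  then have "tally v t j = card ((\<lambda>i. (i + v) mod q) ` ?I)" unfolding tally_def by (simp only: card_image)
  also have "(\<lambda>i. (i + v) mod q) ` ?I = {a \<in> {..<q}. {outer v t, core j a} \<in> E}"
  proof -
    have "i mod q < q" for i using q_bounds by simp
    then have "(\<lambda>i. (i + v) mod q) ` ?I =
        {a \<in> {..<q}. \<exists>i<m. (i + v) mod q = a \<and> (t + of_bool (v \<in> R i)) mod k = j}" by blast
    then show ?thesis using outer_core_edge[OF v j] by blast
  qed
  finally show ?thesis
    unfolding w_def unit_weight_def by (simp add: sum.If_cases Int_def)
qed

lemma votes_to:
  assumes "v < N" "t < k" "j < k"
  shows "(\<Sum>u | u \<in> {..<k * q} \<and> home u = j. w (outer v t) u) = real (tally v t j)"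
  unfolding sum_core_part[OF assms(3)] by (rule votes_to_core[OF assms])

lemma pendant_to_core:
  assumes t: "t < r" and j: "j < k"
  shows "(\<Sum>a<q. w (outer N t) (core j a)) = (if j = t then 1 else 0)"
proof -
  have "(\<Sum>a<q. w (outer N t) (core j a)) = (\<Sum>a<q. if a = 0 then (if j = t then 1 else 0) else 0)"
    by (intro sum.cong refl) (auto simp: w_def unit_weight_def pendant_core_edge[OF t j])
  then show ?thesis using q_bounds by simp
qed

lemma pendant_to:
  assumes "t < r" "j < k"
  shows "(\<Sum>u | u \<in> {..<k * q} \<and> home u = j. w (outer N t) u) = (if j = t then 1 else 0)"
  unfolding sum_core_part[OF assms(2)] by (rule pendant_to_core[OF assms])

lemmas to_core_part = votes_to[unfolded lessThan_iff] pendant_to[unfolded lessThan_iff]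

lemma outer_degree:
  assumes v: "v < N" "t < k"
  shows "(\<Sum>u<k * q. w (outer v t) u) = real m"
proof -
  have "(\<Sum>u<k * q. w (outer v t) u) = (\<Sum>j<k. real (tally v t j))"
    unfolding sum_cores by (intro sum.cong[OF refl]) (simp add: votes_to_core[OF v])
  also have "\<dots> = (\<Sum>i<m. \<Sum>j<k. if (t + of_bool (v \<in> R i)) mod k = j then 1 else 0)"
    unfolding tally_sum by (rule sum.swap)
  also have "\<dots> = (\<Sum>i<m. 1)" using k2 by (intro sum.cong[OF refl]) (simp add: sum.delta' split del: if_split)
  finally show ?thesis by simp
qed

lemma pendant_degree:
  assumes t: "t < r"
  shows "(\<Sum>u<k * q. w (outer N t) u) = 1"
proof -
  have "(\<Sum>u<k * q. w (outer N t) u) = (\<Sum>j<k. if j = t then 1 else 0)"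
    unfolding sum_cores by (intro sum.cong[OF refl]) (simp add: pendant_to_core[OF t])
  then show ?thesis using t r_less by simp
qed

lemma card_mod_class_le: "card {v \<in> {..<N}. (i + v) mod q = a} \<le> N div q + 1"
proof -
  have "inj_on (\<lambda>v. v div q) {v \<in> {..<N}. (i + v) mod q = a}"
  proof (rule inj_onI)
    fix v v' assume "v \<in> {v \<in> {..<N}. (i + v) mod q = a}" "v' \<in> {v \<in> {..<N}. (i + v) mod q = a}" and div: "v div q = v' div q"
    then have "[i + v = i + v'] (mod q)" by (simp add: cong_def)
    then have "v mod q = v' mod q" unfolding cong_add_lcancel_nat by (simp add: cong_def)
    then show "v = v'" using div by (metis div_mult_mod_eq)
  qed
  then have "card {v \<in> {..<N}. (i + v) mod q = a} \<le> card {..N div q}"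
    by (rule card_inj_on_le) (auto intro: div_le_mono)
  then show ?thesis by simp
qed

text \<open>A vote edge at core vertex \<open>(j, a)\<close> comes from a site \<open>i\<close> and
  a column \<open>v\<close> with \<open>(i + v) mod q = a\<close>, and these determine
  \<open>t\<close>. Each site has at most \<open>N div q + 1\<close> such columns; the last 1
  accounts for a pendant.\<close>

lemma core_load:
  assumes u: "u < k * q"
  shows "(\<Sum>z\<in>{k * q..<n}. w u z) \<le> real (m * (N div q + 1) + 1)"
proof -
  obtain j a where ja: "u = core j a" "j < k" "a < q" using core_of[OF u] by blast
  have "(\<Sum>z\<in>{k * q..<n}. w u z) = (\<Sum>v<N. \<Sum>t<k. w (outer v t) u) + (\<Sum>t<r. w (outer N t) u)"
    unfolding w_sym[of u] by (rule sum_outers)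
  moreover have "(\<Sum>t<r. w (outer N t) u) \<le> 1"
  proof -
    have "(\<Sum>t<r. w (outer N t) u) = (\<Sum>t<r. if t = j then (if a = 0 then 1 else 0) else 0)"
      using ja by (intro sum.cong refl) (auto simp: w_def unit_weight_def pendant_core_edge)
    then show ?thesis by simp
  qed
  moreover have "(\<Sum>v<N. \<Sum>t<k. w (outer v t) u) \<le> real (m * (N div q + 1))"
  proof -
    have "(\<Sum>v<N. \<Sum>t<k. w (outer v t) u) \<le>
        (\<Sum>v<N. \<Sum>t<k. \<Sum>i<m. if (t + of_bool (v \<in> R i)) mod k = j then (if (i + v) mod q = a then 1 else 0) else 0)"
    proof (intro sum_mono)
      fix v t assume "v \<in> {..<N}" "t \<in> {..<k}"
      then have vt: "v < N" "t < k" by auto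
      show "w (outer v t) u \<le> (\<Sum>i<m. if (t + of_bool (v \<in> R i)) mod k = j then (if (i + v) mod q = a then 1 else 0) else 0)"
      proof (cases "{outer v t, u} \<in> E")
        case True
        then obtain i where i: "i < m" "(i + v) mod q = a" "(t + of_bool (v \<in> R i)) mod k = j"
          unfolding ja(1) outer_core_edge[OF vt ja(2,3)] by blast
        have "w (outer v t) u = (\<Sum>i'\<in>{i}. if (t + of_bool (v \<in> R i')) mod k = j then (if (i' + v) mod q = a then 1 else 0) else 0)"
          using True i by (simp add: w_def unit_weight_def split del: if_split)
        also have "\<dots> \<le> (\<Sum>i<m. if (t + of_bool (v \<in> R i)) mod k = j then (if (i + v) mod q = a then 1 else 0) else 0)"
          using i(1) by (intro sum_mono2) auto
        finally show ?thesis .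
      next
        case False
        then have "w (outer v t) u = 0" by (simp add: w_def unit_weight_def)
        then show ?thesis by (simp only:) (intro sum_nonneg, auto)
      qed
    qed
    also have "\<dots> = (\<Sum>v<N. \<Sum>i<m. \<Sum>t<k. if (t + of_bool (v \<in> R i)) mod k = j then (if (i + v) mod q = a then 1 else 0) else 0)"
      by (intro sum.cong[OF refl]) (rule sum.swap)
    also have "\<dots> = (\<Sum>v<N. \<Sum>i<m. if (i + v) mod q = a then 1 else 0)"
      unfolding sum_shift[OF ja(2)] ..
    also have "\<dots> = (\<Sum>i<m. \<Sum>v<N. if (i + v) mod q = a then 1 else 0)" by (rule sum.swap)
    also have "\<dots> = (\<Sum>i<m. real (card {v \<in> {..<N}. (i + v) mod q = a}))"
      by (intro sum.cong[OF refl]) (simp add: sum.If_cases Int_def)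
    also have "\<dots> \<le> (\<Sum>i<m. real (N div q + 1))" by (intro sum_mono of_nat_mono card_mod_class_le)
    also have "\<dots> = real (m * (N div q + 1))" by (simp add: algebra_simps)
    finally show ?thesis .
  qed
  ultimately show ?thesis by simp
qed

sublocale core_graph w "{..<k}" q "{..<k * q}" "{k * q..<n}" home "real (m * (N div q + 1) + 1)"
proof
  fix u v assume uv: "u \<in> {..<k * q}" "v \<in> {..<k * q}"
  then show "w u v = (if u \<noteq> v \<and> home u = home v then 1 else 0)"
    using core_core_edge[of u v] by (simp add: w_def unit_weight_def home_def)
next
  fix u v assume "u \<in> {k * q..<n}" "v \<in> {k * q..<n}"
  then show "w u v = 0" using no_outer_outer_edge[of u v] by (simp add: w_def unit_weight_def)
next
  fix u assume "u \<in> {..<k * q}"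
  then show "home u \<in> {..<k}" by (simp add: home_def less_mult_imp_div_less)
next
  fix u assume "u \<in> {k * q..<n}"
  then show "home u \<in> {..<k}"
    using k2 r_less by (cases rule: outer_cases) (auto simp: home_outer home_pendant simp del: of_bool_eq_1_iff)
next
  fix i assume i: "i \<in> {..<k}"
  have "real (card {u. u \<in> {..<k * q} \<and> home u = i}) = (\<Sum>u | u \<in> {..<k * q} \<and> home u = i. 1)" by simp
  also have "\<dots> = real q" using i by (subst sum_core_part) auto
  finally show "card {u \<in> {..<k * q}. home u = i} = q" by simp
next
  fix u assume "u \<in> {..<k * q}"
  then show "(\<Sum>z\<in>{k * q..<n}. w u z) \<le> real (m * (N div q + 1) + 1)" by (intro core_load) simp
next
  have "real (16 * (m * (N div q + 1) + 1)) \<le> real q" using load_small by (rule of_nat_mono)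
  then show "16 * real (m * (N div q + 1) + 1) \<le> real q" by (simp only: of_nat_mult of_nat_numeral)
next
  show "q \<ge> 2" using q_bounds by simp
qed (auto simp: w_sym w_nonneg)

lemma vertices_eq: "{..<k * q} \<union> {k * q..<n} = {..<n}"
  by (auto simp: n_def)

lemma sum_home_part:
  "(\<Sum>z | z \<in> {k * q..<n} \<and> home z = j. F z) =
    (\<Sum>v<N. \<Sum>t<k. if (t + of_bool (majority_bit v)) mod k = j then F (outer v t) else 0)
    + (\<Sum>t<r. if t = j then F (outer N t) else 0)" for F :: "nat \<Rightarrow> real"
proof -
  have "(\<Sum>z | z \<in> {k * q..<n} \<and> home z = j. F z) = (\<Sum>z\<in>{k * q..<n}. if home z = j then F z else 0)"
    by (rule sum.inter_filter) simp
  also have "\<dots> = (\<Sum>v<N. \<Sum>t<k. if home (outer v t) = j then F (outer v t) else 0)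
      + (\<Sum>t<r. if home (outer N t) = j then F (outer N t) else 0)" by (rule sum_outers)
  finally show ?thesis by (simp add: home_outer home_pendant split del: if_split)
qed

lemma sum_votes_to:
  assumes j: "j < k"
  shows "(\<Sum>z\<in>{k * q..<n}. \<Sum>u | u \<in> {..<k * q} \<and> home u = j. w z u) = real (N * m) + of_bool (j < r)"
proof -
  have "(\<Sum>z\<in>{k * q..<n}. \<Sum>u | u \<in> {..<k * q} \<and> home u = j. w z u) =
      (\<Sum>v<N. \<Sum>t<k. real (tally v t j)) + (\<Sum>t<r. if t = j then 1 else 0)"
    unfolding sum_outers by (intro arg_cong2[where f=plus] sum.cong[OF refl]) (auto simp: to_core_part j)
  also have "(\<Sum>v<N. \<Sum>t<k. real (tally v t j)) = (\<Sum>v<N. \<Sum>i<m. \<Sum>t<k. if (t + of_bool (v \<in> R i)) mod k = j then 1 else 0)"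
    unfolding tally_sum by (intro sum.cong[OF refl] sum.swap)
  also have "\<dots> = real (N * m)" unfolding sum_shift[OF j] by simp
  finally show ?thesis by simp
qed

lemma sum_degree_part:
  assumes j: "j < k"
  shows "(\<Sum>z | z \<in> {k * q..<n} \<and> home z = j. \<Sum>u<k * q. w z u) = real (N * m) + of_bool (j < r)"
proof -
  have "(\<Sum>z | z \<in> {k * q..<n} \<and> home z = j. \<Sum>u<k * q. w z u) =
      (\<Sum>v<N. \<Sum>t<k. if (t + of_bool (majority_bit v)) mod k = j then real m else 0) + (\<Sum>t<r. if t = j then 1 else 0)"
    unfolding sum_home_part
    by (intro arg_cong2[where f=plus] sum.cong[OF refl] if_cong refl) (simp_all add: outer_degree pendant_degree)
  then show ?thesis unfolding sum_shift[OF j] by simp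
qed

text \<open>Each column has exactly one outer vertex at home in \<open>j\<close>, and it sends
  \<open>winning_votes v\<close> edges there, whatever \<open>j\<close> is; only the pendant term
  distinguishes the clusters.\<close>

lemma sum_votes_home:
  assumes j: "j < k"
  shows "(\<Sum>z | z \<in> {k * q..<n} \<and> home z = j. \<Sum>u | u \<in> {..<k * q} \<and> home u = j. w z u) =
    (\<Sum>v<N. real (winning_votes v)) + of_bool (j < r)"
proof -
  have "(\<Sum>z | z \<in> {k * q..<n} \<and> home z = j. \<Sum>u | u \<in> {..<k * q} \<and> home u = j. w z u) =
      (\<Sum>v<N. \<Sum>t<k. if (t + of_bool (majority_bit v)) mod k = j then real (winning_votes v) else 0)
      + (\<Sum>t<r. if t = j then 1 else 0)"
    unfolding sum_home_part
    by (intro arg_cong2[where f=plus] sum.cong[OF refl] if_cong refl)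
      (simp_all add: to_core_part tally_winner j)
  then show ?thesis unfolding sum_shift[OF j] by simp
qed

definition minority :: real where "minority = (\<Sum>v<N. real m - real (winning_votes v))"

definition base_volume :: real where "base_volume = real q * (real q - 1) + 2 * real (N * m)"

text \<open>In each column the outer vertex at home in \<open>j\<close> sends its losing votes
  elsewhere, and core \<open>j\<close> receives equally many from the rest of the column; hence the
  factor 2. Pendant edges are not cut.\<close>

lemma cut_part:
  assumes "j < k"
  shows "cut w {u \<in> {..<n}. home u = j} ({..<n} - {u \<in> {..<n}. home u = j}) = 2 * minority"
  using cut_home_eq[of j] unfolding vertices_eq sum_votes_to[OF assms] sum_degree_part[OF assms] sum_votes_home[OF assms]
  by (simp add: minority_def sum_subtractf)

lemma vol_part:
  assumes "j < k"
  shows "volume w {..<n} {u \<in> {..<n}. home u = j} = base_volume + 2 * of_bool (j < r)"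
  using vol_home_eq[of j] assms unfolding vertices_eq sum_votes_to[OF assms] sum_degree_part[OF assms]
  by (simp add: base_volume_def)

lemma minority_bounds: "0 < minority" "minority \<le> real (N * m)"
proof -
  show "0 < minority" unfolding minority_def
    using N1 winning_votes_less by (intro sum_pos) (auto simp: lessThan_empty_iff)
  have "minority \<le> (\<Sum>v<N. real m)" unfolding minority_def by (intro sum_mono) simp
  then show "minority \<le> real (N * m)" by simp
qed

lemma base_volume_ge: "real (q * (q - 1)) \<le> base_volume"
  using q_bounds by (simp add: base_volume_def of_nat_diff)

lemma sparse_real: "real (8 + k) * (2 * minority) < base_volume"
proof -
  have "real (8 + k) * (2 * minority) \<le> real (8 + k) * (2 * real (N * m))"
    using minority_bounds by (intro mult_left_mono) auto
  also have "\<dots> = real (2 * (8 + k) * N * m)" by simp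
  also have "\<dots> < real (q * (q - 1))" using sparse by (rule of_nat_less_iff[THEN iffD2])
  finally show ?thesis using base_volume_ge by linarith
qed

sublocale clustered_graph w k q "{..<k * q}" "{k * q..<n}" home "real (m * (N div q + 1) + 1)" n
  "2 * minority" base_volume
proof
  show "{..<k * q} \<union> {k * q..<n} = {..<n}" by (rule vertices_eq)
  fix v assume v: "v < n"
  show "degree w {..<n} v > 0"
  proof (cases "v < k * q")
    case True
    have "(\<Sum>z\<in>{k * q..<n}. w v z) \<ge> 0" by (intro sum_nonneg w_nonneg)
    then show ?thesis using degree_core[of v] True q_bounds unfolding vertices_eq by simp
  next
    case False
    then have "v \<in> {k * q..<n}" using v by simp
    then have "degree w {..<n} v = (\<Sum>u<k * q. w v u)" using degree_out[of v] unfolding vertices_eq by simp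
    moreover from \<open>v \<in> {k * q..<n}\<close> have "(\<Sum>u<k * q. w v u) > 0"
      using m1 by (cases rule: outer_cases) (simp_all add: outer_degree pendant_degree)
    ultimately show ?thesis by simp
  qed
next
  fix u i assume u: "u \<in> {k * q..<n}" and i: "i < k" "i \<noteq> home u"
  from u show "(\<Sum>v | v \<in> {..<k * q} \<and> home v = i. w u v) + 1 \<le> (\<Sum>v | v \<in> {..<k * q} \<and> home v = home u. w u v)"
  proof (cases rule: outer_cases)
    case (1 v t)
    define j where "j = (t + of_bool (majority_bit v)) mod k"
    have j: "home u = j" "j < k" using 1 k2 home_outer by (auto simp: j_def)
    have "tally v t i + 1 \<le> tally v t j"
      using tally_loser[of t i v] tally_winner[of t v j] winning_votes_majority[of v] 1 i j by (simp add: j_def)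
    then have "real (tally v t i) + 1 \<le> real (tally v t j)" by linarith
    moreover have "home (outer v t) = j" using j(1) 1(1) by simp
    ultimately show ?thesis
      unfolding 1(1) by (simp only: votes_to[OF 1(2,3) i(1)] votes_to[OF 1(2,3) j(2)])
  next
    case (2 t)
    then show ?thesis using i pendant_to[of t i] pendant_to[of t t] r_less home_pendant[of t] by simp
  qed
next
  fix j assume j: "j < k"
  show "cut w {u \<in> {..<n}. home u = j} ({..<n} - {u \<in> {..<n}. home u = j}) = 2 * minority"
    "base_volume \<le> volume w {..<n} {u \<in> {..<n}. home u = j}"
    "volume w {..<n} {u \<in> {..<n}. home u = j} \<le> base_volume + 2"
    unfolding cut_part[OF j] vol_part[OF j] by simp_all
next
  show "2 * minority > 0" using minority_bounds by simp
  have "8 * (2 * minority) \<le> real (8 + k) * (2 * minority)" "real k * (2 * minority) \<le> real (8 + k) * (2 * minority)"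
    using minority_bounds by (auto intro!: mult_right_mono)
  then show "8 * (2 * minority) < base_volume" "real k * (2 * minority) < base_volume"
    using sparse_real by linarith+
  show "k \<ge> 1" using k2 by simp
qed

lemma simple_edges_E: "simple_edges n E"
proof -
  have "\<exists>u v. e = {u, v} \<and> u < n \<and> v < n \<and> u \<noteq> v" if "e \<in> E" for e
  proof -
    have kqn: "k * q \<le> n" by (simp add: n_def)
    have on: "outer v t < n" if "v < N" "t < k" for v t
    proof -
      have "v * k + t < (v + 1) * k" using that by simp
      also have "\<dots> \<le> N * k" using that by (intro mult_le_mono1) simp
      finally show ?thesis by (simp add: outer_def n_def mult.commute)
    qed
    have pn: "outer N t < n" if "t < r" for t using that by (simp add: outer_def n_def mult.commute)
    have cn: "c < n \<and> outer v t \<noteq> c" if "c < k * q" for c v t using that kqn outer_ge[of v t] by linarith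
    from \<open>e \<in> E\<close> consider u u' where "e = {u, u'}" "u < k * q" "u' < k * q" "u \<noteq> u'"
      | t where "e = {outer N t, core t 0}" "t < r"
      | i v t where "e = {outer v t, core ((t + of_bool (v \<in> R i)) mod k) ((i + v) mod q)}" "v < N" "t < k"
      unfolding E_in_iff by blast
    then show ?thesis
    proof cases
      case 1
      then show ?thesis using kqn by (metis less_le_trans)
    next
      case 2
      have "core t 0 < k * q" using 2 r_less q_bounds by (intro core_less) auto
      then show ?thesis using 2 pn cn by blast
    next
      case 3
      have "core ((t + of_bool (v \<in> R i)) mod k) ((i + v) mod q) < k * q" using k2 q_bounds by (intro core_less) auto
      then show ?thesis using 3 on cn by blast
    qed
  qed
  then show ?thesis unfolding simple_edges_def by blast
qed

theorem well_clustered_E: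
  fixes Cc :: real
  assumes "Cc \<ge> 0" and "4 * Cc * real k ^ 3 * real (N * m) \<le> real (q * (q - 1))"
  shows "well_clustered n k (1 / 8) Cc E"
proof -
  have "n \<ge> k * q" by (simp add: n_def)
  moreover have "k * 1 < k * q" using k2 q_bounds by simp
  ultimately have kn: "k < n" by linarith
  have "2 * (Cc * real k ^ 3) * (2 * minority) \<le> 4 * Cc * real k ^ 3 * real (N * m)"
    using minority_bounds assms(1) mult_left_mono[of minority "real (N * m)" "4 * Cc * real k ^ 3"] by simp
  then have "2 * (Cc * real k ^ 3) * (2 * minority) \<le> base_volume"
    using assms(2) base_volume_ge by linarith
  then have "Cc * real k ^ 3 \<le> eigenvalue_nth (norm_laplacian w n) (k + 1) / expansion_const w {..<n} k"
    using kn assms(1) by (intro eigenvalue_ratio) auto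
  then show ?thesis
    unfolding well_clustered_def using simple_edges_E degree_pos cluster_expansion
    by (simp add: w_def)
qed

end

section \<open>Disjoint inputs, and what an output reveals\<close>

context vote_graph
begin

text \<open>An edge determines its column and the residue of \<open>i + v\<close> modulo
  \<open>q\<close>, hence \<open>i\<close>, as \<open>m \<le> q\<close>. So the edges of two sites
  are disjoint for any bits.\<close>

lemma vote_edges_disjoint:
  assumes "i < m" "i' < m" and e: "e \<in> vote_edges k q N i A" "e \<in> vote_edges k q N i' A'"
  shows "i = i'"
proof -
  obtain v t v' t' where vt: "v < N" "t < k" "v' < N" "t' < k"
    and eq: "e = {outer v t, core ((t + of_bool (v \<in> A)) mod k) ((i + v) mod q)}"
      "e = {outer v' t', core ((t' + of_bool (v' \<in> A')) mod k) ((i' + v') mod q)}"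
    using e unfolding vote_edge_in_iff by blast
  have amod: "a mod q < q" "a mod k < k" for a using q_bounds k2 by auto
  define a a' where "a = core ((t + of_bool (v \<in> A)) mod k) ((i + v) mod q)"
    and "a' = core ((t' + of_bool (v' \<in> A')) mod k) ((i' + v') mod q)"
  have "a < k * q" "a' < k * q" unfolding a_def a'_def by (intro core_less amod)+
  moreover have "{outer v t, a} = {outer v' t', a'}" using eq unfolding a_def a'_def by blast
  ultimately have "outer v t = outer v' t' \<and> a = a'"
    using outer_ge[of v t] outer_ge[of v' t'] by (auto simp: doubleton_eq_iff)
  then have "outer v t = outer v' t' \<and>
      core ((t + of_bool (v \<in> A)) mod k) ((i + v) mod q) = core ((t' + of_bool (v' \<in> A')) mod k) ((i' + v') mod q)"
    unfolding a_def a'_def .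
  then have "v = v'" "(i + v) mod q = (i' + v') mod q"
    using vt outer_inject core_inject amod by metis+
  then have "[i + v = i' + v] (mod q)" by (simp add: cong_def)
  then have "[i = i'] (mod q)" by (simp only: cong_add_rcancel_nat)
  then show ?thesis using assms(1,2) q_bounds by (simp add: cong_def)
qed

lemma vote_fixed_disjoint: "vote_edges k q N i A \<inter> fixed_edges k q N r = {}"
proof (rule ccontr)
  assume "\<not> ?thesis"
  then obtain e where e: "e \<in> vote_edges k q N i A" "e \<in> fixed_edges k q N r" by blast
  then obtain v t where vt: "v < N" "t < k"
    and eq: "e = {outer v t, core ((t + of_bool (v \<in> A)) mod k) ((i + v) mod q)}"
    unfolding vote_edge_in_iff by blast
  have c: "core ((t + of_bool (v \<in> A)) mod k) ((i + v) mod q) < k * q"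
    using q_bounds k2 by (intro core_less) auto
  from e(2) consider u u' where "e = {u, u'}" "u < k * q" "u' < k * q"
    | t' where "e = {outer N t', core t' 0}" "t' < r"
    unfolding fixed_edge_in_iff by blast
  then show False
  proof cases
    case 1
    then show ?thesis using eq outer_ge[of v t] by (metis insertCI insertE not_le singletonD)
  next
    case 2
    have "outer v t \<in> {outer N t', core t' 0}" using eq 2(1) by blast
    moreover have "core t' 0 < k * q" using 2 r_less q_bounds by (intro core_less) auto
    ultimately have "outer v t = outer N t'" using outer_ge[of v t] by auto
    then show ?thesis using outer_inject[of t t' v N] vt 2(2) r_less by simp
  qed
qed

lemma card_home_part_ge:
  assumes j: "j < k"
  shows "N \<le> card (home_part j)"
proof -
  let ?f = "\<lambda>v. outer v ((j + (k - of_bool (majority_bit v))) mod k)"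
  have mk: "a mod k < k" for a using k2 by simp
  have "inj_on ?f {..<N}"
    by (rule inj_onI) (use outer_inject[OF mk mk] in blast)
  moreover have "?f ` {..<N} \<subseteq> home_part j"
  proof
    fix z assume "z \<in> ?f ` {..<N}"
    then obtain v where v: "v < N" "z = ?f v" by blast
    have "home z = j" unfolding v(2) home_outer[OF v(1) mk] using mod_shift_iff[OF mk j] by blast
    moreover have "z \<in> {..<n}"
    proof -
      let ?t = "(j + (k - of_bool (majority_bit v))) mod k"
      have "v * k + ?t < (v + 1) * k" using mk by simp
      also have "\<dots> \<le> N * k" using v by (intro mult_le_mono1) simp
      finally show ?thesis unfolding v(2) by (simp add: outer_def n_def mult.commute)
    qed
    ultimately show "z \<in> home_part j" by (simp add: home_part_def)
  qed
  ultimately have "card {..<N} \<le> card (home_part j)"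
    by (intro card_inj_on_le) (auto simp: home_part_def)
  then show ?thesis by simp
qed

text \<open>A cluster has \<open>q\<close> core vertices, at most one pendant, and one outer vertex
  per column. By \<open>qN\<close> the first two kinds make up at most half of \<open>c * N\<close>,
  so the rest of \<open>S\<close> meets at least \<open>c / 2 * N\<close> columns.\<close>

lemma cluster_fraction_columns:
  assumes c: "c > 0" and frac: "cluster_fraction c n k E S" and qN: "real q + 1 \<le> c * real N / 2"
  shows "\<exists>j<k. (\<forall>v<N. \<forall>t<k. k * q + v * k + t \<in> S \<longrightarrow> (t + of_bool (majority_bit v)) mod k = j)
    \<and> c / 2 * real N \<le> real (card {v \<in> {..<N}. \<exists>t<k. k * q + v * k + t \<in> S})"
proof -
  let ?T = "{v \<in> {..<N}. \<exists>t<k. k * q + v * k + t \<in> S}"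
  obtain j where j: "j < k" and S: "S \<subseteq> home_part j" and size: "c * real (card (home_part j)) \<le> real (card S)"
    using frac is_cluster_iff unfolding cluster_fraction_def w_def by auto
  have home: "(t + of_bool (majority_bit v)) mod k = j" if "v < N" "t < k" "k * q + v * k + t \<in> S" for v t
    using S that home_outer[OF that(1,2)] by (auto simp: outer_def home_part_def simp del: of_bool_eq_1_iff)
  have "S \<subseteq> {u. u \<in> {..<k * q} \<and> home u = j} \<union> {outer N j} \<union>
      (\<lambda>v. outer v ((j + (k - of_bool (majority_bit v))) mod k)) ` ?T"
  proof
    fix u assume u: "u \<in> S"
    then have un: "u < n" "home u = j" using S by (auto simp: home_part_def)
    show "u \<in> {u. u \<in> {..<k * q} \<and> home u = j} \<union> {outer N j} \<union>
      (\<lambda>v. outer v ((j + (k - of_bool (majority_bit v))) mod k)) ` ?T"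
    proof (cases "u < k * q")
      case True
      then show ?thesis using un by simp
    next
      case False
      then have "u \<in> {k * q..<n}" using un by simp
      then show ?thesis
      proof (cases rule: outer_cases)
        case (1 v t)
        have "(t + of_bool (majority_bit v)) mod k = j"
          using un(2) unfolding 1(1) home_outer[OF 1(2,3)] .
        then have "t = (j + (k - of_bool (majority_bit v))) mod k"
          by (rule iffD1[OF mod_shift_iff[OF 1(3) j]])
        moreover have "v \<in> ?T" using 1 u by (auto simp: outer_def)
        ultimately show ?thesis using 1(1) by blast
      next
        case (2 t)
        then show ?thesis using un home_pendant by simp
      qed
    qed
  qed
  then have "card S \<le> card ({u. u \<in> {..<k * q} \<and> home u = j} \<union> {outer N j} \<union>
      (\<lambda>v. outer v ((j + (k - of_bool (majority_bit v))) mod k)) ` ?T)"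
    by (rule card_mono[rotated]) simp
  also have "\<dots> \<le> card {u. u \<in> {..<k * q} \<and> home u = j} + card {outer N j} +
      card ((\<lambda>v. outer v ((j + (k - of_bool (majority_bit v))) mod k)) ` ?T)"
    by (intro order_trans[OF card_Un_le] add_mono card_Un_le order.refl)
  also have "\<dots> \<le> q + 1 + card ?T"
    using core_size[of j] j by (intro add_mono card_image_le) auto
  finally have "real (card S) \<le> real q + 1 + real (card ?T)" by linarith
  moreover have "c * real N \<le> c * real (card (home_part j))"
    using c card_home_part_ge[OF j] by (intro mult_left_mono) auto
  ultimately have "c / 2 * real N \<le> real (card ?T)" using size qN by simp
  then show ?thesis using j home by blast
qed

end

section \<open>Parameters\<close>

lemma parameter_choice:
  fixes k :: nat and c C K \<tau> :: real
  assumes k: "k \<ge> 2" and c: "0 < c" "c \<le> 1" and C: "C > 0" and K: "K > 0" and \<tau>: "\<tau> > 0"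
  shows "\<exists>\<gamma>>0. \<exists>n0::nat. \<forall>n\<ge>n0. \<forall>s::nat. 1 \<le> s \<and> real s \<le> K * real n \<longrightarrow>
    (\<exists>q N r m. n = k * q + k * N + r \<and> r < k \<and> odd m \<and> m \<le> s \<and> N \<ge> 1 \<and>
      16 * ((m + 2) * (N div q + 1) + 1) \<le> q \<and> 2 * (8 + k) * N * (m + 2) < q * (q - 1) \<and>
      4 * C * real k ^ 3 * real (N * (m + 2)) \<le> real (q * (q - 1)) \<and> real q + 1 \<le> c * real N / 2 \<and>
      real N \<ge> 16 / \<tau>\<^sup>2 \<and> \<gamma> * real n * real s \<le> \<tau>\<^sup>2 / 16 * real N * real m)"
proof -
  \<comment> \<open>The share of \<open>n\<close> given to one core. As
    \<open>N \<ge> n / (2 * k)\<close>, a core has at most half of \<open>c * N / 2\<close>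
    vertices.\<close>
  define \<theta> where "\<theta> = c / (8 * real k)"
  \<comment> \<open>Covers the two sparsity conditions at once; the extra 1 makes the first of them
    strict.\<close>
  define M where "M = 2 * (8 + real k) + 4 * C * real k ^ 3 + 1"
  \<comment> \<open>An upper bound for \<open>(m + 2) / n\<close>. Since
    \<open>N div q + 1 \<le> 17 / c\<close>, the first entry keeps the vote load at most
    \<open>\<theta> * n / 64\<close>, where 1088 is 64 times 17; the second makes
    \<open>M * N * (m + 2)\<close> at most \<open>q * q / 2\<close>.\<close>
  define \<eta> where "\<eta> = min (\<theta> * c / 1088) (\<theta>\<^sup>2 / (8 * M))"
  \<comment> \<open>The cap on \<open>m\<close> costs at most this factor, as
    \<open>s \<le> K * n\<close>. The constant \<open>\<gamma>\<close> then combines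
    \<open>m \<ge> \<kappa> * s / 2\<close> with \<open>N \<ge> n / (2 * k)\<close>.\<close>
  define \<kappa> where "\<kappa> = min 1 (\<eta> / (2 * K))"
  define \<gamma> where "\<gamma> = \<tau>\<^sup>2 / 16 * (\<kappa> / (4 * real k))"
  define n0 where "n0 = nat \<lceil>64 / \<theta> + 8 * real k + 32 * real k / \<tau>\<^sup>2 + 8 / \<eta>\<rceil>"
  have k0: "real k \<ge> 2" using k by simp
  have M0: "M > 0" unfolding M_def using C k0 by (simp add: add_pos_pos)
  have \<theta>0: "\<theta> > 0" unfolding \<theta>_def using c k0 by simp
  have \<eta>0: "\<eta> > 0" unfolding \<eta>_def using c \<theta>0 M0 by simp
  have \<kappa>0: "\<kappa> > 0" "\<kappa> \<le> 1" unfolding \<kappa>_def using \<eta>0 K by auto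
  have \<gamma>0: "\<gamma> > 0" unfolding \<gamma>_def using \<kappa>0 \<tau> k0 by simp
  show ?thesis
  proof (rule exI[of _ \<gamma>], rule conjI[OF \<gamma>0], rule exI[of _ n0], intro allI impI)
    fix n s :: nat assume n: "n \<ge> n0" and s: "1 \<le> s \<and> real s \<le> K * real n"
    have "real n \<ge> real n0" using n by simp
    also have "real n0 \<ge> 64 / \<theta> + 8 * real k + 32 * real k / \<tau>\<^sup>2 + 8 / \<eta>" unfolding n0_def by linarith
    finally have nbig: "64 / \<theta> + 8 * real k + 32 * real k / \<tau>\<^sup>2 + 8 / \<eta> \<le> real n" .
    have pos: "64 / \<theta> \<ge> 0" "32 * real k / \<tau>\<^sup>2 \<ge> 0" "8 / \<eta> \<ge> 0" using \<theta>0 \<eta>0 by auto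
    have n1: "64 / \<theta> \<le> real n" "8 * real k \<le> real n" "32 * real k / \<tau>\<^sup>2 \<le> real n" "8 / \<eta> \<le> real n"
      using nbig pos k0 by linarith+
    have n\<theta>: "64 \<le> \<theta> * real n" using n1(1) \<theta>0 by (simp add: field_simps)
    have n\<eta>: "8 \<le> \<eta> * real n" using n1(4) \<eta>0 by (simp add: field_simps)
    have npos: "real n > 0" using n1(2) k0 by linarith
    define q where "q = nat \<lfloor>\<theta> * real n\<rfloor>"
    define N where "N = n div k - q"
    define r where "r = n mod k"
    define b where "b = nat \<lfloor>\<eta> * real n\<rfloor>"
    \<comment> \<open>The offset 2 reserves room for the two opposing rows; \<open>m\<close> is the
      largest odd number up to \<open>L\<close>.\<close>
    define L where "L = min s (b - 2)"
    define m where "m = 2 * ((L - 1) div 2) + 1"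
    have q: "real q \<le> \<theta> * real n" "\<theta> * real n - 1 \<le> real q"
      unfolding q_def using n\<theta> by simp_all
    have q2: "\<theta> * real n / 2 \<le> real q" using q n\<theta> by simp
    define z where "z = real n / real k"
    have ndk: "z - 1 \<le> real (n div k)" "real (n div k) \<le> z"
    proof -
      show "real (n div k) \<le> z" unfolding z_def by (rule of_nat_div_le_of_nat)
      have "n div k * k + n mod k \<le> n div k * k + k" using k by (intro add_left_mono) (simp add: less_imp_le)
      then have "n \<le> n div k * k + k" by (simp only: div_mult_mod_eq)
      then have "real n \<le> real (n div k * k + k)" by (rule of_nat_mono)
      then have "real n \<le> real (n div k) * real k + real k" by (simp only: of_nat_mult of_nat_add)
      then show "z - 1 \<le> real (n div k)" unfolding z_def using k0 by (simp add: field_simps)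
    qed
    have c\<theta>: "\<theta> * real n \<le> z / 8"
      unfolding \<theta>_def z_def using c npos k0 by (simp add: field_simps mult_left_le_one_le)
    have nk: "8 \<le> z" unfolding z_def using n1(2) k0 by (simp add: field_simps)
    have qk: "q \<le> n div k"
    proof -
      have "real q \<le> real (n div k)" using q(1) c\<theta> ndk(1) nk by linarith
      then show ?thesis by simp
    qed
    have N: "real N = real (n div k) - real q" unfolding N_def using qk by simp
    have Nlow: "z / 2 \<le> real N" using N q(1) c\<theta> ndk(1) nk by linarith
    have Nup: "real N \<le> z" using N ndk(2) by linarith
    have L1: "L \<ge> 1" and Lup: "real L + 2 \<le> \<eta> * real n" and Llow: "\<kappa> * real s \<le> real L"
    proof -
      have b: "real b \<le> \<eta> * real n" "\<eta> * real n - 1 \<le> real b"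
        unfolding b_def using n\<eta> by simp_all
      then have b3: "b \<ge> 3" using n\<eta> by linarith
      then have b2: "real (b - 2) = real b - 2" by (simp add: of_nat_diff)
      show "L \<ge> 1" unfolding L_def using s b3 by auto
      have "real L \<le> real (b - 2)" unfolding L_def by simp
      then show "real L + 2 \<le> \<eta> * real n" unfolding b2 using b by linarith
      show "\<kappa> * real s \<le> real L"
      proof (cases "s \<le> b - 2")
        case True
        then have "L = s" unfolding L_def by simp
        then show ?thesis using \<kappa>0 by (simp add: mult_left_le_one_le)
      next
        case False
        then have "real L = real b - 2" unfolding L_def using b2 by (simp add: min_def)
        then have "\<eta> * real n / 2 \<le> real L" using n\<eta> b by simp
        moreover have "\<kappa> * real s \<le> \<eta> / (2 * K) * (K * real n)"
          using s \<kappa>0 \<eta>0 K by (intro mult_mono) (auto simp: \<kappa>_def)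
        ultimately show ?thesis using K by simp
      qed
    qed
    have m: "odd m" "m \<le> L" "L \<le> 2 * m" unfolding m_def using L1 by presburger+
    have m2: "real (m + 2) \<le> \<eta> * real n" using m(2) Lup by simp
    have qpos: "real q > 0" using q2 n\<theta> by linarith
    show "\<exists>q N r m. n = k * q + k * N + r \<and> r < k \<and> odd m \<and> m \<le> s \<and> N \<ge> 1 \<and>
      16 * ((m + 2) * (N div q + 1) + 1) \<le> q \<and> 2 * (8 + k) * N * (m + 2) < q * (q - 1) \<and>
      4 * C * real k ^ 3 * real (N * (m + 2)) \<le> real (q * (q - 1)) \<and> real q + 1 \<le> c * real N / 2 \<and>
      real N \<ge> 16 / \<tau>\<^sup>2 \<and> \<gamma> * real n * real s \<le> \<tau>\<^sup>2 / 16 * real N * real m"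
    proof (intro exI conjI)
      have "k * q + k * N = k * (n div k)" unfolding N_def using qk by (simp flip: distrib_left)
      then show "n = k * q + k * N + r" unfolding r_def by simp
      show "r < k" unfolding r_def using k by simp
      show "odd m" by (rule m(1))
      show "m \<le> s" using m(2) unfolding L_def by simp
      show "N \<ge> 1" using Nlow nk by linarith
      show "16 * ((m + 2) * (N div q + 1) + 1) \<le> q"
      proof -
        have "real (N div q) \<le> real N / real q" by (rule of_nat_div_le_of_nat)
        also have "\<dots> \<le> (z) / (\<theta> * real n / 2)"
          using Nup q2 n\<theta> qpos by (intro frac_le) auto
        also have "\<dots> = 16 / c" unfolding \<theta>_def z_def using c k0 npos by (simp add: field_simps)
        finally have "real (N div q) + 1 \<le> 17 / c" using c by (simp add: field_simps)
        then have "real (m + 2) * (real (N div q) + 1) \<le> (\<eta> * real n) * (17 / c)"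
          using m2 by (intro mult_mono) auto
        also have "\<dots> \<le> (\<theta> * c / 1088 * real n) * (17 / c)"
          using c npos by (intro mult_right_mono) (auto simp: \<eta>_def)
        also have "\<dots> = \<theta> * real n / 64" using c by (simp add: field_simps)
        finally have "16 * (real (m + 2) * (real (N div q) + 1) + 1) \<le> \<theta> * real n / 2" using n\<theta> by simp
        then have "16 * (real (m + 2) * (real (N div q) + 1) + 1) \<le> real q" using q2 by linarith
        moreover have "16 * (real (m + 2) * (real (N div q) + 1) + 1) = real (16 * ((m + 2) * (N div q + 1) + 1))"
          by (simp only: of_nat_mult of_nat_add of_nat_numeral of_nat_1)
        ultimately show ?thesis by (simp only: of_nat_le_iff)
      qed
      have big: "M * real (N * (m + 2)) \<le> real (q * (q - 1))"
      proof -
        have q1: "q \<ge> 2" using q2 n\<theta> by linarith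
        have "M * real (N * (m + 2)) \<le> M * (z * (\<eta> * real n))"
          unfolding of_nat_mult using M0 Nup m2 npos k0 by (intro mult_left_mono mult_mono) auto
        also have "\<dots> \<le> M * (real n * (\<theta>\<^sup>2 / (8 * M) * real n))"
          using M0 npos k0 \<eta>0 by (intro mult_left_mono mult_mono mult_right_mono)
            (auto simp: \<eta>_def z_def field_simps)
        also have "\<dots> = (\<theta> * real n / 2) * (\<theta> * real n / 2) / 2"
          using M0 by (simp add: field_simps power2_eq_square)
        also have "\<dots> \<le> real q * real q / 2"
          using q2 n\<theta> by (intro divide_right_mono mult_mono) auto
        also have "\<dots> \<le> real q * (real q - 1)" using q1 by (simp add: field_simps)
        finally show ?thesis using q1 by (simp add: of_nat_diff)
      qed
      have Nm: "real (N * (m + 2)) > 0"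
        unfolding of_nat_mult using Nlow nk by (intro mult_pos_pos) auto
      have MM: "M * real (N * (m + 2)) = 2 * (8 + real k) * real (N * (m + 2)) +
          4 * C * real k ^ 3 * real (N * (m + 2)) + real (N * (m + 2))"
        unfolding M_def by (simp only: distrib_right mult_1_left)
      have p: "4 * C * real k ^ 3 * real (N * (m + 2)) \<ge> 0" "2 * (8 + real k) * real (N * (m + 2)) \<ge> 0"
        using C by auto
      have "2 * (8 + real k) * real (N * (m + 2)) < real (q * (q - 1))" using big MM p Nm by linarith
      moreover have "2 * (8 + real k) * real (N * (m + 2)) = real (2 * (8 + k) * N * (m + 2))"
        by (simp only: of_nat_mult of_nat_add of_nat_numeral mult.assoc)
      ultimately show "2 * (8 + k) * N * (m + 2) < q * (q - 1)" by (simp only: of_nat_less_iff)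
      show "4 * C * real k ^ 3 * real (N * (m + 2)) \<le> real (q * (q - 1))" using big MM p Nm by linarith
      have "2 * (\<theta> * real n) = c / 2 * (z / 2)" unfolding \<theta>_def z_def using k0 by (simp add: field_simps)
      also have "\<dots> \<le> c / 2 * real N" using Nlow c by (intro mult_left_mono) auto
      finally have "2 * (\<theta> * real n) \<le> c * real N / 2" by simp
      then show "real q + 1 \<le> c * real N / 2" using q(1) n\<theta> by linarith
      have "16 / \<tau>\<^sup>2 \<le> z / 2" unfolding z_def using n1(3) k0 by (simp add: field_simps)
      then show "real N \<ge> 16 / \<tau>\<^sup>2" using Nlow by linarith
      have "\<kappa> * real s / 2 \<le> real m" using Llow m(3) by linarith
      then have "(z / 2) * (\<kappa> * real s / 2) \<le> real N * real m"
        using Nlow \<kappa>0 npos k0 by (intro mult_mono) auto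
      then have "\<tau>\<^sup>2 / 16 * ((z / 2) * (\<kappa> * real s / 2)) \<le> \<tau>\<^sup>2 / 16 * (real N * real m)"
        by (intro mult_left_mono) auto
      moreover have "\<gamma> * real n * real s = \<tau>\<^sup>2 / 16 * ((z / 2) * (\<kappa> * real s / 2))"
        unfolding \<gamma>_def z_def using k0 by (simp add: field_simps)
      ultimately show "\<gamma> * real n * real s \<le> \<tau>\<^sup>2 / 16 * real N * real m" by (simp only: mult.assoc)
    qed
  qed
qed

section \<open>The lower bound\<close>

text \<open>The sites turn their bits into edges locally, so a protocol on graphs becomes a protocol
  on bits with the same coordinator tree and the same transcripts.\<close>

lemma execute_precompose:
  "execute t (\<lambda>i y. \<sigma> i (F i y)) x h = execute t \<sigma> (\<lambda>i. F i (x i)) h"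
  by (induction t arbitrary: h) (simp_all add: Let_def)

text \<open>The easy direction of Yao's principle: the expected number of good inputs exceeds half
  of them, so some deterministic protocol in the support is good on at least half.\<close>

lemma averaging_pmf:
  fixes P :: "'p pmf" and \<Omega> :: "'x set"
  assumes fin: "finite \<Omega>" and ne: "\<Omega> \<noteq> {}" and \<delta>: "\<delta> < 1 / 2"
    and prob: "\<And>x. x \<in> \<Omega> \<Longrightarrow> measure_pmf.prob P {\<pi>. Q \<pi> x} \<ge> 1 - \<delta>"
  shows "\<exists>\<pi>\<in>set_pmf P. card \<Omega> \<le> 2 * card {x \<in> \<Omega>. Q \<pi> x}"
proof (rule ccontr)
  assume neg: "\<not> ?thesis"
  let ?f = "\<lambda>\<pi>. \<Sum>x\<in>\<Omega>. indicator {\<pi>. Q \<pi> x} \<pi> :: real"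
  have f: "?f \<pi> = real (card {x \<in> \<Omega>. Q \<pi> x})" for \<pi>
    using fin by (simp add: indicator_def sum.If_cases Int_def)
  have int: "integrable (measure_pmf P) (indicator {\<pi>. Q \<pi> x} :: 'p \<Rightarrow> real)" for x
    by (rule measure_pmf.integrable_const_bound[where B = 1]) auto
  have "measure_pmf.expectation P ?f = (\<Sum>x\<in>\<Omega>. measure_pmf.prob P {\<pi>. Q \<pi> x})"
    using int by (subst Bochner_Integration.integral_sum) auto
  also have "\<dots> \<ge> (\<Sum>x\<in>\<Omega>. 1 - \<delta>)" by (intro sum_mono prob)
  finally have lower: "real (card \<Omega>) * (1 - \<delta>) \<le> measure_pmf.expectation P ?f" by simp
  have "measure_pmf.expectation P ?f \<le> real (card \<Omega>) / 2"
  proof (rule measure_pmf.integral_le_const)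
    show "integrable (measure_pmf P) ?f" using int by (intro Bochner_Integration.integrable_sum)
    show "AE \<pi> in measure_pmf P. ?f \<pi> \<le> real (card \<Omega>) / 2"
      unfolding f AE_measure_pmf_iff using neg by (auto simp: not_le)
  qed
  moreover have "real (card \<Omega>) * (1 / 2) < real (card \<Omega>) * (1 - \<delta>)"
    using \<delta> fin ne by (intro mult_strict_left_mono) (auto simp: card_gt_0_iff)
  ultimately show False using lower by simp
qed

text \<open>
  The last two rows vote against each other, so that no column is unanimous and the clusters have
  positive conductance.
\<close>

definition vote_rows :: "nat \<Rightarrow> nat \<Rightarrow> (nat \<Rightarrow> nat set) \<Rightarrow> nat \<Rightarrow> nat set" where
  "vote_rows m N x i = (if i < m then x i else if i = m then {} else {..<N})"

text \<open>Everything that does not depend on the private bits goes to site 0. The two opposing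
  rows thus have no sites of their own, and \<open>m + 2\<close> may exceed
  \<open>s\<close>.\<close>

definition site_input :: "nat \<Rightarrow> nat \<Rightarrow> nat \<Rightarrow> nat \<Rightarrow> nat \<Rightarrow> nat \<Rightarrow> nat set \<Rightarrow> nat set set" where
  "site_input k q N r m i y = (if i < m then vote_edges k q N i y else {}) \<union>
    (if i = 0 then fixed_edges k q N r \<union> vote_edges k q N m {} \<union> vote_edges k q N (m + 1) {..<N} else {})"

locale vote_cube =
  fixes k q N r m s :: nat
  assumes k2: "k \<ge> 2" and r_less: "r < k" and odd_m: "odd m" and ms: "m \<le> s" and N1: "N \<ge> 1"
    and load_small: "16 * ((m + 2) * (N div q + 1) + 1) \<le> q"
    and sparse: "2 * (8 + k) * N * (m + 2) < q * (q - 1)"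
begin

sublocale rows: vote_graph k q N r "m + 2" "vote_rows m N x" for x
proof
  fix v assume "v < N"
  then have "v \<notin> vote_rows m N x m" "v \<in> vote_rows m N x (m + 1)" by (auto simp: vote_rows_def)
  moreover have "m < m + 2" "m + 1 < m + 2" by auto
  ultimately show "(\<exists>i<m + 2. v \<in> vote_rows m N x i) \<and> (\<exists>i<m + 2. v \<notin> vote_rows m N x i)" by blast
qed (use k2 r_less odd_m N1 load_small sparse in auto)

text \<open>The opposing rows add one vote to either side, so the threshold
  \<open>m + 2 < 2 * (a + 1)\<close> is the original one, \<open>m < 2 * a\<close>.\<close>

lemma majority_bit_iff:
  assumes v: "v < N"
  shows "rows.majority_bit x v \<longleftrightarrow> column_sum m v x > 0"
proof -
  have "{i \<in> {..<m + 2}. v \<in> vote_rows m N x i} = insert (m + 1) {i \<in> {..<m}. v \<in> x i}"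
    using v by (auto simp: vote_rows_def less_Suc_eq split: if_splits)
  then have "card {i \<in> {..<m + 2}. v \<in> vote_rows m N x i} = card {i \<in> {..<m}. v \<in> x i} + 1" by simp
  then have "rows.majority_bit x v \<longleftrightarrow> m < 2 * card {i \<in> {..<m}. v \<in> x i}"
    unfolding rows.majority_bit_def by simp
  then show ?thesis unfolding column_sum_eq by linarith
qed

lemma column_sum_nonzero: "column_sum m v x \<noteq> 0"
proof
  assume "column_sum m v x = 0"
  then have "2 * card {i \<in> {..<m}. v \<in> x i} = m" unfolding column_sum_eq by linarith
  then show False using odd_m by presburger
qed

lemma distributed: "distributed_among s (rows.E x) (\<lambda>i. site_input k q N r m i (x i))"
proof -
  have s1: "s \<ge> 1" using ms odd_m by (cases s) auto
  let ?V = "\<lambda>i. vote_edges k q N i"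
  have mem: "e \<in> site_input k q N r m i (x i) \<longleftrightarrow> (i < m \<and> e \<in> ?V i (x i)) \<or>
      (i = 0 \<and> (e \<in> fixed_edges k q N r \<or> e \<in> ?V m {} \<or> e \<in> ?V (m + 1) {..<N}))" for e i
    unfolding site_input_def by auto
  have "(\<Union>i<s. site_input k q N r m i (x i)) = rows.E x"
  proof (intro equalityI subsetI)
    fix e assume "e \<in> (\<Union>i<s. site_input k q N r m i (x i))"
    then obtain i where "e \<in> site_input k q N r m i (x i)" by blast
    then consider "i < m" "e \<in> ?V i (vote_rows m N x i)" | "e \<in> fixed_edges k q N r"
      | "e \<in> ?V m (vote_rows m N x m)" | "e \<in> ?V (m + 1) (vote_rows m N x (m + 1))"
      unfolding mem by (auto simp: vote_rows_def)
    then show "e \<in> rows.E x"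
      unfolding rows.E_def Un_iff UN_iff by cases (force simp: lessThan_iff)+
  next
    fix e assume "e \<in> rows.E x"
    then consider "e \<in> fixed_edges k q N r" | i where "i < m + 2" "e \<in> ?V i (vote_rows m N x i)"
      unfolding rows.E_def by blast
    then show "e \<in> (\<Union>i<s. site_input k q N r m i (x i))"
    proof cases
      case 1
      then have "e \<in> site_input k q N r m 0 (x 0)" unfolding mem by simp
      then show ?thesis using s1 by (intro UN_I[of 0]) auto
    next
      case (2 i)
      show ?thesis
      proof (cases "i < m")
        case True
        then have "e \<in> site_input k q N r m i (x i)" unfolding mem using 2(2) by (simp add: vote_rows_def)
        then show ?thesis using True ms by (intro UN_I[of i]) auto
      next
        case False
        then have "i = m \<or> i = m + 1" using 2(1) by linarith
        then have "e \<in> site_input k q N r m 0 (x 0)" unfolding mem using 2(2) by (auto simp: vote_rows_def)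
        then show ?thesis using s1 by (intro UN_I[of 0]) auto
      qed
    qed
  qed
  moreover have "disjoint_family_on (\<lambda>i. site_input k q N r m i (x i)) {..<s}"
    unfolding disjoint_family_on_def
  proof (intro ballI impI)
    have less: False if ij: "i < j" and e: "e \<in> site_input k q N r m i (x i)" "e \<in> site_input k q N r m j (x j)" for e i j
    proof -
      have j: "j < m" "e \<in> ?V j (x j)" using e(2) ij unfolding mem by auto
      from e(1) consider "i < m" "e \<in> ?V i (x i)" | "e \<in> fixed_edges k q N r" | "e \<in> ?V m {}" | "e \<in> ?V (m + 1) {..<N}"
        unfolding mem by auto
      then show False
      proof cases
        case 1
        then show ?thesis using rows.vote_edges_disjoint[of i j e "x i" "x j"] j ij by simp
      next
        case 2
        then show ?thesis using rows.vote_fixed_disjoint[of j "x j"] j by blast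
      next
        case 3
        then show ?thesis using rows.vote_edges_disjoint[of m j e "{}" "x j"] j by simp
      next
        case 4
        then show ?thesis using rows.vote_edges_disjoint[of "m + 1" j e "{..<N}" "x j"] j by simp
      qed
    qed
    fix i j :: nat assume "i \<noteq> j"
    then show "site_input k q N r m i (x i) \<inter> site_input k q N r m j (x j) = {}"
      using less[of i j] less[of j i] by (metis disjoint_iff nat_neq_iff)
  qed
  ultimately show ?thesis unfolding distributed_among_def by simp
qed

definition columns :: "nat set \<Rightarrow> nat set" where
  "columns S = {v \<in> {..<N}. \<exists>t<k. k * q + v * k + t \<in> S}"

definition consistent :: "nat set \<Rightarrow> (nat \<Rightarrow> nat set) \<Rightarrow> bool" where
  "consistent S x \<longleftrightarrow> (\<exists>j<k. \<forall>v<N. \<forall>t<k. k * q + v * k + t \<in> S \<longrightarrow>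
    (t + of_bool (column_sum m v x > 0)) mod k = j)"

text \<open>The coefficients may depend on the output only, so the signs are read off from an
  arbitrary input that is consistent with it.\<close>

definition guess :: "nat set \<Rightarrow> nat \<Rightarrow> real" where
  "guess S v = (if v \<in> columns S then sgn (column_sum m v (SOME x. consistent S x)) else 0)"

text \<open>
  An output reveals the majority bits of its columns only up to a common complement, since the same
  outer vertices can belong to either of two clusters; hence the absolute value.
\<close>

lemma guess_consistent:
  assumes x: "consistent S x"
  shows "(\<Sum>v\<in>columns S. \<bar>column_sum m v x\<bar>) \<le> \<bar>\<Sum>v<N. guess S v * column_sum m v x\<bar>"
proof -
  define x0 where "x0 = (SOME x. consistent S x)"
  have "consistent S x0" unfolding x0_def by (rule someI[of "consistent S", OF x])
  then obtain j0 where "\<forall>v<N. \<forall>t<k. k * q + v * k + t \<in> S \<longrightarrow>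
      (t + of_bool (column_sum m v x0 > 0)) mod k = j0" unfolding consistent_def by (elim exE conjE)
  note j0 = this[rule_format]
  obtain j where "\<forall>v<N. \<forall>t<k. k * q + v * k + t \<in> S \<longrightarrow>
      (t + of_bool (column_sum m v x > 0)) mod k = j" using x unfolding consistent_def by (elim exE conjE)
  note j = this[rule_format]
  \<comment> \<open>For both inputs the shift starts from the same \<open>t\<close>, so the bits
    agree exactly if the targets do. The comparison of \<open>j\<close> with \<open>j0\<close> is
    the same for all columns, hence so is the sign \<open>e\<close> below.\<close>
  have same: "(column_sum m v x > 0) = (column_sum m v x0 > 0) \<longleftrightarrow> j = j0" if v: "v \<in> columns S" for v
  proof -
    obtain t where t: "v < N" "t < k" "k * q + v * k + t \<in> S" using v unfolding columns_def by blast
    show ?thesis using rows.shift_inject[OF t(2)] j[OF t] j0[OF t] by metis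
  qed
  define e :: real where "e = (if j = j0 then 1 else - 1)"
  have "guess S v * column_sum m v x = e * \<bar>column_sum m v x\<bar>" if v: "v \<in> columns S" for v
    using same[OF v] v column_sum_nonzero[of v x] column_sum_nonzero[of v x0]
    unfolding guess_def x0_def[symmetric] e_def by (auto simp: sgn_if abs_if)
  then have "(\<Sum>v\<in>columns S. guess S v * column_sum m v x) = e * (\<Sum>v\<in>columns S. \<bar>column_sum m v x\<bar>)"
    by (simp add: sum_distrib_left)
  moreover have "(\<Sum>v<N. guess S v * column_sum m v x) = (\<Sum>v\<in>columns S. guess S v * column_sum m v x)"
    by (rule sum.mono_neutral_right) (auto simp: guess_def columns_def)
  ultimately have "\<bar>\<Sum>v<N. guess S v * column_sum m v x\<bar> = \<bar>e\<bar> * \<bar>\<Sum>v\<in>columns S. \<bar>column_sum m v x\<bar>\<bar>"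
    by (simp add: abs_mult)
  also have "\<dots> \<ge> (\<Sum>v\<in>columns S. \<bar>column_sum m v x\<bar>)" by (simp add: e_def)
  finally show ?thesis .
qed

lemma cluster_fraction_consistent:
  assumes "c > 0" and "real q + 1 \<le> c * real N / 2"
    and "cluster_fraction c rows.n k (rows.E x) S"
  shows "consistent S x" "c / 2 * real N \<le> real (card (columns S))"
proof -
  obtain j where "j < k" and j: "\<forall>v<N. \<forall>t<k. k * q + v * k + t \<in> S \<longrightarrow> (t + of_bool (rows.majority_bit x v)) mod k = j"
    and "c / 2 * real N \<le> real (card {v \<in> {..<N}. \<exists>t<k. k * q + v * k + t \<in> S})"
    using rows.cluster_fraction_columns[OF assms(1,3,2)] by blast
  then show "consistent S x" "c / 2 * real N \<le> real (card (columns S))"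
    unfolding consistent_def columns_def using majority_bit_iff[of _ x] by (auto simp del: of_bool_eq_1_iff)
qed

end

theorem theorem3p5:
  fixes k :: nat and c \<delta> C K :: real
  assumes "k \<ge> 2"
    and "0 < c" and "c \<le> 1"
    and "0 \<le> \<delta>" and "\<delta> < 1 / 2"
    and "C > 0" and "K > 0"
  shows "\<exists>\<alpha> > 0. \<exists>\<gamma> > 0. \<exists>n0 :: nat. \<forall>n \<ge> n0. \<forall>s :: nat. 1 \<le> s \<and> real s \<le> K * real n \<longrightarrow>
    (\<forall>P :: (nat set set, nat set) protocol pmf.
       protocol_for_sites s P \<and> outputs_cluster_fraction n s k \<alpha> C c \<delta> P \<longrightarrow>
       (\<exists>E X. well_clustered n k \<alpha> C E \<and> distributed_among s E X \<and>
          (\<exists>\<pi> \<in> set_pmf P. real (bits_sent \<pi> X) \<ge> \<gamma> * real n * real s)))"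
proof -
  \<comment> \<open>The constant of \<open>communication_lower_bound\<close> for
    \<open>d = c / 2\<close>, the fraction of columns that a correct output reveals.\<close>
  define \<tau> where "\<tau> = (c / 2) ^ 4 / 4096"
  have \<tau>: "\<tau> > 0" using assms(2) by (simp add: \<tau>_def)
  obtain \<gamma> and n0 :: nat where \<gamma>: "\<gamma> > 0" and params: "\<And>n s. n \<ge> n0 \<Longrightarrow> 1 \<le> s \<and> real s \<le> K * real n \<Longrightarrow>
    (\<exists>q N r m. n = k * q + k * N + r \<and> r < k \<and> odd m \<and> m \<le> s \<and> N \<ge> 1 \<and>
      16 * ((m + 2) * (N div q + 1) + 1) \<le> q \<and> 2 * (8 + k) * N * (m + 2) < q * (q - 1) \<and>
      4 * C * real k ^ 3 * real (N * (m + 2)) \<le> real (q * (q - 1)) \<and> real q + 1 \<le> c * real N / 2 \<and>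
      real N \<ge> 16 / \<tau>\<^sup>2 \<and> \<gamma> * real n * real s \<le> \<tau>\<^sup>2 / 16 * real N * real m)"
    using parameter_choice[OF assms(1-3,6,7) \<tau>] by blast
  show ?thesis
  \<comment> \<open>The expansion 1/8 is that of \<open>cluster_expansion\<close> and does not
    depend on the parameters.\<close>
  proof (rule exI[of _ "1 / 8"], rule conjI, simp, rule exI[of _ \<gamma>], rule conjI[OF \<gamma>],
      rule exI[of _ n0], intro allI impI, rule ccontr)
    fix n s :: nat and P :: "(nat set set, nat set) protocol pmf"
    assume n: "n \<ge> n0" and s: "1 \<le> s \<and> real s \<le> K * real n"
      and P: "protocol_for_sites s P \<and> outputs_cluster_fraction n s k (1 / 8) C c \<delta> P"
      and neg: "\<not> (\<exists>E X. well_clustered n k (1 / 8) C E \<and> distributed_among s E X \<and>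
          (\<exists>\<pi> \<in> set_pmf P. real (bits_sent \<pi> X) \<ge> \<gamma> * real n * real s))"
    obtain q N r m where n_eq: "n = k * q + k * N + r" and r: "r < k" and m: "odd m" "m \<le> s" and N1: "N \<ge> 1"
      and load: "16 * ((m + 2) * (N div q + 1) + 1) \<le> q" and sparse: "2 * (8 + k) * N * (m + 2) < q * (q - 1)"
      and ratio: "4 * C * real k ^ 3 * real (N * (m + 2)) \<le> real (q * (q - 1))"
      and qN: "real q + 1 \<le> c * real N / 2" and N: "real N \<ge> 16 / \<tau>\<^sup>2"
      and \<gamma>ns: "\<gamma> * real n * real s \<le> \<tau>\<^sup>2 / 16 * real N * real m"
      using params[OF n s] by blast
    interpret vote_cube k q N r m s
      using assms(1) r m N1 load sparse by unfold_locales
    have rows_n: "rows.n = n" unfolding rows.n_def n_eq ..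
    let ?\<Omega> = "sign_cube s m N"
    define X where "X x i = site_input k q N r m i (x i)" for x i
    have wc: "well_clustered n k (1 / 8) C (rows.E x)" for x
      using rows.well_clustered_E[of C x] ratio assms(6) unfolding rows_n by simp
    have dist: "distributed_among s (rows.E x) (X x)" for x
      using distributed unfolding X_def .
    \<comment> \<open>By \<open>neg\<close> every protocol in the support stays below the bound on
      every hard input, so the bound serves as \<open>B\<close> for whichever one the averaging
      selects.\<close>
    have bits: "real (bits_sent \<pi> (X x)) \<le> \<gamma> * real n * real s" if "\<pi> \<in> set_pmf P" for \<pi> x
      using neg wc dist that by (meson linear)
    let ?ok = "\<lambda>\<pi> x. cluster_fraction c n k (rows.E x) (output_of \<pi> (X x))"
    have "\<exists>\<pi>\<in>set_pmf P. card ?\<Omega> \<le> 2 * card {x \<in> ?\<Omega>. ?ok \<pi> x}"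
    proof (rule averaging_pmf[OF finite_sign_cube _ assms(5)])
      show "?\<Omega> \<noteq> {}" by (auto simp: PiE_eq_empty_iff sign_inputs_def)
      fix x
      show "measure_pmf.prob P {\<pi>. ?ok \<pi> x} \<ge> 1 - \<delta>"
        using P wc[of x] dist[of x] unfolding outputs_cluster_fraction_def by blast
    qed
    then obtain \<pi> where \<pi>: "\<pi> \<in> set_pmf P" and half: "card ?\<Omega> \<le> 2 * card {x \<in> ?\<Omega>. ?ok \<pi> x}" by blast
    let ?\<sigma> = "\<lambda>i y. fst \<pi> i (site_input k q N r m i y)"
    have exec: "execute (snd \<pi>) ?\<sigma> x (\<lambda>_. []) = execute (snd \<pi>) (fst \<pi>) (X x) (\<lambda>_. [])" for x
      unfolding X_def by (rule execute_precompose)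
    have "\<gamma> * real n * real s > \<tau>\<^sup>2 / 16 * real N * real m"
    proof (rule communication_lower_bound[where t = "snd \<pi>" and \<sigma> = ?\<sigma> and h = "\<lambda>_. []" and c = guess
          and d = "c / 2" and s = s and Z = "{x \<in> ?\<Omega>. ?ok \<pi> x}", OF m _ _ _ _ _ _ _ \<tau>_def N])
      show "0 < c / 2" "c / 2 \<le> 1" using assms(2,3) by auto
      show "sites_used (snd \<pi>) \<subseteq> {..<s}" using P \<pi> unfolding protocol_for_sites_def by blast
      show "{x \<in> ?\<Omega>. ?ok \<pi> x} \<subseteq> ?\<Omega>" by (rule Collect_restrict)
      show "card ?\<Omega> \<le> 2 * card {x \<in> ?\<Omega>. ?ok \<pi> x}" by (rule half)
      show "\<bar>guess out v\<bar> \<le> 1" for out v by (simp add: guess_def sgn_if)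
    next
      fix x assume "x \<in> {x \<in> ?\<Omega>. ?ok \<pi> x}"
      then have ok: "cluster_fraction c rows.n k (rows.E x) (output_of \<pi> (X x))" unfolding rows_n by blast
      note cons = cluster_fraction_consistent[OF assms(2) qN ok]
      have out: "fst (execute (snd \<pi>) ?\<sigma> x (\<lambda>_. [])) = output_of \<pi> (X x)"
        unfolding exec output_of_def ..
      show "\<exists>T\<subseteq>{..<N}. c / 2 * real N \<le> real (card T) \<and> (\<Sum>v\<in>T. \<bar>column_sum m v x\<bar>)
          \<le> \<bar>\<Sum>v<N. guess (fst (execute (snd \<pi>) ?\<sigma> x (\<lambda>_. []))) v * column_sum m v x\<bar>"
        unfolding out using cons(2) guess_consistent[OF cons(1)]
        by (intro exI[of _ "columns (output_of \<pi> (X x))"]) (auto simp: columns_def)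
    next
      fix x
      show "real (snd (execute (snd \<pi>) ?\<sigma> x (\<lambda>_. []))) \<le> \<gamma> * real n * real s"
        using bits[OF \<pi>, of x] unfolding exec bits_sent_def .
    qed
    then show False using \<gamma>ns by linarith
  qed
qed

end
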